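(* Let $(\mathcal C,\mathcal D)$ be a regular MASA inclusion, and let $(I(\mathcal D),\iota)$ be an injective envelope of $\mathcal D$. Then there exists a unique pseudo-expectation $E:\mathcal C\to I(\mathcal D)$ for $\iota$. Furthermore, for every $v\in\mathcal N(\mathcal C,\mathcal D)$: (a) $E(vh)=\iota(vh)$ for every $h\in J_v$; (b) $E(vh)=0$ for every $h\in K_v$; (c) $|E(v)|^2=\iota(v^*v)P$, where $P:=\sup_{I(\mathcal D)}\iota\big((J_v)_1^+\big)$.
   Context: All $C^*$-algebras are unital. An inclusion is a pair $(\mathcal C,\mathcal D)$ where $\mathcal C$ is a unital $C^*$-algebra and $\mathcal D\subseteq\mathcal C$ is an abelian $C^*$-subalgebra containing the unit $I$ of $\mathcal C$. Its set of normalizers is $\mathcal N(\mathcal C,\mathcal D)=\{v\in\mathcal C: v^*\mathcal Dv\cup v\mathcal Dv^*\subseteq\mathcal D\}$. The inclusion is regular if $\operatorname{span}\mathcal N(\mathcal C,\mathcal D)$ is norm dense in $\mathcal C$, and is a MASA inclusion if $\mathcal D$ is a maximal abelian $C^*$-subalgebra (MASA) of $\mathcal C$; a regular MASA inclusion is one that is both. An injective envelope of a unital abelian $C^*$-algebra $\mathcal D$ is a pair $(I(\mathcal D),\iota)$ with $I(\mathcal D)$ an injective unital abelian $C^*$-algebra and $\iota:\mathcal D\to I(\mathcal D)$ a unital injective $*$-homomorphism which is a rigid and essential extension. Injective $C^*$-algebras are monotone complete, so bounded increasing nets of self-adjoint elements of $I(\mathcal D)$ have a least upper bound, denoted $\sup_{I(\mathcal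 D)}$. A pseudo-expectation for $\iota$ is a unital completely positive map $E:\mathcal C\to I(\mathcal D)$ with $E|_{\mathcal D}=\iota$. For $S\subseteq\mathcal D$, $\langle S\rangle$ is the closed ideal of $\mathcal D$ generated by $S$; for a closed ideal $\mathfrak J$ of $\mathcal D$, $\mathfrak J^\perp=\{d\in\mathcal D: dg=0\ \forall g\in\mathfrak J\}$; $\mathfrak J_1\vee\mathfrak J_2$ is the closed ideal generated by $\mathfrak J_1$ and $\mathfrak J_2$. For $v\in\mathcal N(\mathcal C,\mathcal D)$ put $$J_v=\{d\in\mathcal D: vd=dv\in\mathcal D\}\cap\langle v^*v\rangle,\qquad K_v=\langle v^*v\rangle^\perp\vee\langle\{v^*hv-hv^*v: h\in\mathcal D\}\rangle .$$ $(J_v)_1^+$ is the set of positive elements of norm at most $1$ in $J_v$, regarded as an increasing net indexed by itself. *)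

theory Defs
  imports
    "HOL-Analysis.Abstract_Metric_Spaces"
    "HOL-Algebra.Subrings"
begin

section \<open>Unital C*-algebras\<close>

definition complex_ring :: "complex ring" where
  "complex_ring = \<lparr> carrier = UNIV, monoid.mult = (*), one = 1, ring.zero = 0, add = (+) \<rparr>"

record 'a cstar = "(complex, 'a) module" +
  star :: "'a \<Rightarrow> 'a" (\<open>_\<^sup>\<star>\<index>\<close> [1000] 999)
  nrm :: "'a \<Rightarrow> real"

text \<open>The distance is made 0 off the carrier because \<^locale>\<open>Metric_space\<close> asks for
  nonnegativity and symmetry on the whole type.\<close>

definition cdist :: "('a, 'm) cstar_scheme \<Rightarrow> 'a \<Rightarrow> 'a \<Rightarrow> real" where
  "cdist A x y = (if x \<in> carrier A \<and> y \<in> carrier A then nrm A (x \<ominus>\<^bsub>A\<^esub> y) else 0)"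

definition norm_topology :: "('a, 'm) cstar_scheme \<Rightarrow> 'a topology" where
  "norm_topology A = Metric_space.mtopology (carrier A) (cdist A)"

locale cstar_algebra =
  Module.module complex_ring A + ring A
  for A :: "('a, 'm) cstar_scheme" (structure) +
  assumes smult_mult_left:
      "x \<in> carrier A \<Longrightarrow> y \<in> carrier A \<Longrightarrow> (c \<odot> x) \<otimes> y = c \<odot> (x \<otimes> y)"
    and smult_mult_right:
      "x \<in> carrier A \<Longrightarrow> y \<in> carrier A \<Longrightarrow> x \<otimes> (c \<odot> y) = c \<odot> (x \<otimes> y)"
    and star_closed: "x \<in> carrier A \<Longrightarrow> x\<^sup>\<star> \<in> carrier A"
    and star_star: "x \<in> carrier A \<Longrightarrow> (x\<^sup>\<star>)\<^sup>\<star> = x"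
    and star_add: "x \<in> carrier A \<Longrightarrow> y \<in> carrier A \<Longrightarrow> (x \<oplus> y)\<^sup>\<star> = x\<^sup>\<star> \<oplus> y\<^sup>\<star>"
    and star_smult: "x \<in> carrier A \<Longrightarrow> (c \<odot> x)\<^sup>\<star> = cnj c \<odot> x\<^sup>\<star>"
    and star_mult: "x \<in> carrier A \<Longrightarrow> y \<in> carrier A \<Longrightarrow> (x \<otimes> y)\<^sup>\<star> = y\<^sup>\<star> \<otimes> x\<^sup>\<star>"
    and nrm_nonneg: "x \<in> carrier A \<Longrightarrow> 0 \<le> nrm A x"
    and nrm_eq_0_iff: "x \<in> carrier A \<Longrightarrow> nrm A x = 0 \<longleftrightarrow> x = \<zero>"
    and nrm_triangle:
      "x \<in> carrier A \<Longrightarrow> y \<in> carrier A \<Longrightarrow> nrm A (x \<oplus> y) \<le> nrm A x + nrm A y"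
    and nrm_smult: "x \<in> carrier A \<Longrightarrow> nrm A (c \<odot> x) = cmod c * nrm A x"
    and nrm_mult:
      "x \<in> carrier A \<Longrightarrow> y \<in> carrier A \<Longrightarrow> nrm A (x \<otimes> y) \<le> nrm A x * nrm A y"
    and cstar_identity: "x \<in> carrier A \<Longrightarrow> nrm A (x\<^sup>\<star> \<otimes> x) = (nrm A x)\<^sup>2"
    and complete: "Metric_space.mcomplete (carrier A) (cdist A)"

definition selfadjoint_elements :: "('a, 'm) cstar_scheme \<Rightarrow> 'a set" where
  "selfadjoint_elements A = {x \<in> carrier A. x\<^sup>\<star>\<^bsub>A\<^esub> = x}"

definition positive_elements :: "('a, 'm) cstar_scheme \<Rightarrow> 'a set" where
  "positive_elements A = {y\<^sup>\<star>\<^bsub>A\<^esub> \<otimes>\<^bsub>A\<^esub> y | y. y \<in> carrier A}"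

definition cstar_le :: "('a, 'm) cstar_scheme \<Rightarrow> 'a \<Rightarrow> 'a \<Rightarrow> bool" where
  "cstar_le A x y \<longleftrightarrow> y \<ominus>\<^bsub>A\<^esub> x \<in> positive_elements A"

definition is_sup :: "('a, 'm) cstar_scheme \<Rightarrow> 'a set \<Rightarrow> 'a \<Rightarrow> bool" where
  "is_sup A S p \<longleftrightarrow> p \<in> selfadjoint_elements A \<and> (\<forall>x\<in>S. cstar_le A x p) \<and>
     (\<forall>q \<in> selfadjoint_elements A. (\<forall>x\<in>S. cstar_le A x q) \<longrightarrow> cstar_le A p q)"

definition linear_span :: "('a, 'm) cstar_scheme \<Rightarrow> 'a set \<Rightarrow> 'a set" where
  "linear_span A S = \<Inter>{V. submodule V complex_ring A \<and> S \<subseteq> V}"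

definition cstar_hom ::
    "('a, 'm) cstar_scheme \<Rightarrow> ('b, 'n) cstar_scheme \<Rightarrow> ('a \<Rightarrow> 'b) set" where
  "cstar_hom A B = {f \<in> ring_hom A B.
     (\<forall>x \<in> carrier A. \<forall>c. f (c \<odot>\<^bsub>A\<^esub> x) = c \<odot>\<^bsub>B\<^esub> f x) \<and>
     (\<forall>x \<in> carrier A. f (x\<^sup>\<star>\<^bsub>A\<^esub>) = (f x)\<^sup>\<star>\<^bsub>B\<^esub>)}"

section \<open>Matrix algebras and completely positive maps\<close>

text \<open>The n by n matrices over A are functions of two indices that vanish outside
  \<open>{..<n} \<times> {..<n}\<close>.  The C*-norm is the operator norm for the action by left
  multiplication on columns, i.e. on the Hilbert A-module of n-tuples with
  \<open>\<parallel>x\<parallel>\<^sup>2 = \<parallel>\<Sum>i. x\<^sub>i\<^sup>\<star> x\<^sub>i\<parallel>\<close>.\<close>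

definition column_norm :: "nat \<Rightarrow> ('a, 'm) cstar_scheme \<Rightarrow> (nat \<Rightarrow> 'a) \<Rightarrow> real" where
  "column_norm n A x = sqrt (nrm A (\<Oplus>\<^bsub>A\<^esub>i\<in>{..<n}. (x i)\<^sup>\<star>\<^bsub>A\<^esub> \<otimes>\<^bsub>A\<^esub> x i))"

definition matrix_algebra ::
    "nat \<Rightarrow> ('a, 'm) cstar_scheme \<Rightarrow> (nat \<Rightarrow> nat \<Rightarrow> 'a) cstar" where
  "matrix_algebra n A =
    \<lparr> carrier = {M. \<forall>i j. if i < n \<and> j < n then M i j \<in> carrier A else M i j = \<zero>\<^bsub>A\<^esub>},
      monoid.mult = (\<lambda>M N i j. if i < n \<and> j < n
        then \<Oplus>\<^bsub>A\<^esub>k\<in>{..<n}. M i k \<otimes>\<^bsub>A\<^esub> N k j else \<zero>\<^bsub>A\<^esub>),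
      one = (\<lambda>i j. if i < n \<and> i = j then \<one>\<^bsub>A\<^esub> else \<zero>\<^bsub>A\<^esub>),
      ring.zero = (\<lambda>i j. \<zero>\<^bsub>A\<^esub>),
      add = (\<lambda>M N i j. M i j \<oplus>\<^bsub>A\<^esub> N i j),
      module.smult = (\<lambda>c M i j. c \<odot>\<^bsub>A\<^esub> M i j),
      star = (\<lambda>M i j. (M j i)\<^sup>\<star>\<^bsub>A\<^esub>),
      nrm = (\<lambda>M. SUP x \<in> {x. (\<forall>i<n. x i \<in> carrier A) \<and> column_norm n A x \<le> 1}.
        column_norm n A (\<lambda>i. \<Oplus>\<^bsub>A\<^esub>k\<in>{..<n}. M i k \<otimes>\<^bsub>A\<^esub> x k)) \<rparr>"

definition amplify :: "('a \<Rightarrow> 'b) \<Rightarrow> (nat \<Rightarrow> nat \<Rightarrow> 'a) \<Rightarrow> nat \<Rightarrow> nat \<Rightarrow> 'b" where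
  "amplify \<phi> M = (\<lambda>i j. \<phi> (M i j))"

definition operator_system :: "('a, 'm) cstar_scheme \<Rightarrow> 'a set \<Rightarrow> bool" where
  "operator_system B S \<longleftrightarrow> submodule S complex_ring B \<and>
     \<one>\<^bsub>B\<^esub> \<in> S \<and> (\<forall>x\<in>S. x\<^sup>\<star>\<^bsub>B\<^esub> \<in> S)"

text \<open>Unital completely positive maps from an operator system \<open>S \<subseteq> B\<close> to \<open>A\<close>.\<close>

definition ucp :: "('b, 'n) cstar_scheme \<Rightarrow> 'b set \<Rightarrow> ('a, 'm) cstar_scheme \<Rightarrow> ('b \<Rightarrow> 'a) \<Rightarrow> bool"
  where
  "ucp B S A \<phi> \<longleftrightarrow>
     \<phi> \<in> S \<rightarrow> carrier A \<and>
     (\<forall>x\<in>S. \<forall>y\<in>S. \<phi> (x \<oplus>\<^bsub>B\<^esub> y) = \<phi> x \<oplus>\<^bsub>A\<^esub> \<phi> y) \<and>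
     (\<forall>c. \<forall>x\<in>S. \<phi> (c \<odot>\<^bsub>B\<^esub> x) = c \<odot>\<^bsub>A\<^esub> \<phi> x) \<and>
     \<phi> \<one>\<^bsub>B\<^esub> = \<one>\<^bsub>A\<^esub> \<and>
     (\<forall>n. \<forall>M \<in> positive_elements (matrix_algebra n B). (\<forall>i<n. \<forall>j<n. M i j \<in> S) \<longrightarrow>
        amplify \<phi> M \<in> positive_elements (matrix_algebra n A))"

definition completely_isometric ::
    "('b, 'n) cstar_scheme \<Rightarrow> ('a, 'm) cstar_scheme \<Rightarrow> ('b \<Rightarrow> 'a) \<Rightarrow> bool" where
  "completely_isometric B A \<phi> \<longleftrightarrow>
     (\<forall>n. \<forall>M \<in> carrier (matrix_algebra n B).
        nrm (matrix_algebra n A) (amplify \<phi> M) = nrm (matrix_algebra n B) M)"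

section \<open>Injective envelopes\<close>

text \<open>Injectivity and essentiality quantify over all unital C*-algebras B.  A HOL formula
  cannot quantify over types, so B ranges over the C*-algebras whose carrier is a subset of a
  type \<open>'u\<close>, which should be large.  For A abelian on a type \<open>'a\<close>, injectivity with respect to
  \<open>'u = ('a \<Rightarrow> complex) \<Rightarrow> complex\<close> (or any type into which this one embeds) already gives the
  extension property for B on every type: the bounded functions on the character space of A
  form an injective C*-algebra on that type, and extending the inverse of the Gelfand map makes
  A a retract of it.\<close>

definition injective_cstar :: "'u itself \<Rightarrow> ('a, 'm) cstar_scheme \<Rightarrow> bool" where
  "injective_cstar (_ :: 'u itself) A \<longleftrightarrow>
     (\<forall>(B :: 'u cstar) S \<phi>. cstar_algebra B \<and> operator_system B S \<and> ucp B S A \<phi> \<longrightarrow>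
        (\<exists>\<psi>. ucp B (carrier B) A \<psi> \<and> (\<forall>x\<in>S. \<psi> x = \<phi> x)))"

definition rigid_extension ::
    "('d, 'n) cstar_scheme \<Rightarrow> ('a, 'm) cstar_scheme \<Rightarrow> ('d \<Rightarrow> 'a) \<Rightarrow> bool" where
  "rigid_extension D A \<iota> \<longleftrightarrow>
     (\<forall>\<phi>. ucp A (carrier A) A \<phi> \<and> (\<forall>d \<in> carrier D. \<phi> (\<iota> d) = \<iota> d) \<longrightarrow>
        (\<forall>x \<in> carrier A. \<phi> x = x))"

text \<open>Essentiality in the sense of Hamana, for unital completely positive maps into B.\<close>

definition essential_extension ::
    "'u itself \<Rightarrow> ('d, 'n) cstar_scheme \<Rightarrow> ('a, 'm) cstar_scheme \<Rightarrow> ('d \<Rightarrow> 'a) \<Rightarrow> bool" where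
  "essential_extension (_ :: 'u itself) D A \<iota> \<longleftrightarrow>
     (\<forall>(B :: 'u cstar) \<phi>. cstar_algebra B \<and> ucp A (carrier A) B \<phi> \<and>
        completely_isometric D B (\<phi> \<circ> \<iota>) \<longrightarrow> completely_isometric A B \<phi>)"

definition injective_envelope ::
    "'u itself \<Rightarrow> ('d, 'n) cstar_scheme \<Rightarrow> ('a, 'm) cstar_scheme \<Rightarrow> ('d \<Rightarrow> 'a) \<Rightarrow> bool" where
  "injective_envelope U D A \<iota> \<longleftrightarrow>
     cstar_algebra A \<and> cring A \<and> injective_cstar U A \<and>
     \<iota> \<in> cstar_hom D A \<and> inj_on \<iota> (carrier D) \<and>
     rigid_extension D A \<iota> \<and> essential_extension U D A \<iota>"

section \<open>Inclusions\<close>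

definition abelian_cstar_subalgebra :: "('a, 'm) cstar_scheme \<Rightarrow> 'a set \<Rightarrow> bool" where
  "abelian_cstar_subalgebra C D \<longleftrightarrow> subcring D C \<and>
     (\<forall>c. \<forall>x\<in>D. c \<odot>\<^bsub>C\<^esub> x \<in> D) \<and> (\<forall>x\<in>D. x\<^sup>\<star>\<^bsub>C\<^esub> \<in> D) \<and>
     closedin (norm_topology C) D"

definition inclusion :: "('a, 'm) cstar_scheme \<Rightarrow> 'a set \<Rightarrow> bool" where
  "inclusion C D \<longleftrightarrow> cstar_algebra C \<and> abelian_cstar_subalgebra C D"

definition normalizers :: "('a, 'm) cstar_scheme \<Rightarrow> 'a set \<Rightarrow> 'a set" where
  "normalizers C D = {v \<in> carrier C. \<forall>d\<in>D.
     v\<^sup>\<star>\<^bsub>C\<^esub> \<otimes>\<^bsub>C\<^esub> d \<otimes>\<^bsub>C\<^esub> v \<in> D \<and> v \<otimes>\<^bsub>C\<^esub> d \<otimes>\<^bsub>C\<^esub> v\<^sup>\<star>\<^bsub>C\<^esub> \<in> D}"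

definition regular_inclusion :: "('a, 'm) cstar_scheme \<Rightarrow> 'a set \<Rightarrow> bool" where
  "regular_inclusion C D \<longleftrightarrow> inclusion C D \<and>
     norm_topology C closure_of linear_span C (normalizers C D) = carrier C"

definition MASA_inclusion :: "('a, 'm) cstar_scheme \<Rightarrow> 'a set \<Rightarrow> bool" where
  "MASA_inclusion C D \<longleftrightarrow> inclusion C D \<and>
     (\<forall>E. abelian_cstar_subalgebra C E \<and> D \<subseteq> E \<longrightarrow> E = D)"

definition regular_MASA_inclusion :: "('a, 'm) cstar_scheme \<Rightarrow> 'a set \<Rightarrow> bool" where
  "regular_MASA_inclusion C D \<longleftrightarrow> regular_inclusion C D \<and> MASA_inclusion C D"

definition pseudo_expectation ::
    "('c, 'n) cstar_scheme \<Rightarrow> 'c set \<Rightarrow> ('a, 'm) cstar_scheme \<Rightarrow> ('c \<Rightarrow> 'a) \<Rightarrow> ('c \<Rightarrow> 'a) \<Rightarrow> bool"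
  where
  "pseudo_expectation C D A \<iota> E \<longleftrightarrow> ucp C (carrier C) A E \<and> (\<forall>d\<in>D. E d = \<iota> d)"

section \<open>Ideals attached to a normalizer\<close>

definition closed_ideal_gen :: "('a, 'm) cstar_scheme \<Rightarrow> 'a set \<Rightarrow> 'a set" where
  "closed_ideal_gen D S = \<Inter>{J. ideal J D \<and> closedin (norm_topology D) J \<and> S \<subseteq> J}"

definition ideal_perp :: "('a, 'm) cstar_scheme \<Rightarrow> 'a set \<Rightarrow> 'a set" where
  "ideal_perp D J = {d \<in> carrier D. \<forall>g\<in>J. d \<otimes>\<^bsub>D\<^esub> g = \<zero>\<^bsub>D\<^esub>}"

definition ideal_join :: "('a, 'm) cstar_scheme \<Rightarrow> 'a set \<Rightarrow> 'a set \<Rightarrow> 'a set" where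
  "ideal_join D J1 J2 = closed_ideal_gen D (J1 \<union> J2)"

definition J_ideal :: "('a, 'm) cstar_scheme \<Rightarrow> 'a set \<Rightarrow> 'a \<Rightarrow> 'a set" where
  "J_ideal C D v =
     {d \<in> D. v \<otimes>\<^bsub>C\<^esub> d = d \<otimes>\<^bsub>C\<^esub> v \<and> v \<otimes>\<^bsub>C\<^esub> d \<in> D} \<inter>
     closed_ideal_gen (C\<lparr>carrier := D\<rparr>) {v\<^sup>\<star>\<^bsub>C\<^esub> \<otimes>\<^bsub>C\<^esub> v}"

definition K_ideal :: "('a, 'm) cstar_scheme \<Rightarrow> 'a set \<Rightarrow> 'a \<Rightarrow> 'a set" where
  "K_ideal C D v = ideal_join (C\<lparr>carrier := D\<rparr>)
     (ideal_perp (C\<lparr>carrier := D\<rparr>)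
        (closed_ideal_gen (C\<lparr>carrier := D\<rparr>) {v\<^sup>\<star>\<^bsub>C\<^esub> \<otimes>\<^bsub>C\<^esub> v}))
     (closed_ideal_gen (C\<lparr>carrier := D\<rparr>)
        {v\<^sup>\<star>\<^bsub>C\<^esub> \<otimes>\<^bsub>C\<^esub> h \<otimes>\<^bsub>C\<^esub> v \<ominus>\<^bsub>C\<^esub> h \<otimes>\<^bsub>C\<^esub> v\<^sup>\<star>\<^bsub>C\<^esub> \<otimes>\<^bsub>C\<^esub> v | h. h \<in> D})"

definition J_positive_ball :: "('a, 'm) cstar_scheme \<Rightarrow> 'a set \<Rightarrow> 'a \<Rightarrow> 'a set" where
  "J_positive_ball C D v =
     {h \<in> J_ideal C D v. h \<in> positive_elements (C\<lparr>carrier := D\<rparr>) \<and> nrm C h \<le> 1}"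

end

theory Submission
  imports Defs
begin

text \<open>Let \<open>v\<close> be a normalizer. The ideals \<open>J\<^sub>v\<close> and \<open>K\<^sub>v\<close> annihilate each other, and
  nothing in \<open>D\<close> annihilates both: if \<open>g \<in> K\<^sub>v\<^sup>\<bottom>\<close> then \<open>v g\<close> commutes with \<open>D\<close>, so
  \<open>v g \<in> D\<close> by maximality, and hence \<open>g\<^sup>\<star> g v\<^sup>\<star> v \<in> J\<^sub>v\<close>. A pseudo-expectation is a
  \<open>D\<close>-bimodule map because \<open>D\<close> lies in its multiplicative domain. Since \<open>A\<close> is abelian,
  this forces \<open>E (v h) = 0\<close> on the generators of \<open>K\<^sub>v\<close>, while \<open>E (v h) = \<iota> (v h)\<close> on \<open>J\<^sub>v\<close> is
  immediate. So everything follows once we know that only \<open>0\<close> annihilates both \<open>\<iota> (J\<^sub>v)\<close> and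
  \<open>\<iota> (K\<^sub>v)\<close> in \<open>A\<close>, and that the projection \<open>P\<close> exists. Both come from one use of injectivity:
  the pairs in \<open>A \<times> A\<close> that agree with \<open>(\<iota> d, \<iota> d)\<close> up to annihilators of \<open>\<iota> (J\<^sub>v)\<close> and
  \<open>\<iota> (K\<^sub>v)\<close> form an operator system, which \<open>(x, y) \<mapsto> \<iota> d\<close> maps completely positively to \<open>A\<close>.
  An extension \<open>\<psi>\<close> to \<open>A \<times> A\<close> is the identity on the diagonal by rigidity, and \<open>P = \<psi> (1, 0)\<close>.

  Complete positivity is obtained without Gelfand theory: the Visser iteration gives square roots
  of elements and of matrices, and over an abelian C*-algebra a hermitian matrix with nonnegative
  quadratic form is a Gram matrix.\<close>

section \<open>Norm and convergence in C*-algebras\<close>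

text \<open>The obstacle lies between \<open>D\<close> and \<open>A\<close>. That nothing in
  \<open>D\<close> annihilates both ideals is plain algebra, but an element of \<open>A\<close> need
  not be a limit of elements of \<iota>(D), so approximation does not carry this over. Rigidity
  does: if \<open>a\<close> annihilates both, the pair (a, a) agrees with (0, 0) in the operator
  system, so \<psi> sends it to 0, while \<psi> is the identity on the diagonal. Two coordinates are
  used because each is tested against one ideal only; this lets (\<iota> j, 0) stand for j and
  (\<iota> k, 0) for 0, and so makes \<psi> (1, 0) act as 1 on J and as 0 on K.

  Uniqueness and the modulus formula are settled by the same device: two elements of
  \<open>A\<close> are equal if they agree after multiplication by \<iota> of J and of K. The
  elements compared are E v and E' v, respectively |E v|^2 and \<iota> (s) P with s =
  \<open>v\<^sup>\<star> v\<close>.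

  Injectivity is given for algebras inside one fixed type. The sum type in the theorem has room for
  C, where E is extended, and for pairs over \<open>A\<close>, where \<psi> lives.\<close>

lemma complex_ring_simps [simp]:
  "carrier complex_ring = UNIV" "x \<otimes>\<^bsub>complex_ring\<^esub> y = x * y" "\<one>\<^bsub>complex_ring\<^esub> = 1"
  "\<zero>\<^bsub>complex_ring\<^esub> = 0" "x \<oplus>\<^bsub>complex_ring\<^esub> y = x + y"
  by (simp_all add: complex_ring_def)

lemma cring_complex_ring: "cring complex_ring"
proof (rule cringI)
  have "\<exists>y. y + x = 0" for x :: complex
    by (rule exI[of _ "- x"]) simp
  then show "abelian_group complex_ring"
    by (intro abelian_groupI) (auto simp: algebra_simps)
  show "comm_monoid complex_ring"
    by (rule comm_monoidI) auto
qed (auto simp: algebra_simps)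

text \<open>Membership of all terms and of the limit in the carrier is built in, so the limit rules
  for sums and products carry no closure premises.\<close>

definition converges :: "('a, 'm) cstar_scheme \<Rightarrow> (nat \<Rightarrow> 'a) \<Rightarrow> 'a \<Rightarrow> bool" where
  "converges A f l \<longleftrightarrow> (\<forall>n. f n \<in> carrier A) \<and> l \<in> carrier A \<and> (\<lambda>n. nrm A (f n \<ominus>\<^bsub>A\<^esub> l)) \<longlonglongrightarrow> 0"

context cstar_algebra
begin

lemma smult_cl [simp, intro]: "x \<in> carrier A \<Longrightarrow> c \<odot> x \<in> carrier A"
  using smult_closed[of c x] by simp

lemma smult_add_left: "x \<in> carrier A \<Longrightarrow> (c + d) \<odot> x = c \<odot> x \<oplus> d \<odot> x"
  using smult_l_distr[of c d x] by simp

lemma smult_add_right: "x \<in> carrier A \<Longrightarrow> y \<in> carrier A \<Longrightarrow> c \<odot> (x \<oplus> y) = c \<odot> x \<oplus> c \<odot> y"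
  using smult_r_distr[of c x y] by simp

lemma smult_smult [simp]: "x \<in> carrier A \<Longrightarrow> c \<odot> (d \<odot> x) = (c * d) \<odot> x"
  using smult_assoc1[of c d x] by simp

lemma smult_1 [simp]: "x \<in> carrier A \<Longrightarrow> 1 \<odot> x = x"
  using smult_one[of x] by simp

lemma smult_0 [simp]: "x \<in> carrier A \<Longrightarrow> 0 \<odot> x = \<zero>"
  using smult_l_null[of x] by simp

lemma smult_zero [simp]: "c \<odot> \<zero> = \<zero>"
  using smult_r_null[of c] by simp

declare star_closed [simp, intro] star_star [simp]

lemma sum_eq_zeroD: "x \<in> carrier A \<Longrightarrow> y \<in> carrier A \<Longrightarrow> x \<oplus> y = \<zero> \<Longrightarrow> \<ominus> x = y"
  by (metis minus_equality a_comm)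

lemma smult_minus_left: "x \<in> carrier A \<Longrightarrow> (- c) \<odot> x = \<ominus> (c \<odot> x)"
  by (rule sum_eq_zeroD[symmetric]) (simp_all flip: smult_add_left)

lemma smult_minus_right: "x \<in> carrier A \<Longrightarrow> c \<odot> (\<ominus> x) = \<ominus> (c \<odot> x)"
  by (rule sum_eq_zeroD[symmetric]) (simp_all add: r_neg flip: smult_add_right)

lemma minus_as_smult: "x \<in> carrier A \<Longrightarrow> \<ominus> x = (- 1) \<odot> x"
  by (simp add: smult_minus_left)

lemma smult_diff_right:
  "x \<in> carrier A \<Longrightarrow> y \<in> carrier A \<Longrightarrow> c \<odot> (x \<ominus> y) = c \<odot> x \<ominus> c \<odot> y"
  by (simp add: minus_eq smult_add_right smult_minus_right)

lemma sum_halves: "x \<in> carrier A \<Longrightarrow> (1/2) \<odot> x \<oplus> (1/2) \<odot> x = x"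
  by (simp flip: smult_add_left)

lemma star_zero [simp]: "\<zero>\<^sup>\<star> = \<zero>"
  using star_smult[of \<zero> 0] by simp

lemma star_one [simp]: "\<one>\<^sup>\<star> = \<one>"
  by (metis l_one one_closed r_one star_closed star_mult star_star)

lemma star_minus: "x \<in> carrier A \<Longrightarrow> (\<ominus> x)\<^sup>\<star> = \<ominus> (x\<^sup>\<star>)"
  by (simp add: minus_as_smult star_smult)

lemma star_diff: "x \<in> carrier A \<Longrightarrow> y \<in> carrier A \<Longrightarrow> (x \<ominus> y)\<^sup>\<star> = x\<^sup>\<star> \<ominus> y\<^sup>\<star>"
  by (simp add: minus_eq star_add star_minus)

lemmas star_simps = star_add star_diff star_minus star_mult star_smult

lemma diff_self [simp]: "x \<in> carrier A \<Longrightarrow> x \<ominus> x = \<zero>"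
  by (simp add: minus_eq r_neg)

lemma diff_eq_zero_iff: "x \<in> carrier A \<Longrightarrow> y \<in> carrier A \<Longrightarrow> x \<ominus> y = \<zero> \<longleftrightarrow> x = y"
  by (simp add: r_right_minus_eq)

lemma nrm_zero [simp]: "nrm A \<zero> = 0"
  by (simp add: nrm_eq_0_iff)

lemma nrm_minus [simp]: "x \<in> carrier A \<Longrightarrow> nrm A (\<ominus> x) = nrm A x"
  by (simp add: minus_as_smult nrm_smult)

lemma nrm_diff_commute: "x \<in> carrier A \<Longrightarrow> y \<in> carrier A \<Longrightarrow> nrm A (x \<ominus> y) = nrm A (y \<ominus> x)"
  using nrm_minus[of "x \<ominus> y"] by (simp add: minus_eq minus_add a_comm)

lemma nrm_diff_le: "x \<in> carrier A \<Longrightarrow> y \<in> carrier A \<Longrightarrow> nrm A (x \<ominus> y) \<le> nrm A x + nrm A y"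
  using nrm_triangle[of x "\<ominus> y"] by (simp add: minus_eq)

lemma diff_add_diff:
  "x \<in> carrier A \<Longrightarrow> y \<in> carrier A \<Longrightarrow> z \<in> carrier A \<Longrightarrow> (x \<ominus> y) \<oplus> (y \<ominus> z) = x \<ominus> z"
  by algebra

lemma nrm_diff_triangle:
  assumes "x \<in> carrier A" "y \<in> carrier A" "z \<in> carrier A"
  shows "nrm A (x \<ominus> z) \<le> nrm A (x \<ominus> y) + nrm A (y \<ominus> z)"
  using nrm_triangle[of "x \<ominus> y" "y \<ominus> z"] assms by (simp add: diff_add_diff)

lemma nrm_le_add_diff: "x \<in> carrier A \<Longrightarrow> y \<in> carrier A \<Longrightarrow> nrm A x \<le> nrm A y + nrm A (x \<ominus> y)"
  using nrm_triangle[of y "x \<ominus> y"] by (simp add: minus_eq a_lcomm r_neg)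

text \<open>The C*-identity and submultiplicativity bound ||y||^2 by the product of ||y|| and the
  norm of the adjoint; after cancelling, the same is applied to the adjoint.\<close>

lemma nrm_star [simp]: assumes x: "x \<in> carrier A" shows "nrm A (x\<^sup>\<star>) = nrm A x"
proof -
  have le: "nrm A y \<le> nrm A (y\<^sup>\<star>)" if y: "y \<in> carrier A" for y
  proof (cases "nrm A y = 0")
    case False
    have "nrm A y * nrm A y \<le> nrm A (y\<^sup>\<star>) * nrm A y"
      using cstar_identity[OF y] nrm_mult[of "y\<^sup>\<star>" y] y by (simp add: power2_eq_square)
    then show ?thesis
      using False nrm_nonneg[OF y] by simp
  qed (use y in \<open>simp add: nrm_nonneg\<close>)
  show ?thesis
    using le[OF x] le[OF star_closed[OF x]] x by simp
qed

text \<open>Equality can fail: the unit of the zero algebra has norm 0. The relation ||1|| = ||1||^2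
  leaves the values 0 and 1.\<close>

lemma nrm_one_le: "nrm A \<one> \<le> 1"
proof -
  have "nrm A \<one> = (nrm A \<one>)\<^sup>2"
    using cstar_identity[of \<one>] by simp
  then have "nrm A \<one> * (1 - nrm A \<one>) = 0"
    by (simp add: power2_eq_square algebra_simps)
  then show ?thesis
    by auto
qed

lemma Metric_space: "Metric_space (carrier A) (cdist A)"
proof
  fix x y z
  show "0 \<le> cdist A x y"
    by (simp add: cdist_def nrm_nonneg)
  show "cdist A x y = cdist A y x"
    by (simp add: cdist_def nrm_diff_commute)
  assume "x \<in> carrier A" "y \<in> carrier A"
  then show "cdist A x y = 0 \<longleftrightarrow> x = y"
    by (simp add: cdist_def nrm_eq_0_iff diff_eq_zero_iff)
  assume "z \<in> carrier A"
  with \<open>x \<in> carrier A\<close> \<open>y \<in> carrier A\<close> show "cdist A x z \<le> cdist A x y + cdist A y z"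
    by (simp add: cdist_def nrm_diff_triangle)
qed

interpretation Metric_space "carrier A" "cdist A"
  by (rule Metric_space)

lemma converges_iff_limitin:
  assumes "\<And>n. f n \<in> carrier A"
  shows "converges A f l \<longleftrightarrow> limitin mtopology f l sequentially"
  using assms by (auto simp: converges_def limitin_metric_dist_null cdist_def)

lemma Cauchy_converges:
  assumes f: "\<And>n. f n \<in> carrier A"
    and cauchy: "\<And>e. 0 < e \<Longrightarrow> \<exists>N. \<forall>m\<ge>N. \<forall>n\<ge>N. nrm A (f m \<ominus> f n) < e"
  shows "\<exists>l. converges A f l"
proof -
  have "MCauchy f"
    unfolding MCauchy_def using f cauchy by (auto simp: cdist_def)
  then show ?thesis
    using complete f by (auto simp: mcomplete_def converges_iff_limitin)
qed

lemma closedin_norm_topology_iff: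
  "closedin (norm_topology A) S \<longleftrightarrow>
    S \<subseteq> carrier A \<and> (\<forall>f l. range f \<subseteq> S \<and> converges A f l \<longrightarrow> l \<in> S)"
proof -
  have "converges A f l \<longleftrightarrow> limitin mtopology f l sequentially" if "S \<subseteq> carrier A" "range f \<subseteq> S" for f l
    using that by (intro converges_iff_limitin) auto
  then show ?thesis
    unfolding norm_topology_def metric_closedin_iff_sequentially_closed by metis
qed

lemma topspace_norm_topology [simp]: "topspace (norm_topology A) = carrier A"
  by (simp add: norm_topology_def)

lemma converges_closed: "converges A f l \<Longrightarrow> f n \<in> carrier A" "converges A f l \<Longrightarrow> l \<in> carrier A"
  by (auto simp: converges_def)

lemma converges_const: "x \<in> carrier A \<Longrightarrow> converges A (\<lambda>n. x) x"
  by (simp add: converges_def)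

lemma converges_bound:
  assumes "\<And>n. f n \<in> carrier A" "l \<in> carrier A" "\<And>n. nrm A (f n \<ominus> l) \<le> e n" "e \<longlonglongrightarrow> 0"
  shows "converges A f l"
  using assms unfolding converges_def
  by (auto intro: tendsto_sandwich[OF _ _ tendsto_const[of 0] assms(4)] simp: nrm_nonneg)

lemma converges_unique:
  assumes "converges A f l" "converges A f l'" shows "l = l'"
proof -
  have "limitin mtopology f l sequentially" "limitin mtopology f l' sequentially"
    using assms by (simp_all add: converges_def flip: converges_iff_limitin)
  then show ?thesis
    using limitin_metric_unique trivial_limit_sequentially by blast
qed

lemma converges_add:
  assumes "converges A f l" "converges A g m"
  shows "converges A (\<lambda>n. f n \<oplus> g n) (l \<oplus> m)"
proof (rule converges_bound)
  note [simp] = converges_closed[OF assms(1)] converges_closed[OF assms(2)]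
  have "(f n \<oplus> g n) \<ominus> (l \<oplus> m) = (f n \<ominus> l) \<oplus> (g n \<ominus> m)" for n
    using converges_closed[OF assms(1)] converges_closed[OF assms(2)] by algebra
  then show "nrm A ((f n \<oplus> g n) \<ominus> (l \<oplus> m)) \<le> nrm A (f n \<ominus> l) + nrm A (g n \<ominus> m)" for n
    by (simp add: nrm_triangle)
  show "(\<lambda>n. nrm A (f n \<ominus> l) + nrm A (g n \<ominus> m)) \<longlonglongrightarrow> 0"
    using assms tendsto_add[of _ 0 _ _ 0] by (fastforce simp: converges_def)
qed (use assms in \<open>auto simp: converges_def\<close>)

lemma converges_smult:
  assumes "converges A f l"
  shows "converges A (\<lambda>n. c \<odot> f n) (c \<odot> l)"
proof (rule converges_bound)
  note [simp] = converges_closed[OF assms]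
  show "nrm A (c \<odot> f n \<ominus> c \<odot> l) \<le> cmod c * nrm A (f n \<ominus> l)" for n
    by (simp flip: smult_diff_right add: nrm_smult)
  show "(\<lambda>n. cmod c * nrm A (f n \<ominus> l)) \<longlonglongrightarrow> 0"
    using assms tendsto_mult_left[of _ 0] by (fastforce simp: converges_def)
qed (use assms in \<open>auto simp: converges_def\<close>)

lemma converges_diff:
  assumes "converges A f l" "converges A g m"
  shows "converges A (\<lambda>n. f n \<ominus> g n) (l \<ominus> m)"
  using converges_add[OF assms(1) converges_smult[OF assms(2), of "-1"]] assms
  by (simp add: converges_closed minus_eq flip: minus_as_smult)

lemma converges_star:
  assumes "converges A f l"
  shows "converges A (\<lambda>n. (f n)\<^sup>\<star>) (l\<^sup>\<star>)"
  using assms by (auto simp: converges_def simp flip: star_diff)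

lemma converges_nrm:
  assumes "converges A f l"
  shows "(\<lambda>n. nrm A (f n)) \<longlonglongrightarrow> nrm A l"
proof (rule Lim_null[THEN iffD2], rule Lim_null_comparison)
  note [simp] = converges_closed[OF assms]
  have "nrm A (f n) \<le> nrm A l + nrm A (f n \<ominus> l)" "nrm A l \<le> nrm A (f n) + nrm A (f n \<ominus> l)" for n
    using nrm_le_add_diff[of "f n" l] nrm_le_add_diff[of l "f n"] nrm_diff_commute[of l "f n"] by auto
  then show "\<forall>\<^sub>F n in sequentially. norm (nrm A (f n) - nrm A l) \<le> nrm A (f n \<ominus> l)"
    by (auto simp: abs_le_iff algebra_simps)
qed (use assms in \<open>simp add: converges_def\<close>)

lemma converges_nrm_le:
  assumes "converges A f l" "\<And>n. nrm A (f n) \<le> c"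
  shows "nrm A l \<le> c"
  using LIMSEQ_le_const2[OF converges_nrm[OF assms(1)]] assms(2) by blast

lemma converges_mult:
  assumes "converges A f l" "converges A g m"
  shows "converges A (\<lambda>n. f n \<otimes> g n) (l \<otimes> m)"
proof (rule converges_bound)
  note [simp] = converges_closed[OF assms(1)] converges_closed[OF assms(2)]
  have "(f n \<otimes> g n) \<ominus> (l \<otimes> m) = (f n \<ominus> l) \<otimes> g n \<oplus> l \<otimes> (g n \<ominus> m)" for n
    using converges_closed[OF assms(1)] converges_closed[OF assms(2)] by algebra
  then have "nrm A ((f n \<otimes> g n) \<ominus> (l \<otimes> m)) \<le> nrm A ((f n \<ominus> l) \<otimes> g n) + nrm A (l \<otimes> (g n \<ominus> m))" for n
    by (simp add: nrm_triangle)
  then show "nrm A ((f n \<otimes> g n) \<ominus> (l \<otimes> m)) \<le> nrm A (f n \<ominus> l) * nrm A (g n) + nrm A l * nrm A (g n \<ominus> m)" for n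
    by (rule order_trans) (simp add: nrm_mult add_mono)
  have "(\<lambda>n. nrm A (f n \<ominus> l) * nrm A (g n) + nrm A l * nrm A (g n \<ominus> m)) \<longlonglongrightarrow> 0 * nrm A m + nrm A l * 0"
    using assms by (intro tendsto_intros converges_nrm) (auto simp: converges_def)
  then show "(\<lambda>n. nrm A (f n \<ominus> l) * nrm A (g n) + nrm A l * nrm A (g n \<ominus> m)) \<longlonglongrightarrow> 0"
    by simp
qed (use assms in \<open>auto simp: converges_def\<close>)

end

section \<open>Finite sums and the square root iteration\<close>

text \<open>A recursion instead of \<open>finsum\<close>, whose definition involves the carrier:
  here passing to a subalgebra changes nothing, and only the terms below \<open>n\<close> have to
  lie in the carrier.\<close>

primrec vsum :: "('a, 'm) cstar_scheme \<Rightarrow> (nat \<Rightarrow> 'a) \<Rightarrow> nat \<Rightarrow> 'a" where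
  "vsum A f 0 = \<zero>\<^bsub>A\<^esub>"
| "vsum A f (Suc n) = vsum A f n \<oplus>\<^bsub>A\<^esub> f n"

lemma vsum_cong: "(\<And>k. k < n \<Longrightarrow> f k = g k) \<Longrightarrow> vsum A f n = vsum A g n"
  by (induction n) auto

lemma vsum_subalgebra [simp]: "vsum (A\<lparr>carrier := D\<rparr>) f n = vsum A f n"
  by (induction n) auto

text \<open>Outside the n by n block nothing is demanded, in contrast to
  \<open>matrix_algebra\<close>; matrix identities are therefore stated entrywise for indices below
  \<open>n\<close>.\<close>

definition entries_in :: "('a, 'm) cstar_scheme \<Rightarrow> nat \<Rightarrow> (nat \<Rightarrow> nat \<Rightarrow> 'a) \<Rightarrow> bool" where
  "entries_in A n T \<longleftrightarrow> (\<forall>i<n. \<forall>j<n. T i j \<in> carrier A)"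

definition mat_mult ::
    "('a, 'm) cstar_scheme \<Rightarrow> nat \<Rightarrow> (nat \<Rightarrow> nat \<Rightarrow> 'a) \<Rightarrow> (nat \<Rightarrow> nat \<Rightarrow> 'a) \<Rightarrow> nat \<Rightarrow> nat \<Rightarrow> 'a" where
  "mat_mult A n T S = (\<lambda>i j. vsum A (\<lambda>k. T i k \<otimes>\<^bsub>A\<^esub> S k j) n)"

definition mat_adj :: "('a, 'm) cstar_scheme \<Rightarrow> (nat \<Rightarrow> nat \<Rightarrow> 'a) \<Rightarrow> nat \<Rightarrow> nat \<Rightarrow> 'a" where
  "mat_adj A T = (\<lambda>i j. (T j i)\<^sup>\<star>\<^bsub>A\<^esub>)"

definition mat_id :: "('a, 'm) cstar_scheme \<Rightarrow> nat \<Rightarrow> nat \<Rightarrow> 'a" where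
  "mat_id A = (\<lambda>i j. if i = j then \<one>\<^bsub>A\<^esub> else \<zero>\<^bsub>A\<^esub>)"

text \<open>The Visser iteration for \<open>1 - \<surd>(1 - t)\<close>, carried out for matrices so that it serves both
  the algebra itself (\<open>n = 1\<close>) and the matrices over it.\<close>

primrec root_iter ::
    "('a, 'm) cstar_scheme \<Rightarrow> nat \<Rightarrow> (nat \<Rightarrow> nat \<Rightarrow> 'a) \<Rightarrow> nat \<Rightarrow> nat \<Rightarrow> nat \<Rightarrow> 'a" where
  "root_iter A n t 0 = (\<lambda>i j. (1/2) \<odot>\<^bsub>A\<^esub> t i j)"
| "root_iter A n t (Suc k) = (\<lambda>i j. (1/2) \<odot>\<^bsub>A\<^esub>
    (t i j \<oplus>\<^bsub>A\<^esub> mat_mult A n (root_iter A n t k) (root_iter A n t k) i j))"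

text \<open>The same iteration for the scalar t = 1. It majorizes the iterates for every t of norm
  at most 1, and its increments majorize theirs.\<close>

primrec root_bound :: "nat \<Rightarrow> real" where
  "root_bound 0 = 1/2"
| "root_bound (Suc k) = (1 + (root_bound k)\<^sup>2) / 2"

lemma root_bound_range: "0 < root_bound k \<and> root_bound k < 1"
proof (induction k)
  case (Suc k)
  then have "(root_bound k)\<^sup>2 < 1"
    by (simp add: power_less_one_iff)
  then show ?case
    by (simp add: add_pos_nonneg)
qed auto

lemma root_bound_increasing: "root_bound k < root_bound (Suc k)"
proof -
  have "root_bound (Suc k) - root_bound k = (1 - root_bound k)\<^sup>2 / 2"
    by (simp add: power2_eq_square field_simps)
  moreover have "(1 - root_bound k)\<^sup>2 > 0"
    using root_bound_range[of k] by simp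
  ultimately show ?thesis
    by linarith
qed

lemma incseq_root_bound: "incseq root_bound"
  using root_bound_increasing by (auto intro!: incseq_SucI less_imp_le)

context cstar_algebra
begin

lemma vsum_closed [simp, intro]: "(\<And>k. k < n \<Longrightarrow> f k \<in> carrier A) \<Longrightarrow> vsum A f n \<in> carrier A"
  by (induction n) auto

lemma finsum_eq_vsum:
  "(\<And>k. k < n \<Longrightarrow> f k \<in> carrier A) \<Longrightarrow> finsum A f {..<n} = vsum A f n"
proof (induction n)
  case (Suc n)
  then have "finsum A f (insert n {..<n}) = f n \<oplus> finsum A f {..<n}"
    by (intro finsum_insert) auto
  with Suc show ?case
    by (simp add: lessThan_Suc a_comm)
qed simp

lemma vsum_zero: "(\<And>k. k < n \<Longrightarrow> f k = \<zero>) \<Longrightarrow> vsum A f n = \<zero>"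
  by (induction n) auto

lemma vsum_add:
  "(\<And>k. k < n \<Longrightarrow> f k \<in> carrier A) \<Longrightarrow> (\<And>k. k < n \<Longrightarrow> g k \<in> carrier A) \<Longrightarrow>
    vsum A (\<lambda>k. f k \<oplus> g k) n = vsum A f n \<oplus> vsum A g n"
proof (induction n)
  case (Suc n)
  have "vsum A f n \<in> carrier A" "vsum A g n \<in> carrier A"
    using Suc.prems by auto
  with Suc show ?case
    by (simp add: a_ac)
qed simp

lemma vsum_smult:
  "(\<And>k. k < n \<Longrightarrow> f k \<in> carrier A) \<Longrightarrow> vsum A (\<lambda>k. c \<odot> f k) n = c \<odot> vsum A f n"
  by (induction n) (auto simp: smult_add_right)

lemma vsum_diff:
  "(\<And>k. k < n \<Longrightarrow> f k \<in> carrier A) \<Longrightarrow> (\<And>k. k < n \<Longrightarrow> g k \<in> carrier A) \<Longrightarrow>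
    vsum A (\<lambda>k. f k \<ominus> g k) n = vsum A f n \<ominus> vsum A g n"
proof (induction n)
  case (Suc n)
  have *: "vsum A f n \<in> carrier A" "vsum A g n \<in> carrier A" "f n \<in> carrier A" "g n \<in> carrier A"
    using Suc.prems by auto
  then have "vsum A f n \<ominus> vsum A g n \<oplus> (f n \<ominus> g n) = vsum A f n \<oplus> f n \<ominus> (vsum A g n \<oplus> g n)"
    by algebra
  with Suc show ?case
    by simp
qed simp

lemma vsum_mult_left:
  "(\<And>k. k < n \<Longrightarrow> f k \<in> carrier A) \<Longrightarrow> x \<in> carrier A \<Longrightarrow>
    x \<otimes> vsum A f n = vsum A (\<lambda>k. x \<otimes> f k) n"
  by (induction n) (auto simp: r_distr)

lemma vsum_mult_right:
  "(\<And>k. k < n \<Longrightarrow> f k \<in> carrier A) \<Longrightarrow> x \<in> carrier A \<Longrightarrow>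
    vsum A f n \<otimes> x = vsum A (\<lambda>k. f k \<otimes> x) n"
  by (induction n) (auto simp: l_distr)

lemma vsum_star:
  "(\<And>k. k < n \<Longrightarrow> f k \<in> carrier A) \<Longrightarrow> (vsum A f n)\<^sup>\<star> = vsum A (\<lambda>k. (f k)\<^sup>\<star>) n"
  by (induction n) (auto simp: star_add)

lemma vsum_swap:
  "(\<And>i j. i < m \<Longrightarrow> j < n \<Longrightarrow> f i j \<in> carrier A) \<Longrightarrow>
    vsum A (\<lambda>i. vsum A (\<lambda>j. f i j) n) m = vsum A (\<lambda>j. vsum A (\<lambda>i. f i j) m) n"
  by (induction m) (auto simp: vsum_zero vsum_add)

lemma vsum_delta:
  "i < n \<Longrightarrow> (\<And>k. k < n \<Longrightarrow> f k \<in> carrier A) \<Longrightarrow> (\<And>k. k < n \<Longrightarrow> k \<noteq> i \<Longrightarrow> f k = \<zero>) \<Longrightarrow> vsum A f n = f i"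
proof (induction n)
  case (Suc n)
  show ?case
  proof (cases "i = n")
    case True
    have "vsum A f n = \<zero>"
      using Suc.prems True by (intro vsum_zero) auto
    with True Suc.prems show ?thesis
      by simp
  next
    case False
    with Suc show ?thesis
      by auto
  qed
qed simp

lemma converges_vsum:
  "(\<And>k. k < n \<Longrightarrow> converges A (\<lambda>m. f m k) (l k)) \<Longrightarrow>
    converges A (\<lambda>m. vsum A (f m) n) (vsum A l n)"
  by (induction n) (auto intro: converges_add converges_const)

lemma mat_mult_closed: "entries_in A n T \<Longrightarrow> entries_in A n S \<Longrightarrow> entries_in A n (mat_mult A n T S)"
  by (auto simp: entries_in_def mat_mult_def)

lemma mat_mult_id_left: "entries_in A n T \<Longrightarrow> i < n \<Longrightarrow> j < n \<Longrightarrow> mat_mult A n (mat_id A) T i j = T i j"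
  unfolding mat_mult_def by (subst vsum_delta[of i]) (auto simp: mat_id_def entries_in_def)

lemma mat_mult_id_right: "entries_in A n T \<Longrightarrow> i < n \<Longrightarrow> j < n \<Longrightarrow> mat_mult A n T (mat_id A) i j = T i j"
  unfolding mat_mult_def by (subst vsum_delta[of j]) (auto simp: mat_id_def entries_in_def)

text \<open>The increments telescope, so a Cauchy estimate for the real sequence \<open>r\<close> is
  one for \<open>f\<close>.\<close>

lemma increments_converge:
  assumes f: "\<And>k. f k \<in> carrier A"
    and step: "\<And>k. nrm A (f (Suc k) \<ominus> f k) \<le> r (Suc k) - r k" and r: "convergent r"
  shows "\<exists>l. converges A f l"
proof (rule Cauchy_converges[OF f])
  have le: "nrm A (f (m + p) \<ominus> f m) \<le> r (m + p) - r m" for m p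
  proof (induction p)
    case (Suc p)
    then show ?case
      using nrm_diff_triangle[of "f (Suc (m + p))" "f (m + p)" "f m"] step[of "m + p"] f by simp
  qed (use f in simp)
  have abs: "nrm A (f m \<ominus> f n) \<le> \<bar>r m - r n\<bar>" for m n
  proof (cases "n \<le> m")
    case True
    then show ?thesis
      using le[of n "m - n"] by simp
  next
    case False
    then show ?thesis
      using le[of m "n - m"] nrm_diff_commute[of "f m" "f n"] f by simp
  qed
  fix e :: real assume "0 < e"
  then obtain N where "\<forall>m\<ge>N. \<forall>n\<ge>N. norm (r m - r n) < e"
    using r by (meson CauchyD Cauchy_convergent_iff)
  then show "\<exists>N. \<forall>m\<ge>N. \<forall>n\<ge>N. nrm A (f m \<ominus> f n) < e"
    using abs by (metis le_less_trans real_norm_def)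
qed

text \<open>A difference of squares, split as T T - S S = (T - S) T + S (T - S), which is valid
  without commutation of T and S.\<close>

lemma mat_mult_diff:
  assumes T: "entries_in A n T" and S: "entries_in A n S" and ij: "i < n" "j < n"
  shows "mat_mult A n T T i j \<ominus> mat_mult A n S S i j =
    mat_mult A n (\<lambda>i j. T i j \<ominus> S i j) T i j \<oplus> mat_mult A n S (\<lambda>i j. T i j \<ominus> S i j) i j"
proof -
  have [simp]: "T p q \<in> carrier A" "S p q \<in> carrier A" if "p < n" "q < n" for p q
    using T S that by (auto simp: entries_in_def)
  have "(T i k \<ominus> S i k) \<otimes> T k j \<oplus> S i k \<otimes> (T k j \<ominus> S k j) = T i k \<otimes> T k j \<ominus> S i k \<otimes> S k j"
    if "k < n" for k
  proof -
    have "T i k \<in> carrier A" "S i k \<in> carrier A" "T k j \<in> carrier A" "S k j \<in> carrier A"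
      using that ij by auto
    then show ?thesis
      by algebra
  qed
  then show ?thesis
    using ij unfolding mat_mult_def
    by (subst vsum_diff[symmetric], simp, simp, subst vsum_add[symmetric], simp, simp)
      (auto intro!: vsum_cong)
qed

text \<open>The predicate \<open>bd T c\<close> plays the role of \<open>\<parallel>T\<parallel> \<le> c\<close> for a matrix norm that
  dominates the norms of the entries.\<close>

lemma root_iter_converges:
  assumes t: "entries_in A n t"
    and bd_cong: "\<And>T S c. (\<And>i j. i < n \<Longrightarrow> j < n \<Longrightarrow> T i j = S i j) \<Longrightarrow> bd T c \<Longrightarrow> bd S c"
    and bd_entry: "\<And>T c i j. entries_in A n T \<Longrightarrow> bd T c \<Longrightarrow> 0 < c \<Longrightarrow> i < n \<Longrightarrow> j < n \<Longrightarrow>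
      nrm A (T i j) \<le> c"
    and bd_add: "\<And>T S c d. entries_in A n T \<Longrightarrow> entries_in A n S \<Longrightarrow> bd T c \<Longrightarrow> bd S d \<Longrightarrow> 0 < c \<Longrightarrow>
      0 < d \<Longrightarrow> bd (\<lambda>i j. T i j \<oplus> S i j) (c + d)"
    and bd_mult: "\<And>T S c d. entries_in A n T \<Longrightarrow> entries_in A n S \<Longrightarrow> bd T c \<Longrightarrow> bd S d \<Longrightarrow> 0 < c \<Longrightarrow>
      0 < d \<Longrightarrow> bd (mat_mult A n T S) (c * d)"
    and bd_half: "\<And>T c. entries_in A n T \<Longrightarrow> bd T c \<Longrightarrow> 0 < c \<Longrightarrow> bd (\<lambda>i j. (1/2) \<odot> T i j) (c / 2)"
    and bd_t: "bd t 1"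
  shows "(\<forall>k. bd (root_iter A n t k) (root_bound k)) \<and>
    (\<exists>Y. \<forall>i<n. \<forall>j<n. converges A (\<lambda>k. root_iter A n t k i j) (Y i j))"
proof -
  let ?y = "root_iter A n t"
  have y: "entries_in A n (?y k)" for k
  proof (induction k)
    case 0
    show ?case
      using t by (auto simp: entries_in_def)
  next
    case (Suc k)
    show ?case
      using t mat_mult_closed[OF Suc Suc] by (auto simp: entries_in_def)
  qed
  have yc [simp]: "?y k i j \<in> carrier A" if "i < n" "j < n" for i j k
    using y[of k] that by (auto simp: entries_in_def)
  have tc [simp]: "t i j \<in> carrier A" if "i < n" "j < n" for i j
    using t that by (auto simp: entries_in_def)
  have mc [simp]: "mat_mult A n (?y k) (?y k) i j \<in> carrier A" if "i < n" "j < n" for i j k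
    using mat_mult_closed[OF y y, of k k] that by (auto simp: entries_in_def)
  have bd_y: "bd (?y k) (root_bound k)" for k
  proof (induction k)
    case 0
    show ?case
      using bd_half[OF t bd_t] by simp
  next
    case (Suc k)
    have r: "0 < root_bound k * root_bound k"
      using root_bound_range by simp
    have "bd (\<lambda>i j. t i j \<oplus> mat_mult A n (?y k) (?y k) i j) (1 + root_bound k * root_bound k)"
      using root_bound_range r by (intro bd_add t mat_mult_closed y bd_t bd_mult Suc) auto
    then have "bd (\<lambda>i j. (1/2) \<odot> (t i j \<oplus> mat_mult A n (?y k) (?y k) i j)) ((1 + root_bound k * root_bound k) / 2)"
      using r by (intro bd_half) (auto simp: entries_in_def)
    then show ?case
      by (simp add: power2_eq_square)
  qed
  define \<Delta> where "\<Delta> k = (\<lambda>i j. ?y (Suc k) i j \<ominus> ?y k i j)" for k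
  have \<Delta>: "entries_in A n (\<Delta> k)" for k
    using y unfolding \<Delta>_def entries_in_def by (meson minus_closed)
  \<comment> \<open>By \<open>mat_mult_diff\<close>, the next difference is half of \<Delta> k times
    y (k+1) plus y k times \<Delta> k. The differences of \<open>root_bound\<close> obey the same
    recursion, so the bounds match exactly.\<close>
  have bd_\<Delta>: "bd (\<Delta> k) (root_bound (Suc k) - root_bound k)" for k
  proof (induction k)
    case 0
    have "bd (\<lambda>i j. (1/2) \<odot> mat_mult A n (?y 0) (?y 0) i j) (root_bound 0 * root_bound 0 / 2)"
      by (intro bd_half mat_mult_closed y bd_mult bd_y) auto
    moreover have "(1/2) \<odot> mat_mult A n (?y 0) (?y 0) i j = \<Delta> 0 i j" if "i < n" "j < n" for i j
    proof -
      have "t i j \<oplus> mat_mult A n (?y 0) (?y 0) i j \<ominus> t i j = mat_mult A n (?y 0) (?y 0) i j"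
        using tc[OF that] mc[OF that, of 0] by algebra
      then show ?thesis
        using that tc[OF that] mc[OF that, of 0]
        by (simp add: \<Delta>_def flip: smult_diff_right)
    qed
    ultimately show ?case
      by (rule_tac bd_cong) (auto simp: power2_eq_square)
  next
    case (Suc k)
    let ?d = "root_bound (Suc k) - root_bound k"
    have d: "0 < ?d"
      using root_bound_increasing[of k] by linarith
    have r: "0 < root_bound k" "0 < root_bound (Suc k)"
      using root_bound_range by blast+
    let ?M = "\<lambda>i j. mat_mult A n (\<Delta> k) (?y (Suc k)) i j \<oplus> mat_mult A n (?y k) (\<Delta> k) i j"
    have "bd ?M (?d * root_bound (Suc k) + root_bound k * ?d)"
      using d r by (intro bd_add mat_mult_closed y \<Delta> bd_mult bd_y Suc mult_pos_pos)
    moreover have "entries_in A n ?M"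
      using mat_mult_closed[OF \<Delta> y, of k "Suc k"] mat_mult_closed[OF y \<Delta>, of k k]
      by (auto simp: entries_in_def)
    ultimately have "bd (\<lambda>i j. (1/2) \<odot> ?M i j) ((?d * root_bound (Suc k) + root_bound k * ?d) / 2)"
      using d r by (intro bd_half add_pos_pos mult_pos_pos)
    moreover have "(1/2) \<odot> ?M i j = \<Delta> (Suc k) i j" if "i < n" "j < n" for i j
    proof -
      have "?M i j = mat_mult A n (?y (Suc k)) (?y (Suc k)) i j \<ominus> mat_mult A n (?y k) (?y k) i j"
        unfolding \<Delta>_def by (rule mat_mult_diff[OF y y that, symmetric])
      also have "\<dots> = (t i j \<oplus> mat_mult A n (?y (Suc k)) (?y (Suc k)) i j) \<ominus> (t i j \<oplus> mat_mult A n (?y k) (?y k) i j)"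
        using tc[OF that] mc[OF that, of k] mc[OF that, of "Suc k"] by algebra
      also have "(1/2) \<odot> \<dots> = \<Delta> (Suc k) i j"
        using tc[OF that] mc[OF that, of k] mc[OF that, of "Suc k"]
        by (simp only: \<Delta>_def root_iter.simps(2) smult_diff_right a_closed)
      finally show ?thesis .
    qed
    moreover have "(?d * root_bound (Suc k) + root_bound k * ?d) / 2 = root_bound (Suc (Suc k)) - root_bound (Suc k)"
      by (simp add: power2_eq_square field_simps)
    ultimately show ?case
      by (metis (no_types, lifting) bd_cong)
  qed
  have conv: "convergent root_bound"
    using incseq_convergent[OF incseq_root_bound, of 1] root_bound_range by (metis convergentI less_imp_le)
  have "\<exists>l. converges A (\<lambda>k. ?y k i j) l" if "i < n" "j < n" for i j
  proof (rule increments_converge[OF _ _ conv])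
    fix k
    have "nrm A (\<Delta> k i j) \<le> root_bound (Suc k) - root_bound k"
      using \<Delta> bd_\<Delta> root_bound_increasing that by (intro bd_entry[of "\<Delta> k"]) auto
    then show "nrm A (?y (Suc k) i j \<ominus> ?y k i j) \<le> root_bound (Suc k) - root_bound k"
      by (simp add: \<Delta>_def)
  qed (use that in simp)
  then have "\<exists>Y. \<forall>i<n. \<forall>j<n. converges A (\<lambda>k. ?y k i j) (Y i j)"
    by metis
  with bd_y show ?thesis
    by blast
qed

text \<open>The limit solves Y = (t + Y^2) / 2, which is (1 - Y)^2 = 1 - t after completing the
  square.\<close>

lemma root_iter_limit:
  assumes t: "entries_in A n t"
    and Y: "\<And>i j. i < n \<Longrightarrow> j < n \<Longrightarrow> converges A (\<lambda>k. root_iter A n t k i j) (Y i j)"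
    and ij: "i < n" "j < n"
  shows "mat_mult A n (\<lambda>i j. mat_id A i j \<ominus> Y i j) (\<lambda>i j. mat_id A i j \<ominus> Y i j) i j = mat_id A i j \<ominus> t i j"
proof -
  have tc [simp]: "t i j \<in> carrier A"
    using t ij by (auto simp: entries_in_def)
  have Yc [simp]: "Y i j \<in> carrier A" if "i < n" "j < n" for i j
    using Y[OF that] by (rule converges_closed)
  then have YE: "entries_in A n Y"
    by (simp add: entries_in_def)
  have mc [simp]: "mat_mult A n Y Y i j \<in> carrier A"
    using mat_mult_closed[OF YE YE] ij by (auto simp: entries_in_def)
  have idc [simp]: "mat_id A p q \<in> carrier A" for p q
    by (simp add: mat_id_def)
  have "converges A (\<lambda>k. root_iter A n t (Suc k) i j) ((1/2) \<odot> (t i j \<oplus> mat_mult A n Y Y i j))"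
    using Y ij unfolding mat_mult_def root_iter.simps
    by (intro converges_smult converges_add converges_const converges_vsum converges_mult) auto
  moreover have "converges A (\<lambda>k. root_iter A n t (Suc k) i j) (Y i j)"
    using Y[OF ij] by (auto simp: converges_def intro: LIMSEQ_Suc simp del: root_iter.simps)
  ultimately have "Y i j = (1/2) \<odot> (t i j \<oplus> mat_mult A n Y Y i j)"
    by (rule converges_unique[symmetric])
  then have eq: "Y i j \<oplus> Y i j = t i j \<oplus> mat_mult A n Y Y i j"
    using sum_halves[of "t i j \<oplus> mat_mult A n Y Y i j"] by simp
  have "(mat_id A i k \<ominus> Y i k) \<otimes> (mat_id A k j \<ominus> Y k j) =
      (mat_id A i k \<otimes> (mat_id A k j \<ominus> Y k j)) \<ominus> (Y i k \<otimes> mat_id A k j \<ominus> Y i k \<otimes> Y k j)" if "k < n" for k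
  proof -
    have "Y i k \<in> carrier A" "Y k j \<in> carrier A" "mat_id A i k \<in> carrier A" "mat_id A k j \<in> carrier A"
      using that ij by auto
    then show ?thesis
      by algebra
  qed
  then have "mat_mult A n (\<lambda>i j. mat_id A i j \<ominus> Y i j) (\<lambda>i j. mat_id A i j \<ominus> Y i j) i j =
      vsum A (\<lambda>k. (mat_id A i k \<otimes> (mat_id A k j \<ominus> Y k j)) \<ominus> (Y i k \<otimes> mat_id A k j \<ominus> Y i k \<otimes> Y k j)) n"
    unfolding mat_mult_def by (rule vsum_cong)
  also have "\<dots> = vsum A (\<lambda>k. mat_id A i k \<otimes> (mat_id A k j \<ominus> Y k j)) n \<ominus>
      (vsum A (\<lambda>k. Y i k \<otimes> mat_id A k j) n \<ominus> vsum A (\<lambda>k. Y i k \<otimes> Y k j) n)"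
    using ij by (subst vsum_diff; (subst vsum_diff)?) auto
  also have "\<dots> = (mat_id A i j \<ominus> Y i j) \<ominus> (Y i j \<ominus> mat_mult A n Y Y i j)"
    using ij mat_mult_id_left[of n "\<lambda>i j. mat_id A i j \<ominus> Y i j" i j] mat_mult_id_right[OF YE ij]
    by (simp add: mat_mult_def entries_in_def)
  also have "\<dots> = mat_id A i j \<ominus> (Y i j \<oplus> Y i j) \<oplus> mat_mult A n Y Y i j"
    using Yc[OF ij] idc[of i j] mc by algebra
  also have "\<dots> = mat_id A i j \<ominus> t i j"
    unfolding eq using idc[of i j] mc tc by algebra
  finally show ?thesis .
qed

end

section \<open>Square roots and the cone of squares\<close>

text \<open>A provisional notion of positivity whose stability under sums and limits can be shown
  before anything is known about \<open>b\<^sup>\<star> b\<close>;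
  \<open>positive_elements_eq_squares\<close> later identifies the two cones.\<close>

definition squares :: "('a, 'm) cstar_scheme \<Rightarrow> 'a set" where
  "squares A = {k \<otimes>\<^bsub>A\<^esub> k | k. k \<in> selfadjoint_elements A}"

context cstar_algebra
begin

lemma selfadjointI: "x \<in> carrier A \<Longrightarrow> x\<^sup>\<star> = x \<Longrightarrow> x \<in> selfadjoint_elements A"
  by (simp add: selfadjoint_elements_def)

lemma selfadjointD [simp]:
  "x \<in> selfadjoint_elements A \<Longrightarrow> x \<in> carrier A" "x \<in> selfadjoint_elements A \<Longrightarrow> x\<^sup>\<star> = x"
  by (simp_all add: selfadjoint_elements_def)

lemma selfadjoint_add: "x \<in> selfadjoint_elements A \<Longrightarrow> y \<in> selfadjoint_elements A \<Longrightarrow>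
    x \<oplus> y \<in> selfadjoint_elements A"
  by (rule selfadjointI) (simp_all add: star_add)

lemma selfadjoint_diff: "x \<in> selfadjoint_elements A \<Longrightarrow> y \<in> selfadjoint_elements A \<Longrightarrow>
    x \<ominus> y \<in> selfadjoint_elements A"
  by (rule selfadjointI) (simp_all add: star_diff)

lemma selfadjoint_minus: "x \<in> selfadjoint_elements A \<Longrightarrow> \<ominus> x \<in> selfadjoint_elements A"
  by (rule selfadjointI) (simp_all add: star_minus)

lemma selfadjoint_smult: "x \<in> selfadjoint_elements A \<Longrightarrow> complex_of_real c \<odot> x \<in> selfadjoint_elements A"
  by (rule selfadjointI) (simp_all add: star_smult)

lemma selfadjoint_square: "x \<in> selfadjoint_elements A \<Longrightarrow> x \<otimes> x \<in> selfadjoint_elements A"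
  by (rule selfadjointI) (simp_all add: star_mult)

lemma selfadjoint_one: "\<one> \<in> selfadjoint_elements A"
  by (rule selfadjointI) (simp_all)

lemma selfadjoint_zero: "\<zero> \<in> selfadjoint_elements A"
  by (rule selfadjointI) (simp_all)

lemma selfadjoint_star_mult: "z \<in> carrier A \<Longrightarrow> z\<^sup>\<star> \<otimes> z \<in> selfadjoint_elements A"
  by (rule selfadjointI) (simp_all add: star_mult)

lemmas selfadjoint_intros = selfadjoint_add selfadjoint_diff selfadjoint_minus selfadjoint_smult
  selfadjoint_square selfadjoint_one selfadjoint_zero selfadjoint_star_mult

lemma selfadjoint_limit:
  assumes "converges A f l" "\<And>n. f n \<in> selfadjoint_elements A"
  shows "l \<in> selfadjoint_elements A"
proof -
  have "converges A f (l\<^sup>\<star>)"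
    using converges_star[OF assms(1)] assms(2) by simp
  with assms(1) show ?thesis
    using converges_unique converges_closed(2) by (metis selfadjointI)
qed

lemma star_mult_eq_zero: "z \<in> carrier A \<Longrightarrow> z\<^sup>\<star> \<otimes> z = \<zero> \<Longrightarrow> z = \<zero>"
  using cstar_identity[of z] nrm_eq_0_iff[of z] by simp

text \<open>For x = a + i b with a and b self-adjoint, the two elements are 2a and -2b; the halves
  are postponed to the reassembly.\<close>

lemma cartesian_decomposition:
  assumes x: "x \<in> carrier A"
  shows "x \<oplus> x\<^sup>\<star> \<in> selfadjoint_elements A" "\<i> \<odot> (x \<ominus> x\<^sup>\<star>) \<in> selfadjoint_elements A"
    and "(1/2) \<odot> (x \<oplus> x\<^sup>\<star> \<oplus> (- \<i>) \<odot> (\<i> \<odot> (x \<ominus> x\<^sup>\<star>))) = x"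
proof -
  note [simp] = x
  have eq: "\<ominus> (x \<ominus> y) = y \<ominus> x" if "x \<in> carrier A" "y \<in> carrier A" for x y
    using that by algebra
  show "x \<oplus> x\<^sup>\<star> \<in> selfadjoint_elements A" "\<i> \<odot> (x \<ominus> x\<^sup>\<star>) \<in> selfadjoint_elements A"
    by (rule selfadjointI; simp add: star_simps a_comm smult_minus_left eq flip: smult_minus_right)+
  have "x \<oplus> x\<^sup>\<star> \<oplus> (x \<ominus> x\<^sup>\<star>) = x \<oplus> x"
    using x star_closed[OF x] by algebra
  then show "(1/2) \<odot> (x \<oplus> x\<^sup>\<star> \<oplus> (- \<i>) \<odot> (\<i> \<odot> (x \<ominus> x\<^sup>\<star>))) = x"
    by (simp add: smult_add_right sum_halves del: smult_add_left)
qed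

text \<open>The iteration for n = 1, with the norm of the single entry as bound, and s = 1 - Y. The
  estimate on 1 - s makes s itself a square, by a second root. What commutes with t commutes with
  all iterates and hence with s.\<close>

lemma sqrt_one_minus:
  assumes t: "t \<in> selfadjoint_elements A" "nrm A t \<le> 1"
  shows "\<exists>s \<in> selfadjoint_elements A. s \<otimes> s = \<one> \<ominus> t \<and> nrm A (\<one> \<ominus> s) \<le> 1 \<and>
    (\<forall>x\<in>carrier A. x \<otimes> t = t \<otimes> x \<longrightarrow> x \<otimes> s = s \<otimes> x)"
proof -
  let ?t = "\<lambda>i j :: nat. t"
  let ?y = "\<lambda>k. root_iter A 1 ?t k 0 0"
  let ?bd = "\<lambda>T c. nrm A (T 0 0) \<le> c"
  have [simp]: "t \<in> carrier A" "t\<^sup>\<star> = t"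
    using t by simp_all
  have E: "entries_in A 1 ?t"
    by (simp add: entries_in_def)
  have bds: "(\<forall>k. ?bd (root_iter A 1 ?t k) (root_bound k)) \<and>
      (\<exists>Y. \<forall>i<1. \<forall>j<1. converges A (\<lambda>k. root_iter A 1 ?t k i j) (Y i j))"
  proof (rule root_iter_converges[where bd = ?bd])
    fix T S :: "nat \<Rightarrow> nat \<Rightarrow> 'a" and c d :: real
    assume *: "entries_in A 1 T" "entries_in A 1 S" "?bd T c" "?bd S d" "0 < c" "0 < d"
    then have "nrm A (T 0 0 \<otimes> S 0 0) \<le> c * d"
      by (intro order_trans[OF nrm_mult] mult_mono) (auto simp: entries_in_def nrm_nonneg)
    with * show "?bd (mat_mult A 1 T S) (c * d)"
      by (simp add: mat_mult_def entries_in_def)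
    from * show "?bd (\<lambda>i j. T i j \<oplus> S i j) (c + d)"
      using nrm_triangle[of "T 0 0" "S 0 0"] by (simp add: entries_in_def)
  next
    fix T :: "nat \<Rightarrow> nat \<Rightarrow> 'a" and c :: real
    assume "entries_in A 1 T" "?bd T c"
    then show "?bd (\<lambda>i j. (1/2) \<odot> T i j) (c/2)"
      by (simp add: entries_in_def nrm_smult)
  qed (use t E in auto)
  then obtain Y where Y: "converges A ?y (Y (0::nat) (0::nat))"
    by (metis less_one)
  have yc [simp]: "?y k \<in> carrier A" for k
    by (rule converges_closed[OF Y])
  let ?Y = "Y 0 0"
  have [simp]: "?Y \<in> carrier A"
    by (rule converges_closed[OF Y])
  have "(\<one> \<ominus> ?Y) \<otimes> (\<one> \<ominus> ?Y) = \<one> \<ominus> t"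
    using root_iter_limit[OF E, of Y 0 0] Y by (simp add: mat_mult_def mat_id_def)
  moreover have "?y k \<in> selfadjoint_elements A" for k
    by (induction k; rule selfadjointI) (auto simp: mat_mult_def star_simps)
  then have "?Y \<in> selfadjoint_elements A"
    by (rule selfadjoint_limit[OF Y])
  then have "\<one> \<ominus> ?Y \<in> selfadjoint_elements A"
    by (intro selfadjoint_intros)
  moreover have "nrm A ?Y \<le> 1"
    using bds root_bound_range by (intro converges_nrm_le[OF Y]) (meson less_eq_real_def order_trans)
  then have "nrm A (\<one> \<ominus> (\<one> \<ominus> ?Y)) \<le> 1"
  proof -
    have "\<one> \<ominus> (\<one> \<ominus> y) = y" if "y \<in> carrier A" for y
      using that by algebra
    with \<open>nrm A ?Y \<le> 1\<close> show ?thesis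
      by simp
  qed
  moreover have "x \<otimes> (\<one> \<ominus> ?Y) = (\<one> \<ominus> ?Y) \<otimes> x" if x: "x \<in> carrier A" and xt: "x \<otimes> t = t \<otimes> x" for x
  proof -
    have "x \<otimes> ?y k = ?y k \<otimes> x" for k
    proof (induction k)
      case 0
      then show ?case
        using x xt by (simp add: smult_mult_left smult_mult_right)
    next
      case (Suc k)
      have "x \<otimes> (?y k \<otimes> ?y k) = (?y k \<otimes> ?y k) \<otimes> x"
        using x Suc yc[of k] by (metis m_assoc)
      then show ?case
        using x xt yc[of k] by (simp add: smult_mult_left smult_mult_right mat_mult_def l_distr r_distr)
    qed
    moreover have "converges A (\<lambda>k. x \<otimes> ?y k) (x \<otimes> ?Y)" "converges A (\<lambda>k. ?y k \<otimes> x) (?Y \<otimes> x)"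
      using x Y by (auto intro: converges_mult converges_const)
    ultimately have "x \<otimes> ?Y = ?Y \<otimes> x"
      using converges_unique by simp
    then show ?thesis
      using x by (simp add: minus_eq l_distr r_distr l_minus r_minus)
  qed
  ultimately show ?thesis
    by blast
qed

text \<open>The element \<open>k + i s\<close> is unitary.\<close>

lemma norm_le_one_of_squares_sum_one:
  assumes k: "k \<in> selfadjoint_elements A" and s: "s \<in> selfadjoint_elements A"
    and comm: "k \<otimes> s = s \<otimes> k" and sum: "k \<otimes> k \<oplus> s \<otimes> s = \<one>"
  shows "nrm A s \<le> 1"
proof -
  note [simp] = selfadjointD[OF k] selfadjointD[OF s]
  define u where "u = k \<oplus> \<i> \<odot> s"
  have u [simp]: "u \<in> carrier A"
    by (simp add: u_def)
  have us: "u\<^sup>\<star> = k \<oplus> (- \<i>) \<odot> s"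
    by (simp add: u_def star_simps)
  have "u\<^sup>\<star> \<otimes> u = (k \<otimes> k \<oplus> \<ominus> (\<i> \<odot> (s \<otimes> k))) \<oplus> (\<i> \<odot> (s \<otimes> k) \<oplus> s \<otimes> s)"
    unfolding us unfolding u_def
    by (simp add: l_distr r_distr smult_mult_left smult_mult_right comm smult_minus_left l_minus
        smult_add_right smult_minus_right)
  also have "\<dots> = k \<otimes> k \<oplus> s \<otimes> s"
  proof -
    have "k \<otimes> k \<in> carrier A" "s \<otimes> s \<in> carrier A" "\<i> \<odot> (s \<otimes> k) \<in> carrier A"
      by simp_all
    then show ?thesis
      by algebra
  qed
  finally have "(nrm A u)\<^sup>2 \<le> 1"
    using cstar_identity[OF u] nrm_one_le sum by simp
  then have u1: "nrm A u \<le> 1"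
    using power2_le_imp_le[of "nrm A u" 1] by simp
  have "u \<ominus> u\<^sup>\<star> = \<i> \<odot> s \<oplus> \<i> \<odot> s"
  proof -
    have "\<i> \<odot> s \<in> carrier A" "k \<in> carrier A" by simp_all
    then show ?thesis
      unfolding us unfolding u_def smult_minus_left[OF selfadjointD(1)[OF s]] by algebra
  qed
  then have "(- \<i> / 2) \<odot> (u \<ominus> u\<^sup>\<star>) = s"
    by (simp add: smult_add_right flip: smult_add_left)
  then have "nrm A s = 1/2 * nrm A (u \<ominus> u\<^sup>\<star>)"
    using nrm_smult[of "u \<ominus> u\<^sup>\<star>" "- \<i> / 2"] by (simp add: norm_divide)
  then show ?thesis
    using nrm_diff_le[of u "u\<^sup>\<star>"] u1 by simp
qed

text \<open>With s^2 = 1 - k^2 the elements k and s commute and their squares add up to 1. Hence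
  ||s|| \<le> 1, which bounds s^2.\<close>

lemma norm_one_minus_square_le:
  assumes k: "k \<in> selfadjoint_elements A" "nrm A k \<le> 1"
  shows "nrm A (\<one> \<ominus> k \<otimes> k) \<le> 1"
proof -
  note [simp] = selfadjointD[OF k(1)]
  have "nrm A (k \<otimes> k) \<le> nrm A k * nrm A k"
    by (simp add: nrm_mult)
  also have "\<dots> \<le> 1"
    using k nrm_nonneg[of k] by (simp add: mult_le_one)
  finally obtain s where s: "s \<in> selfadjoint_elements A" "s \<otimes> s = \<one> \<ominus> k \<otimes> k" "k \<otimes> s = s \<otimes> k"
    using sqrt_one_minus[OF selfadjoint_square[OF k(1)]] by (metis m_assoc selfadjointD(1) k(1))
  have "k \<otimes> k \<in> carrier A" by simp
  then have "k \<otimes> k \<oplus> s \<otimes> s = \<one>"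
    unfolding s(2) by algebra
  then have "nrm A s \<le> 1"
    using norm_le_one_of_squares_sum_one k s by blast
  then have "nrm A s * nrm A s \<le> 1"
    using s nrm_nonneg[of s] by (simp add: mult_le_one)
  then show ?thesis
    using nrm_mult[of s s] s by simp
qed

lemma squaresE:
  assumes "h \<in> squares A"
  obtains k where "k \<in> selfadjoint_elements A" "h = k \<otimes> k"
  using assms by (auto simp: squares_def)

lemma squares_selfadjoint [simp]: "h \<in> squares A \<Longrightarrow> h \<in> selfadjoint_elements A"
  by (auto elim!: squaresE intro: selfadjoint_intros)

lemma squares_carrier [simp]: "h \<in> squares A \<Longrightarrow> h \<in> carrier A"
  by simp

lemma square_in_squares [intro]: "k \<in> selfadjoint_elements A \<Longrightarrow> k \<otimes> k \<in> squares A"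
  unfolding squares_def by blast

lemma squares_smult:
  assumes h: "h \<in> squares A" and c: "0 \<le> c"
  shows "complex_of_real c \<odot> h \<in> squares A"
proof -
  obtain k where k: "k \<in> selfadjoint_elements A" "h = k \<otimes> k"
    using h by (rule squaresE)
  have "complex_of_real c \<odot> h = (complex_of_real (sqrt c) \<odot> k) \<otimes> (complex_of_real (sqrt c) \<odot> k)"
    using k c by (simp add: smult_mult_left smult_mult_right flip: of_real_mult)
  then show ?thesis
    using k by (simp add: square_in_squares selfadjoint_smult)
qed

text \<open>One half of a norm criterion whose other half is \<open>squaresI\<close>: a self-adjoint
  h is a square precisely when ||c - h|| \<le> c for some c > 0, and then for every positive c at
  least ||h||. Unlike the existence of a root, this condition is visibly stable under sums, limits
  and a change of the ambient algebra.\<close>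

lemma norm_diff_square_le:
  assumes h: "h \<in> squares A" and c: "nrm A h \<le> c" "0 < c"
  shows "nrm A (complex_of_real c \<odot> \<one> \<ominus> h) \<le> c"
proof -
  have "complex_of_real (1 / c) \<odot> h \<in> squares A"
    using squares_smult[OF h, of "1/c"] c by simp
  then obtain k where k: "k \<in> selfadjoint_elements A" "complex_of_real (1/c) \<odot> h = k \<otimes> k"
    by (rule squaresE)
  have "(nrm A k)\<^sup>2 = nrm A (complex_of_real (1/c) \<odot> h)"
    using cstar_identity[of k] k by simp
  also have "\<dots> \<le> 1"
    using h c by (simp add: nrm_smult norm_divide)
  finally have "nrm A k \<le> 1"
    using power2_le_imp_le[of "nrm A k" 1] by simp
  then have "nrm A (\<one> \<ominus> complex_of_real (1/c) \<odot> h) \<le> 1"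
    using norm_one_minus_square_le k by simp
  moreover have "complex_of_real c \<odot> \<one> \<ominus> h = complex_of_real c \<odot> (\<one> \<ominus> complex_of_real (1/c) \<odot> h)"
    using h c by (simp add: smult_diff_right)
  ultimately show ?thesis
    using h c by (simp add: nrm_smult)
qed

text \<open>Rescaling to t = 1 - h/c reduces this to \<open>sqrt_one_minus\<close>; the root is
  multiplied back by sqrt c.\<close>

lemma square_root:
  assumes h: "h \<in> selfadjoint_elements A" and c: "nrm A (complex_of_real c \<odot> \<one> \<ominus> h) \<le> c" "0 < c"
  shows "\<exists>s \<in> selfadjoint_elements A. h = s \<otimes> s \<and> (\<forall>x\<in>carrier A. x \<otimes> h = h \<otimes> x \<longrightarrow> x \<otimes> s = s \<otimes> x)"
proof -
  let ?h = "complex_of_real (1/c) \<odot> h"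
  have hc [simp]: "h \<in> carrier A"
    using h by simp
  have "complex_of_real c \<odot> (\<one> \<ominus> ?h) = complex_of_real c \<odot> \<one> \<ominus> h"
    using c by (simp add: smult_diff_right)
  then have "c * nrm A (\<one> \<ominus> ?h) \<le> c"
    using c nrm_smult[of "\<one> \<ominus> ?h" "complex_of_real c"] by simp
  then have n: "nrm A (\<one> \<ominus> ?h) \<le> 1"
    using c by simp
  have "\<one> \<ominus> ?h \<in> selfadjoint_elements A"
    using h by (intro selfadjoint_intros)
  from sqrt_one_minus[OF this n] obtain s where s: "s \<in> selfadjoint_elements A"
      "s \<otimes> s = \<one> \<ominus> (\<one> \<ominus> ?h)"
      "\<And>x. x \<in> carrier A \<Longrightarrow> x \<otimes> (\<one> \<ominus> ?h) = (\<one> \<ominus> ?h) \<otimes> x \<Longrightarrow> x \<otimes> s = s \<otimes> x"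
    by blast
  have "?h \<in> carrier A" by simp
  then have ss: "s \<otimes> s = ?h"
    unfolding s(2) by algebra
  have comm: "x \<otimes> s = s \<otimes> x" if x: "x \<in> carrier A" "x \<otimes> h = h \<otimes> x" for x
    using x by (intro s(3))
      (simp_all add: minus_eq l_distr r_distr l_minus r_minus smult_mult_left smult_mult_right)
  have "(complex_of_real (sqrt c) \<odot> s) \<otimes> (complex_of_real (sqrt c) \<odot> s) = h"
    using s(1) ss c by (simp add: smult_mult_left smult_mult_right flip: of_real_mult)
  moreover have "x \<otimes> (complex_of_real (sqrt c) \<odot> s) = (complex_of_real (sqrt c) \<odot> s) \<otimes> x"
    if "x \<in> carrier A" "x \<otimes> h = h \<otimes> x" for x
    using comm[OF that] that(1) s(1) by (simp add: smult_mult_left smult_mult_right)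
  ultimately show ?thesis
    using selfadjoint_smult[OF s(1), of "sqrt c"] by metis
qed

lemma squaresI:
  assumes "h \<in> selfadjoint_elements A" "nrm A (complex_of_real c \<odot> \<one> \<ominus> h) \<le> c" "0 < c"
  shows "h \<in> squares A"
  using square_root[OF assms] by auto

text \<open>The norm criterion turns this into the triangle inequality: 2c - (h + g) is the sum of c
  - h and c - g.\<close>

lemma squares_add:
  assumes h: "h \<in> squares A" "g \<in> squares A"
  shows "h \<oplus> g \<in> squares A"
proof (rule squaresI)
  define c where "c = nrm A h + nrm A g + 1"
  have c: "nrm A h \<le> c" "nrm A g \<le> c" "0 < c"
    using h nrm_nonneg[of h] nrm_nonneg[of g] by (auto simp: c_def)
  show "0 < c + c"
    using c by simp
  have "complex_of_real (c + c) \<odot> \<one> \<ominus> (h \<oplus> g) =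
      (complex_of_real c \<odot> \<one> \<ominus> h) \<oplus> (complex_of_real c \<odot> \<one> \<ominus> g)"
  proof -
    have "h \<in> carrier A" "g \<in> carrier A" "complex_of_real c \<odot> \<one> \<in> carrier A"
      using h by simp_all
    then show ?thesis
      unfolding of_real_add smult_add_left[OF one_closed] by algebra
  qed
  then show "nrm A (complex_of_real (c + c) \<odot> \<one> \<ominus> (h \<oplus> g)) \<le> c + c"
    using norm_diff_square_le[OF h(1) c(1,3)] norm_diff_square_le[OF h(2) c(2,3)] h
      nrm_triangle[of "complex_of_real c \<odot> \<one> \<ominus> h" "complex_of_real c \<odot> \<one> \<ominus> g"] by simp
qed (use h in \<open>auto intro: selfadjoint_intros\<close>)

lemma squares_zero [simp]: "\<zero> \<in> squares A"
  using square_in_squares[OF selfadjoint_zero] by simp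

lemma squares_one [simp]: "\<one> \<in> squares A"
  using square_in_squares[OF selfadjoint_one] by simp

lemma squares_vsum: "(\<And>k. k < n \<Longrightarrow> f k \<in> squares A) \<Longrightarrow> vsum A f n \<in> squares A"
  by (induction n) (auto intro: squares_add)

text \<open>A convergent sequence has a common norm bound c, and ||c - f n|| \<le> c survives the
  limit.\<close>

lemma squares_limit:
  assumes f: "converges A f l" "\<And>n. f n \<in> squares A"
  shows "l \<in> squares A"
proof -
  have "Bseq (\<lambda>n. nrm A (f n))"
    using converges_nrm[OF f(1)] convergentI convergent_imp_Bseq by blast
  then obtain c where c: "0 < c" "\<And>n. nrm A (f n) \<le> c"
    using f(2) by (auto simp: Bseq_def nrm_nonneg)
  show ?thesis
  proof (rule squaresI[OF _ _ c(1)])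
    show "l \<in> selfadjoint_elements A"
      using f by (auto intro: selfadjoint_limit)
    have "converges A (\<lambda>n. complex_of_real c \<odot> \<one> \<ominus> f n) (complex_of_real c \<odot> \<one> \<ominus> l)"
      using f by (intro converges_diff converges_const) auto
    then show "nrm A (complex_of_real c \<odot> \<one> \<ominus> l) \<le> c"
      by (rule converges_nrm_le) (use f c norm_diff_square_le in auto)
  qed
qed

lemma one_minus_in_squares:
  assumes "x \<in> selfadjoint_elements A" "nrm A x \<le> 1"
  shows "\<one> \<ominus> x \<in> squares A"
  using sqrt_one_minus[OF assms] by (metis square_in_squares)

text \<open>With \<open>z = a + i b\<close> the sum is \<open>2 (a\<^sup>2 + b\<^sup>2)\<close>.\<close>

lemma star_mult_add_mult_star_in_squares:
  assumes z [simp]: "z \<in> carrier A"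
  shows "z\<^sup>\<star> \<otimes> z \<oplus> z \<otimes> z\<^sup>\<star> \<in> squares A"
proof -
  let ?a = "z \<oplus> z\<^sup>\<star>" and ?b = "\<i> \<odot> (z \<ominus> z\<^sup>\<star>)"
  note ab = cartesian_decomposition(1,2)[OF z]
  let ?s = "z\<^sup>\<star> \<otimes> z \<oplus> z \<otimes> z\<^sup>\<star>"
  have "?b \<otimes> ?b = \<ominus> ((z \<ominus> z\<^sup>\<star>) \<otimes> (z \<ominus> z\<^sup>\<star>))"
    by (simp add: smult_mult_left smult_mult_right minus_as_smult)
  then have "?a \<otimes> ?a \<oplus> ?b \<otimes> ?b = (?a \<otimes> ?a) \<ominus> (z \<ominus> z\<^sup>\<star>) \<otimes> (z \<ominus> z\<^sup>\<star>)"
    by (simp add: minus_eq)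
  also have "\<dots> = ?s \<oplus> ?s"
  proof -
    have "z \<in> carrier A" "z\<^sup>\<star> \<in> carrier A" by simp_all
    then show ?thesis by algebra
  qed
  finally have "?s = complex_of_real (1/2) \<odot> (?a \<otimes> ?a \<oplus> ?b \<otimes> ?b)"
    using sum_halves[of ?s] by (simp add: smult_add_right)
  moreover have "complex_of_real (1/2) \<odot> (?a \<otimes> ?a \<oplus> ?b \<otimes> ?b) \<in> squares A"
    using ab by (intro squares_smult squares_add square_in_squares) auto
  ultimately show ?thesis
    by metis
qed

end

section \<open>Subalgebras, products and embeddings\<close>

text \<open>(p, q) identifies X with a closed subalgebra of the direct sum of A and B, closed by
  \<open>X_limit\<close>, and all axioms are pulled back along it. Two targets are used so that one
  locale serves products as well as, with A = B and p = q, closed subalgebras and copies on another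
  type.\<close>

locale cstar_embedding = A: cstar_algebra A + B: cstar_algebra B
  for A :: "('a, 'm) cstar_scheme" and B :: "('b, 'n) cstar_scheme" +
  fixes X :: "('x, 'l) cstar_scheme" and p :: "'x \<Rightarrow> 'a" and q :: "'x \<Rightarrow> 'b"
  assumes p_closed [simp, intro]: "x \<in> carrier X \<Longrightarrow> p x \<in> carrier A"
    and q_closed [simp, intro]: "x \<in> carrier X \<Longrightarrow> q x \<in> carrier B"
    and inj: "x \<in> carrier X \<Longrightarrow> y \<in> carrier X \<Longrightarrow> p x = p y \<Longrightarrow> q x = q y \<Longrightarrow> x = y"
    and X_zero [simp, intro]: "\<zero>\<^bsub>X\<^esub> \<in> carrier X"
    and X_one [simp, intro]: "\<one>\<^bsub>X\<^esub> \<in> carrier X"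
    and X_add [simp, intro]: "x \<in> carrier X \<Longrightarrow> y \<in> carrier X \<Longrightarrow> x \<oplus>\<^bsub>X\<^esub> y \<in> carrier X"
    and X_mult [simp, intro]: "x \<in> carrier X \<Longrightarrow> y \<in> carrier X \<Longrightarrow> x \<otimes>\<^bsub>X\<^esub> y \<in> carrier X"
    and X_smult [simp, intro]: "x \<in> carrier X \<Longrightarrow> c \<odot>\<^bsub>X\<^esub> x \<in> carrier X"
    and X_star [simp, intro]: "x \<in> carrier X \<Longrightarrow> x\<^sup>\<star>\<^bsub>X\<^esub> \<in> carrier X"
    and p_zero [simp]: "p \<zero>\<^bsub>X\<^esub> = \<zero>\<^bsub>A\<^esub>" and q_zero [simp]: "q \<zero>\<^bsub>X\<^esub> = \<zero>\<^bsub>B\<^esub>"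
    and p_one [simp]: "p \<one>\<^bsub>X\<^esub> = \<one>\<^bsub>A\<^esub>" and q_one [simp]: "q \<one>\<^bsub>X\<^esub> = \<one>\<^bsub>B\<^esub>"
    and p_add [simp]: "x \<in> carrier X \<Longrightarrow> y \<in> carrier X \<Longrightarrow> p (x \<oplus>\<^bsub>X\<^esub> y) = p x \<oplus>\<^bsub>A\<^esub> p y"
    and q_add [simp]: "x \<in> carrier X \<Longrightarrow> y \<in> carrier X \<Longrightarrow> q (x \<oplus>\<^bsub>X\<^esub> y) = q x \<oplus>\<^bsub>B\<^esub> q y"
    and p_mult [simp]: "x \<in> carrier X \<Longrightarrow> y \<in> carrier X \<Longrightarrow> p (x \<otimes>\<^bsub>X\<^esub> y) = p x \<otimes>\<^bsub>A\<^esub> p y"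
    and q_mult [simp]: "x \<in> carrier X \<Longrightarrow> y \<in> carrier X \<Longrightarrow> q (x \<otimes>\<^bsub>X\<^esub> y) = q x \<otimes>\<^bsub>B\<^esub> q y"
    and p_smult [simp]: "x \<in> carrier X \<Longrightarrow> p (c \<odot>\<^bsub>X\<^esub> x) = c \<odot>\<^bsub>A\<^esub> p x"
    and q_smult [simp]: "x \<in> carrier X \<Longrightarrow> q (c \<odot>\<^bsub>X\<^esub> x) = c \<odot>\<^bsub>B\<^esub> q x"
    and p_star [simp]: "x \<in> carrier X \<Longrightarrow> p (x\<^sup>\<star>\<^bsub>X\<^esub>) = (p x)\<^sup>\<star>\<^bsub>A\<^esub>"
    and q_star [simp]: "x \<in> carrier X \<Longrightarrow> q (x\<^sup>\<star>\<^bsub>X\<^esub>) = (q x)\<^sup>\<star>\<^bsub>B\<^esub>"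
    and X_nrm: "x \<in> carrier X \<Longrightarrow> nrm X x = max (nrm A (p x)) (nrm B (q x))"
    and X_limit: "(\<And>n. f n \<in> carrier X) \<Longrightarrow> converges A (\<lambda>n. p (f n)) a \<Longrightarrow>
      converges B (\<lambda>n. q (f n)) b \<Longrightarrow> \<exists>x\<in>carrier X. p x = a \<and> q x = b"
begin

lemma X_ring: "ring X"
proof (rule ringI)
  have "\<exists>y\<in>carrier X. y \<oplus>\<^bsub>X\<^esub> x = \<zero>\<^bsub>X\<^esub>" if "x \<in> carrier X" for x
  proof
    show "(- 1) \<odot>\<^bsub>X\<^esub> x \<oplus>\<^bsub>X\<^esub> x = \<zero>\<^bsub>X\<^esub>"
      using that by (intro inj) (simp_all add: A.l_neg B.l_neg flip: A.minus_as_smult B.minus_as_smult)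
  qed (use that in simp)
  then show "abelian_group X"
    by (intro abelian_groupI) (auto intro!: inj simp: A.a_ac B.a_ac)
  show "monoid X"
    by (intro monoidI) (auto intro!: inj simp: A.m_assoc B.m_assoc)
qed (auto intro!: inj simp: A.l_distr A.r_distr B.l_distr B.r_distr)

interpretation X: ring X
  by (rule X_ring)

lemma p_minus: "x \<in> carrier X \<Longrightarrow> p (\<ominus>\<^bsub>X\<^esub> x) = \<ominus>\<^bsub>A\<^esub> p x"
  by (metis A.minus_equality X.a_inv_closed X.l_neg p_add p_closed p_zero)

lemma q_minus: "x \<in> carrier X \<Longrightarrow> q (\<ominus>\<^bsub>X\<^esub> x) = \<ominus>\<^bsub>B\<^esub> q x"
  by (metis B.minus_equality X.a_inv_closed X.l_neg q_add q_closed q_zero)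

lemma p_diff: "x \<in> carrier X \<Longrightarrow> y \<in> carrier X \<Longrightarrow> p (x \<ominus>\<^bsub>X\<^esub> y) = p x \<ominus>\<^bsub>A\<^esub> p y"
  and q_diff: "x \<in> carrier X \<Longrightarrow> y \<in> carrier X \<Longrightarrow> q (x \<ominus>\<^bsub>X\<^esub> y) = q x \<ominus>\<^bsub>B\<^esub> q y"
  by (simp_all add: X.minus_eq A.minus_eq B.minus_eq p_minus q_minus)

lemma X_cdist:
  "x \<in> carrier X \<Longrightarrow> y \<in> carrier X \<Longrightarrow> cdist X x y = max (nrm A (p x \<ominus>\<^bsub>A\<^esub> p y)) (nrm B (q x \<ominus>\<^bsub>B\<^esub> q y))"
  by (simp add: cdist_def X_nrm p_diff q_diff)

lemma X_Metric_space: "Metric_space (carrier X) (cdist X)"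
proof
  fix x y z
  show "0 \<le> cdist X x y"
    by (simp add: cdist_def X_nrm A.nrm_nonneg le_max_iff_disj)
  show "cdist X x y = cdist X y x"
    by (simp add: cdist_def X_nrm p_diff q_diff A.nrm_diff_commute B.nrm_diff_commute)
  assume x: "x \<in> carrier X" and y: "y \<in> carrier X"
  have "max (nrm A (p x \<ominus>\<^bsub>A\<^esub> p y)) (nrm B (q x \<ominus>\<^bsub>B\<^esub> q y)) = 0 \<longleftrightarrow>
      nrm A (p x \<ominus>\<^bsub>A\<^esub> p y) = 0 \<and> nrm B (q x \<ominus>\<^bsub>B\<^esub> q y) = 0"
    using x y A.nrm_nonneg[of "p x \<ominus>\<^bsub>A\<^esub> p y"] B.nrm_nonneg[of "q x \<ominus>\<^bsub>B\<^esub> q y"] by auto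
  also have "\<dots> \<longleftrightarrow> x = y"
    using x y inj by (auto simp: A.nrm_eq_0_iff B.nrm_eq_0_iff A.diff_eq_zero_iff B.diff_eq_zero_iff)
  finally show "cdist X x y = 0 \<longleftrightarrow> x = y"
    using x y by (simp add: X_cdist)
  assume z: "z \<in> carrier X"
  show "cdist X x z \<le> cdist X x y + cdist X y z"
    using x y z A.nrm_diff_triangle[of "p x" "p y" "p z"] B.nrm_diff_triangle[of "q x" "q y" "q z"]
    by (auto simp: X_cdist)
qed

interpretation X: Metric_space "carrier X" "cdist X"
  by (rule X_Metric_space)

lemma X_mcomplete: "X.mcomplete"
  unfolding X.mcomplete_def
proof (intro allI impI)
  fix f assume "X.MCauchy f"
  then have f: "\<And>n. f n \<in> carrier X"
    and cauchy: "\<And>e. 0 < e \<Longrightarrow> \<exists>N. \<forall>m\<ge>N. \<forall>n\<ge>N. cdist X (f m) (f n) < e"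
    by (auto simp: X.MCauchy_def)
  have "\<exists>a. converges A (\<lambda>n. p (f n)) a"
  proof (rule A.Cauchy_converges)
    fix e :: real assume "0 < e"
    from cauchy[OF this] show "\<exists>N. \<forall>m\<ge>N. \<forall>n\<ge>N. nrm A (p (f m) \<ominus>\<^bsub>A\<^esub> p (f n)) < e"
      using f by (fastforce simp: X_cdist)
  qed (use f in simp)
  then obtain a where a: "converges A (\<lambda>n. p (f n)) a" ..
  have "\<exists>b. converges B (\<lambda>n. q (f n)) b"
  proof (rule B.Cauchy_converges)
    fix e :: real assume "0 < e"
    from cauchy[OF this] show "\<exists>N. \<forall>m\<ge>N. \<forall>n\<ge>N. nrm B (q (f m) \<ominus>\<^bsub>B\<^esub> q (f n)) < e"
      using f by (fastforce simp: X_cdist)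
  qed (use f in simp)
  then obtain b where b: "converges B (\<lambda>n. q (f n)) b" ..
  obtain x where x: "x \<in> carrier X" "p x = a" "q x = b"
    using X_limit[OF f a b] by blast
  have "(\<lambda>n. max (nrm A (p (f n) \<ominus>\<^bsub>A\<^esub> a)) (nrm B (q (f n) \<ominus>\<^bsub>B\<^esub> b))) \<longlonglongrightarrow> max 0 0"
    using a b by (intro tendsto_max) (simp_all add: converges_def)
  then have "(\<lambda>n. cdist X (f n) x) \<longlonglongrightarrow> 0"
    using f x by (simp add: X_cdist)
  then have "limitin X.mtopology f x sequentially"
    using f x by (simp add: X.limitin_metric_dist_null)
  then show "\<exists>x. limitin X.mtopology f x sequentially" ..
qed

lemma cstar_algebra_X: "cstar_algebra X"
proof -
  have "module complex_ring X"
    by (intro module.intro cring_complex_ring X.abelian_group_axioms module_axioms.intro)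
      (auto intro!: inj simp: A.smult_add_left A.smult_add_right B.smult_add_left B.smult_add_right)
  moreover have "max a b * max c d \<ge> a * c" "max a b * max c d \<ge> b * d"
    if "0 \<le> a" "0 \<le> b" "0 \<le> c" "0 \<le> d" for a b c d :: real
    using that by (auto intro!: mult_mono)
  then have "nrm X (x \<otimes>\<^bsub>X\<^esub> y) \<le> nrm X x * nrm X y" if "x \<in> carrier X" "y \<in> carrier X" for x y
    using that A.nrm_mult[of "p x" "p y"] B.nrm_mult[of "q x" "q y"]
    by (simp add: X_nrm A.nrm_nonneg B.nrm_nonneg) (meson A.nrm_nonneg B.nrm_nonneg order_trans p_closed q_closed)
  moreover have "nrm X (x\<^sup>\<star>\<^bsub>X\<^esub> \<otimes>\<^bsub>X\<^esub> x) = (nrm X x)\<^sup>2" if "x \<in> carrier X" for x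
    using that A.nrm_nonneg[of "p x"] B.nrm_nonneg[of "q x"]
    by (simp add: X_nrm A.cstar_identity B.cstar_identity max_def power2_le_iff_abs_le)
  moreover have "nrm X x = 0 \<longleftrightarrow> x = \<zero>\<^bsub>X\<^esub>" if x: "x \<in> carrier X" for x
  proof -
    have "max (nrm A (p x)) (nrm B (q x)) = 0 \<longleftrightarrow> nrm A (p x) = 0 \<and> nrm B (q x) = 0"
      using x A.nrm_nonneg[of "p x"] B.nrm_nonneg[of "q x"] by auto
    then show ?thesis
      using x inj[of x "\<zero>\<^bsub>X\<^esub>"] by (auto simp: X_nrm A.nrm_eq_0_iff B.nrm_eq_0_iff)
  qed
  moreover have "nrm X (x \<oplus>\<^bsub>X\<^esub> y) \<le> nrm X x + nrm X y" if "x \<in> carrier X" "y \<in> carrier X" for x y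
    using that A.nrm_triangle[of "p x" "p y"] B.nrm_triangle[of "q x" "q y"] by (auto simp: X_nrm)
  moreover have "nrm X (c \<odot>\<^bsub>X\<^esub> x) = cmod c * nrm X x" if "x \<in> carrier X" for c x
    using that by (simp add: X_nrm A.nrm_smult B.nrm_smult max_mult_distrib_left)
  ultimately show ?thesis
    using X_ring X_mcomplete
    by (intro cstar_algebra.intro cstar_algebra_axioms.intro)
      (auto intro!: inj simp: A.smult_mult_left A.smult_mult_right B.smult_mult_left B.smult_mult_right
        A.star_simps B.star_simps X_nrm A.nrm_nonneg le_max_iff_disj)
qed

end

section \<open>Abelian C*-algebras and closed abelian subalgebras\<close>

locale comm_cstar_algebra = cstar_algebra A + cring A for A :: "('a, 'm) cstar_scheme" (structure)

lemma (in cstar_algebra) closed_subalgebra_embedding: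
  assumes D: "D \<subseteq> carrier A" "\<zero> \<in> D" "\<one> \<in> D"
    and add: "\<And>x y. x \<in> D \<Longrightarrow> y \<in> D \<Longrightarrow> x \<oplus> y \<in> D"
    and mult: "\<And>x y. x \<in> D \<Longrightarrow> y \<in> D \<Longrightarrow> x \<otimes> y \<in> D"
    and smult: "\<And>c x. x \<in> D \<Longrightarrow> c \<odot> x \<in> D" and star: "\<And>x. x \<in> D \<Longrightarrow> x\<^sup>\<star> \<in> D"
    and closed: "closedin (norm_topology A) D"
  shows "cstar_embedding A A (A\<lparr>carrier := D\<rparr>) id id"
proof
  fix f a b
  assume "\<And>n. f n \<in> carrier (A\<lparr>carrier := D\<rparr>)" "converges A (\<lambda>n. id (f n)) a" "converges A (\<lambda>n. id (f n)) b"
  then have *: "range f \<subseteq> D" "converges A f a" "converges A f b"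
    by auto
  then have "a \<in> D"
    using closed unfolding closedin_norm_topology_iff by blast
  moreover have "a = b"
    using * converges_unique by blast
  ultimately show "\<exists>x\<in>carrier (A\<lparr>carrier := D\<rparr>). id x = a \<and> id x = b"
    by auto
qed (use assms in auto)

text \<open>Maximality is left to a later locale, because this one is also instantiated with the
  bicommutant of a single element.\<close>

locale abelian_subalgebra = cstar_algebra A for A :: "('a, 'm) cstar_scheme" (structure) +
  fixes D assumes D: "abelian_cstar_subalgebra A D"
begin

abbreviation sub where "sub \<equiv> A\<lparr>carrier := D\<rparr>"

lemma subcring: "subcring D A"
  using D by (simp add: abelian_cstar_subalgebra_def)

lemma D_carrier [simp]: "x \<in> D \<Longrightarrow> x \<in> carrier A"
  using subcringE(1)[OF subcring] by blast

lemma D_smult [simp]: "x \<in> D \<Longrightarrow> c \<odot> x \<in> D" and D_star [simp]: "x \<in> D \<Longrightarrow> x\<^sup>\<star> \<in> D"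
  and D_closed: "closedin (norm_topology A) D"
  using D by (simp_all add: abelian_cstar_subalgebra_def)

lemma D_zero [simp]: "\<zero> \<in> D" and D_one [simp]: "\<one> \<in> D"
  and D_add [simp]: "x \<in> D \<Longrightarrow> y \<in> D \<Longrightarrow> x \<oplus> y \<in> D"
  and D_mult [simp]: "x \<in> D \<Longrightarrow> y \<in> D \<Longrightarrow> x \<otimes> y \<in> D"
  and D_minus [simp]: "x \<in> D \<Longrightarrow> \<ominus> x \<in> D"
  using subcringE[OF subcring] by auto

lemma D_diff [simp]: "x \<in> D \<Longrightarrow> y \<in> D \<Longrightarrow> x \<ominus> y \<in> D"
  by (simp add: minus_eq)

lemma D_comm: "x \<in> D \<Longrightarrow> y \<in> D \<Longrightarrow> x \<otimes> y = y \<otimes> x"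
  using subcringE(8)[OF subcring] by blast

lemma sub_embedding: "cstar_embedding A A sub id id"
  by (rule closed_subalgebra_embedding) (auto simp: D_closed)

lemma sub_diff: "x \<in> D \<Longrightarrow> y \<in> D \<Longrightarrow> x \<ominus>\<^bsub>sub\<^esub> y = x \<ominus> y"
  using cstar_embedding.p_diff[OF sub_embedding] by simp

lemma sub_minus: "x \<in> D \<Longrightarrow> \<ominus>\<^bsub>sub\<^esub> x = \<ominus> x"
  using cstar_embedding.p_minus[OF sub_embedding] by simp

sublocale sub: comm_cstar_algebra sub
proof -
  interpret S: cstar_algebra sub
    by (rule cstar_embedding.cstar_algebra_X[OF sub_embedding])
  have "cring sub"
    by (intro cring.intro S.ring_axioms comm_monoid.intro S.monoid_axioms comm_monoid_axioms.intro)
      (simp add: D_comm)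
  then show "comm_cstar_algebra sub"
    by (intro comm_cstar_algebra.intro S.cstar_algebra_axioms)
qed

lemma sub_selfadjoint_iff: "x \<in> selfadjoint_elements sub \<longleftrightarrow> x \<in> D \<and> x \<in> selfadjoint_elements A"
  unfolding selfadjoint_elements_def by auto

lemma sub_squares_subset:
  assumes "h \<in> squares sub" shows "h \<in> squares A \<and> h \<in> D"
proof -
  obtain k where "k \<in> D" "k \<in> selfadjoint_elements A" "h = k \<otimes> k"
    using sub.squaresE[OF assms] by (auto simp: sub_selfadjoint_iff)
  then show ?thesis
    by (simp add: square_in_squares)
qed

text \<open>The norm criterion refers only to the unit, differences and the norm, which
  \<open>D\<close> inherits. This takes the place of spectral permanence.\<close>

lemma sub_squares_iff: "h \<in> squares sub \<longleftrightarrow> h \<in> squares A \<and> h \<in> D"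
proof
  assume *: "h \<in> squares A \<and> h \<in> D"
  then have "nrm A (complex_of_real (nrm A h + 1) \<odot> \<one> \<ominus> h) \<le> nrm A h + 1"
    using nrm_nonneg[of h] by (intro norm_diff_square_le) auto
  then show "h \<in> squares sub"
    using * nrm_nonneg[of h]
    by (intro sub.squaresI[of _ "nrm A h + 1"]) (auto simp: sub_selfadjoint_iff sub_diff)
qed (rule sub_squares_subset)

lemma sub_converges_iff: "converges sub f l \<longleftrightarrow> converges A f l \<and> (\<forall>n. f n \<in> D) \<and> l \<in> D"
  by (auto simp: converges_def sub_diff)

end

section \<open>Order in abelian C*-algebras\<close>

context comm_cstar_algebra
begin

lemma squares_mult:
  assumes "h \<in> squares A" "g \<in> squares A"
  shows "h \<otimes> g \<in> squares A"
proof -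
  obtain k l where k: "k \<in> selfadjoint_elements A" "h = k \<otimes> k" and l: "l \<in> selfadjoint_elements A" "g = l \<otimes> l"
    using assms by (meson squaresE)
  then have "h \<otimes> g = (k \<otimes> l) \<otimes> (k \<otimes> l)"
    by (simp add: m_ac)
  moreover have "k \<otimes> l \<in> selfadjoint_elements A"
    using k l by (intro selfadjointI) (simp_all add: star_mult m_comm)
  ultimately show ?thesis
    by (simp add: square_in_squares)
qed

lemma squares_pow: "h \<in> squares A \<Longrightarrow> h [^] (n::nat) \<in> squares A"
  by (induction n) (auto intro: squares_mult)

text \<open>The product (1 - a) (1 + a) = 1 - a^2 is a square s^2, so s and a are commuting
  self-adjoint elements whose squares add up to 1.\<close>

lemma norm_le_one:
  assumes a: "a \<in> selfadjoint_elements A" "\<one> \<ominus> a \<in> squares A" "\<one> \<oplus> a \<in> squares A"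
  shows "nrm A a \<le> 1"
proof -
  have [simp]: "a \<in> carrier A"
    using a by simp
  have "(\<one> \<ominus> a) \<otimes> (\<one> \<oplus> a) \<in> squares A"
    using a by (intro squares_mult)
  then obtain s where s: "s \<in> selfadjoint_elements A" "(\<one> \<ominus> a) \<otimes> (\<one> \<oplus> a) = s \<otimes> s"
    by (rule squaresE)
  have "(\<one> \<ominus> a) \<otimes> (\<one> \<oplus> a) \<oplus> a \<otimes> a = \<one>"
    using a(1)[THEN selfadjointD(1)] by algebra
  then show ?thesis
    using s a by (intro norm_le_one_of_squares_sum_one[of s a]) (auto simp: m_comm)
qed

text \<open>If h and -h are positive, so are 1 + n h and 1 - n h, whence n ||h|| \<le> 1 for every
  n.\<close>

lemma squares_antisym:
  assumes h: "h \<in> squares A" "\<ominus> h \<in> squares A"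
  shows "h = \<zero>"
proof -
  have hc [simp]: "h \<in> carrier A"
    using h by simp
  have "real n * nrm A h \<le> 1" for n
  proof -
    let ?h = "complex_of_real (real n) \<odot> h"
    have "?h \<in> squares A" "complex_of_real (real n) \<odot> (\<ominus> h) \<in> squares A"
      using h by (auto simp del: of_real_of_nat_eq intro: squares_smult)
    then have "\<one> \<oplus> ?h \<in> squares A" "\<one> \<ominus> ?h \<in> squares A"
      by (simp_all add: squares_add minus_eq smult_minus_right del: of_real_of_nat_eq)
    then have "nrm A ?h \<le> 1"
      using h by (intro norm_le_one selfadjoint_smult) auto
    then show ?thesis
      by (simp add: nrm_smult)
  qed
  then have "nrm A h \<le> 0"
    by (meson ex_less_of_nat_mult linorder_not_le)
  then show ?thesis
    using nrm_eq_0_iff[of h] nrm_nonneg[of h] by simp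
qed

lemma squares_sum_zero:
  assumes h: "h \<in> squares A" "g \<in> squares A" "h \<oplus> g = \<zero>"
  shows "h = \<zero>"
  using h squares_antisym[of h] sum_eq_zeroD[of h g] by simp

lemma vsum_squares_eq_zero:
  "(\<And>k. k < n \<Longrightarrow> f k \<in> squares A) \<Longrightarrow> vsum A f n = \<zero> \<Longrightarrow> k < n \<Longrightarrow> f k = \<zero>"
proof (induction n)
  case (Suc n)
  have 1: "vsum A f n \<in> squares A" "f n \<in> squares A"
    using Suc.prems by (auto intro: squares_vsum)
  then have "vsum A f n = \<zero>" "f n = \<zero>"
    using squares_sum_zero[of "vsum A f n" "f n"] squares_sum_zero[of "f n" "vsum A f n"] Suc.prems(2)
    by (auto simp: a_comm)
  with Suc show ?case
    by (cases "k = n") auto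
qed simp

text \<open>The factor g is the geometric sum of the powers of 1 - s. The elements 1 - (1 - s)^n
  serve as an approximate unit for the ideal generated by s.\<close>

lemma one_minus_pow:
  assumes s: "s \<in> squares A" "\<one> \<ominus> s \<in> squares A"
  shows "\<exists>g\<in>squares A. \<one> \<ominus> (\<one> \<ominus> s) [^] (n::nat) = s \<otimes> g"
proof (induction n)
  case 0
  show ?case
    using s by (intro bexI[of _ \<zero>]) auto
next
  case (Suc n)
  then obtain g where g: "g \<in> squares A" "\<one> \<ominus> (\<one> \<ominus> s) [^] n = s \<otimes> g"
    by blast
  let ?p = "(\<one> \<ominus> s) [^] n"
  have c: "?p \<in> carrier A" "s \<in> carrier A" "g \<in> carrier A"
    using s g by simp_all
  have "\<one> \<ominus> ?p \<otimes> (\<one> \<ominus> s) = (\<one> \<ominus> ?p) \<oplus> s \<otimes> ?p"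
    using c by algebra
  also have "\<dots> = s \<otimes> (g \<oplus> ?p)"
    unfolding g(2) using c by algebra
  finally show ?case
    using g s by (intro bexI[of _ "g \<oplus> ?p"]) (auto intro: squares_add squares_pow)
qed

text \<open>The scalar inequality (n + 1) s (1 - s)^n \<le> 1 - (1 - s)^(n + 1) for 0 \<le> s \<le>
  1, proved inside the cone by induction on n. It gives the rate at which the approximate unit acts
  on s.\<close>

lemma norm_mult_one_minus_pow:
  assumes s: "s \<in> squares A" "\<one> \<ominus> s \<in> squares A"
  shows "nrm A (s \<otimes> (\<one> \<ominus> s) [^] (n::nat)) \<le> 1 / real (Suc n)"
proof -
  let ?r = "\<lambda>n::nat. (\<one> \<ominus> s) [^] n"
  have sc [simp]: "s \<in> carrier A" using s by simp
  have rc [simp]: "?r n \<in> carrier A" for n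
    by simp
  let ?c = "\<lambda>n. complex_of_real (real n) \<odot> \<one>"
  have cS: "?c n \<in> squares A" for n
    by (intro squares_smult) auto
  have cc [simp]: "?c n \<in> carrier A" for n
    by simp
  have cSuc: "?c (Suc n) = ?c n \<oplus> \<one>" for n
    by (simp add: smult_add_left a_comm)
  have main: "\<one> \<ominus> ?r (Suc n) \<ominus> ?c (Suc n) \<otimes> (s \<otimes> ?r n) \<in> squares A" for n
  proof (induction n)
    case 0
    have "\<one> \<ominus> (\<one> \<ominus> s) \<ominus> s = \<zero>"
      using sc by algebra
    then show ?case
      by simp
  next
    case (Suc n)
    \<comment> \<open>From n to n + 1 the claim gains the positive term (n + 1) s^2 (1 -
      s)^n.\<close>
    have "\<one> \<ominus> p \<otimes> (\<one> \<ominus> s) \<otimes> (\<one> \<ominus> s) \<ominus> (c \<oplus> \<one>) \<otimes> (s \<otimes> (p \<otimes> (\<one> \<ominus> s))) =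
        (\<one> \<ominus> p \<otimes> (\<one> \<ominus> s) \<ominus> c \<otimes> (s \<otimes> p)) \<oplus> c \<otimes> (s \<otimes> s \<otimes> p)"
      if "p \<in> carrier A" "c \<in> carrier A" for p c
      using sc that by algebra
    from this[OF rc[of n] cc[of "Suc n"]]
    have "\<one> \<ominus> ?r (Suc (Suc n)) \<ominus> ?c (Suc (Suc n)) \<otimes> (s \<otimes> ?r (Suc n)) =
        (\<one> \<ominus> ?r (Suc n) \<ominus> ?c (Suc n) \<otimes> (s \<otimes> ?r n)) \<oplus> ?c (Suc n) \<otimes> (s \<otimes> s \<otimes> ?r n)"
      by (simp only: nat_pow_Suc cSuc[of "Suc n"])
    also have "\<dots> \<in> squares A"
      by (intro squares_add Suc squares_mult cS s squares_pow)
    finally show ?case .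
  qed
  let ?a = "?c (Suc n) \<otimes> (s \<otimes> ?r n)"
  have a: "?a \<in> squares A"
    by (intro squares_mult cS s squares_pow)
  have "(\<one> \<ominus> ?r (Suc n) \<ominus> ?a) \<oplus> ?r (Suc n) \<in> squares A"
    by (intro squares_add main squares_pow s)
  moreover have "(\<one> \<ominus> ?r (Suc n) \<ominus> ?a) \<oplus> ?r (Suc n) = \<one> \<ominus> ?a"
  proof -
    have "?a \<in> carrier A" "?r (Suc n) \<in> carrier A" using a by simp_all
    then show ?thesis by algebra
  qed
  ultimately have "nrm A ?a \<le> 1"
    using a by (intro norm_le_one squares_add) auto
  moreover have "?a = complex_of_real (real (Suc n)) \<odot> (s \<otimes> ?r n)"
    by (subst smult_mult_left) simp_all
  ultimately have "real (Suc n) * nrm A (s \<otimes> ?r n) \<le> 1"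
    by (simp add: nrm_smult del: of_real_of_nat_eq of_nat_Suc)
  then show ?thesis
    by (simp add: field_simps)
qed

text \<open>The element \<open>q\<close> is the limit of \<open>q (1 - (1 - s)\<^sup>n) = q\<^sup>2 g\<^sub>n\<close> with \<open>g\<^sub>n\<close> positive.\<close>

lemma in_squares_if_mult_eq_square:
  assumes q: "q \<in> selfadjoint_elements A" and s: "s \<in> squares A" "\<one> \<ominus> s \<in> squares A"
    and eq: "q \<otimes> s = q \<otimes> q"
  shows "q \<in> squares A"
proof (rule squares_limit)
  let ?r = "\<lambda>n::nat. (\<one> \<ominus> s) [^] n"
  have [simp]: "q \<in> carrier A" "s \<in> carrier A"
    using q s by simp_all
  show "q \<otimes> (\<one> \<ominus> ?r n) \<in> squares A" for n
  proof -
    obtain g where g: "g \<in> squares A" "\<one> \<ominus> ?r n = s \<otimes> g"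
      using one_minus_pow[OF s] by blast
    then have "q \<otimes> (\<one> \<ominus> ?r n) = (q \<otimes> q) \<otimes> g"
      by (simp flip: m_assoc add: eq)
    then show ?thesis
      using g q by (auto intro: squares_mult)
  qed
  show "converges A (\<lambda>n. q \<otimes> (\<one> \<ominus> ?r n)) q"
  proof (rule converges_bound)
    fix n
    have rsa: "?r n \<in> selfadjoint_elements A"
      using squares_pow[OF s(2)] by simp
    have [simp]: "?r n \<in> carrier A" "(?r n)\<^sup>\<star> = ?r n"
      using rsa by simp_all
    have "q \<otimes> (\<one> \<ominus> ?r n) \<ominus> q = \<ominus> (q \<otimes> ?r n)"
    proof -
      have "q \<in> carrier A" "?r n \<in> carrier A" by simp_all
      then show ?thesis by algebra
    qed
    \<comment> \<open>The C*-identity brings in q^2, which the hypothesis turns into q s; and s (1 -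
      s)^(2n) is small.\<close>
    then have "(nrm A (q \<otimes> (\<one> \<ominus> ?r n) \<ominus> q))\<^sup>2 = nrm A ((q \<otimes> ?r n)\<^sup>\<star> \<otimes> (q \<otimes> ?r n))"
      by (simp add: cstar_identity)
    also have "(q \<otimes> ?r n)\<^sup>\<star> \<otimes> (q \<otimes> ?r n) = (q \<otimes> q) \<otimes> (?r n \<otimes> ?r n)"
      using q by (simp add: star_mult m_ac)
    also have "\<dots> = q \<otimes> (s \<otimes> ?r (n + n))"
      by (simp add: eq[symmetric] m_assoc nat_pow_mult)
    also have "nrm A \<dots> \<le> nrm A q * nrm A (s \<otimes> ?r (n + n))"
      by (simp add: nrm_mult)
    also have "\<dots> \<le> nrm A q * (1 / real (Suc (n + n)))"
      using norm_mult_one_minus_pow[OF s, of "n + n"] by (intro mult_left_mono) (auto simp: nrm_nonneg)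
    also have "\<dots> \<le> nrm A q * (1 / real (Suc n))"
      by (intro mult_left_mono) (auto simp: nrm_nonneg frac_le)
    finally show "nrm A (q \<otimes> (\<one> \<ominus> ?r n) \<ominus> q) \<le> sqrt (nrm A q * (1 / real (Suc n)))"
      by (rule real_le_rsqrt)
  next
    have "(\<lambda>n. sqrt (nrm A q * (1 / real (Suc n)))) \<longlonglongrightarrow> sqrt (nrm A q * 0)"
      by (intro tendsto_intros LIMSEQ_Suc[OF lim_1_over_n])
    then show "(\<lambda>n. sqrt (nrm A q * (1 / real (Suc n)))) \<longlonglongrightarrow> 0"
      by simp
  qed simp_all
qed

text \<open>The modulus s of x is a root of x^2 = 1 - (1 - x^2), since roots are available for 1
  minus a self-adjoint contraction. The parts are (s + x) / 2 and (s - x) / 2, with product (s^2 -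
  x^2) / 4 = 0. Their positivity is the substance and comes from
  \<open>in_squares_if_mult_eq_square\<close>.\<close>

lemma pos_neg_parts_contraction:
  assumes x: "x \<in> selfadjoint_elements A" "nrm A x \<le> 1"
  shows "\<exists>p\<in>squares A. \<exists>m\<in>squares A. x = p \<ominus> m \<and> p \<otimes> m = \<zero>"
proof -
  have xc [simp]: "x \<in> carrier A"
    using x by simp
  have t: "\<one> \<ominus> x \<otimes> x \<in> selfadjoint_elements A"
    using x by (intro selfadjoint_intros)
  obtain s where s: "s \<in> selfadjoint_elements A" "s \<otimes> s = \<one> \<ominus> (\<one> \<ominus> x \<otimes> x)" "nrm A (\<one> \<ominus> s) \<le> 1"
    using sqrt_one_minus[OF t norm_one_minus_square_le[OF x]] by blast
  have sc [simp]: "s \<in> carrier A"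
    using s by simp
  have ss: "s \<otimes> s = x \<otimes> x"
    unfolding s(2) using xc by algebra
  have sS: "s \<in> squares A"
    using s by (intro squaresI[of s 1]) auto
  have "(nrm A s)\<^sup>2 = (nrm A x)\<^sup>2"
    using cstar_identity[of s] cstar_identity[of x] s(1) x(1) ss by simp
  then have "nrm A s = nrm A x"
    by (simp add: nrm_nonneg)
  then have s1: "\<one> \<ominus> s \<in> squares A"
    using s x by (intro one_minus_in_squares) auto
  have half: "(1/2) \<odot> (y \<otimes> s) = (1/2) \<odot> y \<otimes> s" if "y \<in> carrier A" for y
    using that by (simp add: smult_mult_left)
  \<comment> \<open>If y^2 = s^2, then (s + y)^2 = 2 (s + y) s, so q = (s + y) / 2 satisfies q s =
    q^2. This is used for y = x and for y = -x.\<close>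
  have in_sq: "(1/2) \<odot> (s \<oplus> y) \<in> squares A" if y: "y \<in> selfadjoint_elements A" "y \<otimes> y = s \<otimes> s" for y
  proof (rule in_squares_if_mult_eq_square[OF _ sS s1])
    have yc: "y \<in> carrier A" using y by simp
    show "(1/2) \<odot> (s \<oplus> y) \<in> selfadjoint_elements A"
      using selfadjoint_smult[OF selfadjoint_add[OF s(1) y(1)], of "1/2"] by simp
    have "(s \<oplus> y) \<otimes> (s \<oplus> y) = s \<otimes> s \<oplus> s \<otimes> y \<oplus> (s \<otimes> y \<oplus> y \<otimes> y)"
      using yc sc by algebra
    also have "\<dots> = (s \<oplus> y) \<otimes> s \<oplus> (s \<oplus> y) \<otimes> s"
      unfolding y(2) using yc sc by algebra
    finally have "(1/2) \<odot> ((1/2) \<odot> ((s \<oplus> y) \<otimes> (s \<oplus> y))) = (1/2) \<odot> ((s \<oplus> y) \<otimes> s)"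
      using yc by (simp add: smult_add_right sum_halves del: smult_smult)
    then show "(1/2) \<odot> (s \<oplus> y) \<otimes> s = (1/2) \<odot> (s \<oplus> y) \<otimes> ((1/2) \<odot> (s \<oplus> y))"
      using yc by (simp add: smult_mult_left smult_mult_right)
  qed
  let ?p = "(1/2) \<odot> (s \<oplus> x)" and ?m = "(1/2) \<odot> (s \<oplus> \<ominus> x)"
  have "?p \<in> squares A"
    using in_sq[OF x(1)] ss by simp
  moreover have "?m \<in> squares A"
    using in_sq[OF selfadjoint_minus[OF x(1)]] ss by (simp add: l_minus r_minus)
  moreover have "x = ?p \<ominus> ?m"
  proof -
    have "(s \<oplus> x) \<ominus> (s \<oplus> \<ominus> x) = x \<oplus> x"
      using xc sc by algebra
    then have "(1/2) \<odot> ((s \<oplus> x) \<ominus> (s \<oplus> \<ominus> x)) = x"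
      by (simp add: smult_add_right sum_halves)
    then show ?thesis
      by (simp add: smult_diff_right)
  qed
  moreover have "?p \<otimes> ?m = \<zero>"
  proof -
    have "(s \<oplus> x) \<otimes> (s \<oplus> \<ominus> x) = s \<otimes> s \<ominus> x \<otimes> x"
      using xc sc by algebra
    then show ?thesis
      by (simp add: smult_mult_left smult_mult_right ss)
  qed
  ultimately show ?thesis
    by blast
qed

lemma pos_neg_parts:
  assumes x: "x \<in> selfadjoint_elements A"
  obtains p m where "p \<in> squares A" "m \<in> squares A" "x = p \<ominus> m" "p \<otimes> m = \<zero>"
proof -
  have xc [simp]: "x \<in> carrier A"
    using x by simp
  define c where "c = nrm A x + 1"
  have c: "0 < c" "nrm A x \<le> c"
    using nrm_nonneg[of x] by (auto simp: c_def)
  have "nrm A (complex_of_real (1/c) \<odot> x) \<le> 1"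
    using c by (simp add: nrm_smult norm_divide)
  then obtain p m where pm: "p \<in> squares A" "m \<in> squares A" "complex_of_real (1/c) \<odot> x = p \<ominus> m" "p \<otimes> m = \<zero>"
    using pos_neg_parts_contraction[OF selfadjoint_smult[OF x]] by blast
  show thesis
  proof
    show "complex_of_real c \<odot> p \<in> squares A" "complex_of_real c \<odot> m \<in> squares A"
      using c pm by (auto intro: squares_smult)
    have "complex_of_real c \<odot> (p \<ominus> m) = x"
      using c by (simp flip: pm(3))
    then show "x = complex_of_real c \<odot> p \<ominus> complex_of_real c \<odot> m"
      using pm by (simp add: smult_diff_right)
    show "(complex_of_real c \<odot> p) \<otimes> (complex_of_real c \<odot> m) = \<zero>"
      using pm by (simp add: smult_mult_left smult_mult_right)
  qed
qed

text \<open>A growth bound: it makes powers of 1 + P large wherever P is, so that a uniform bound on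
  them forces P to vanish.\<close>

lemma bernoulli:
  assumes P: "P \<in> squares A"
  shows "(\<one> \<oplus> P) [^] n \<ominus> \<one> \<ominus> complex_of_real (real n) \<odot> P \<in> squares A"
proof (induction n)
  case 0
  show ?case
    using P by simp
next
  case (Suc n)
  let ?r = "(\<one> \<oplus> P) [^] n" and ?c = "complex_of_real (real n) \<odot> P"
  have c: "?r \<in> carrier A" "P \<in> carrier A" "?c \<in> carrier A"
    using P by simp_all
  have "?r \<otimes> (\<one> \<oplus> P) \<ominus> \<one> \<ominus> (P \<oplus> ?c) = (?r \<ominus> \<one> \<ominus> ?c) \<oplus> ((?r \<ominus> \<one> \<ominus> ?c) \<otimes> P \<oplus> ?c \<otimes> P)"
  proof -
    have "?r \<otimes> (\<one> \<oplus> P) \<ominus> \<one> \<ominus> (P \<oplus> ?c) = (?r \<ominus> \<one> \<ominus> ?c) \<oplus> (?r \<ominus> \<one>) \<otimes> P"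
      using c by algebra
    also have "(?r \<ominus> \<one>) \<otimes> P = (?r \<ominus> \<one> \<ominus> ?c) \<otimes> P \<oplus> ?c \<otimes> P"
      using c by algebra
    finally show ?thesis .
  qed
  moreover have "?c \<in> squares A"
    using P by (intro squares_smult) auto
  ultimately have "?r \<otimes> (\<one> \<oplus> P) \<ominus> \<one> \<ominus> (P \<oplus> ?c) \<in> squares A"
    using Suc P by (auto intro!: squares_add squares_mult)
  moreover have "complex_of_real (real (Suc n)) \<odot> P = P \<oplus> ?c"
    using c by (simp add: smult_add_left)
  ultimately show ?case
    using c by (simp only: nat_pow_Suc)
qed

end

section \<open>Commutants, and bicommutants as abelian subalgebras\<close>

definition commutant :: "('a, 'm) cstar_scheme \<Rightarrow> 'a set \<Rightarrow> 'a set" where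
  "commutant A T = {y \<in> carrier A. \<forall>x\<in>T. x \<otimes>\<^bsub>A\<^esub> y = y \<otimes>\<^bsub>A\<^esub> x}"

context cstar_algebra
begin

lemma commutant_abelian_subalgebra:
  assumes T: "T \<subseteq> carrier A" "\<And>x. x \<in> T \<Longrightarrow> x\<^sup>\<star> \<in> T"
    and comm: "\<And>x y. x \<in> commutant A T \<Longrightarrow> y \<in> commutant A T \<Longrightarrow> x \<otimes> y = y \<otimes> x"
  shows "abelian_cstar_subalgebra A (commutant A T)"
  unfolding abelian_cstar_subalgebra_def
proof (intro conjI ballI allI)
  have sub: "x \<in> carrier A" if "x \<in> T" for x
    using T that by blast
  have mult: "x \<otimes> (y \<otimes> z) = (y \<otimes> z) \<otimes> x" if "x \<in> T" "y \<in> commutant A T" "z \<in> commutant A T" for x y z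
    using that sub[OF that(1)] by (simp add: commutant_def) (metis m_assoc)
  show "subcring (commutant A T) A"
  proof (rule subcringI[OF subringI])
    show "h1 \<otimes> h2 \<in> commutant A T" if "h1 \<in> commutant A T" "h2 \<in> commutant A T" for h1 h2
      using mult[OF _ that] that unfolding commutant_def by blast
    show "h1 \<otimes> h2 = h2 \<otimes> h1" if "h1 \<in> commutant A T" "h2 \<in> commutant A T" for h1 h2
      using that by (rule comm)
  qed (use sub in \<open>auto simp: commutant_def l_distr r_distr l_minus r_minus\<close>)
  show "c \<odot> x \<in> commutant A T" if "x \<in> commutant A T" for c x
    using that sub by (auto simp: commutant_def smult_mult_left smult_mult_right)
  show "x\<^sup>\<star> \<in> commutant A T" if x: "x \<in> commutant A T" for x
  proof -
    have "y \<otimes> x\<^sup>\<star> = x\<^sup>\<star> \<otimes> y" if y: "y \<in> T" for y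
    proof -
      have "(y\<^sup>\<star> \<otimes> x)\<^sup>\<star> = (x \<otimes> y\<^sup>\<star>)\<^sup>\<star>"
        using x T(2)[OF y] by (simp add: commutant_def)
      then show ?thesis
        using x sub[OF y] by (simp add: commutant_def star_mult)
    qed
    then show ?thesis
      using x by (simp add: commutant_def)
  qed
  show "closedin (norm_topology A) (commutant A T)"
    unfolding closedin_norm_topology_iff
  proof (intro conjI allI impI)
    fix f l assume "range f \<subseteq> commutant A T \<and> converges A f l"
    then have f: "\<And>n. f n \<in> commutant A T" and l: "converges A f l"
      by auto
    have "x \<otimes> l = l \<otimes> x" if x: "x \<in> T" for x
    proof (rule converges_unique)
      show "converges A (\<lambda>n. x \<otimes> f n) (x \<otimes> l)"
        using sub[OF x] l by (intro converges_mult converges_const)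
      have "x \<otimes> f n = f n \<otimes> x" for n
        using f x by (simp add: commutant_def)
      then show "converges A (\<lambda>n. x \<otimes> f n) (l \<otimes> x)"
        using sub[OF x] l by (simp add: converges_mult converges_const)
    qed
    then show "l \<in> commutant A T"
      using l by (simp add: commutant_def converges_closed)
  qed (auto simp: commutant_def)
qed

text \<open>A commuting T lies in its commutant, so its bicommutant lies in the commutant too and
  commutes with itself. This supplies an abelian C*-algebra around given commuting elements: around
  \<open>b\<^sup>\<star> b\<close> below, and around a MASA with one more element later.\<close>

lemma bicommutant:
  assumes T: "T \<subseteq> carrier A" "\<And>x. x \<in> T \<Longrightarrow> x\<^sup>\<star> \<in> T"
    and comm: "\<And>x y. x \<in> T \<Longrightarrow> y \<in> T \<Longrightarrow> x \<otimes> y = y \<otimes> x"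
  shows "abelian_cstar_subalgebra A (commutant A (commutant A T))" "T \<subseteq> commutant A (commutant A T)"
proof -
  show sub: "T \<subseteq> commutant A (commutant A T)"
    using T by (auto simp: commutant_def)
  show "abelian_cstar_subalgebra A (commutant A (commutant A T))"
  proof (rule commutant_abelian_subalgebra)
    show "commutant A T \<subseteq> carrier A"
      by (auto simp: commutant_def)
    show "x\<^sup>\<star> \<in> commutant A T" if x: "x \<in> commutant A T" for x
    proof -
      have "y \<otimes> x\<^sup>\<star> = x\<^sup>\<star> \<otimes> y" if y: "y \<in> T" for y
      proof -
        have "(y\<^sup>\<star> \<otimes> x)\<^sup>\<star> = (x \<otimes> y\<^sup>\<star>)\<^sup>\<star>"
          using x T(2)[OF y] by (simp add: commutant_def)
        moreover have "y \<in> carrier A" using T y by blast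
        ultimately show ?thesis
          using x by (simp add: commutant_def star_mult)
      qed
      then show ?thesis
        using x by (simp add: commutant_def)
    qed
    have "T \<subseteq> commutant A T"
      using T comm by (auto simp: commutant_def)
    then show "x \<otimes> y = y \<otimes> x"
      if "x \<in> commutant A (commutant A T)" "y \<in> commutant A (commutant A T)" for x y
    proof -
      have "x \<in> commutant A T"
        using that \<open>T \<subseteq> commutant A T\<close> by (auto simp: commutant_def)
      with that show ?thesis
        by (auto simp: commutant_def)
    qed
  qed
qed

end

section \<open>Positivity of \<open>b\<^sup>\<star> b\<close>\<close>

context abelian_subalgebra
begin

lemma D_squares_mult:
  "h \<in> squares A \<Longrightarrow> h \<in> D \<Longrightarrow> g \<in> squares A \<Longrightarrow> g \<in> D \<Longrightarrow> h \<otimes> g \<in> squares A"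
  using sub.squares_mult[of h g] by (simp add: sub_squares_iff)

lemma D_norm_le_one:
  "a \<in> selfadjoint_elements A \<Longrightarrow> a \<in> D \<Longrightarrow> \<one> \<ominus> a \<in> squares A \<Longrightarrow> \<one> \<oplus> a \<in> squares A \<Longrightarrow> nrm A a \<le> 1"
  using sub.norm_le_one[of a] by (simp add: sub_squares_iff sub_selfadjoint_iff sub_diff)

lemma D_pow: "P \<in> D \<Longrightarrow> P [^]\<^bsub>sub\<^esub> (n::nat) = P [^] n" "P \<in> D \<Longrightarrow> P [^] n \<in> D"
  by (induction n) auto

lemma D_bernoulli:
  "P \<in> squares A \<Longrightarrow> P \<in> D \<Longrightarrow> (\<one> \<oplus> P) [^] n \<ominus> \<one> \<ominus> complex_of_real (real n) \<odot> P \<in> squares A"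
  using sub.bernoulli[of P n] by (simp add: sub_squares_iff sub_diff D_pow)

text \<open>Instead of comparing the spectra of \<open>z\<^sup>\<star> z\<close> and
  \<open>z z\<^sup>\<star>\<close>, powers are compared. The element q =
  \<open>z z\<^sup>\<star>\<close> is positive, because q - P is the sum of
  \<open>z\<^sup>\<star> z\<close> and \<open>z z\<^sup>\<star>\<close>; so ||1 - q|| \<le> 1. From
  (1 - q) z = z (1 + P) one gets that \<open>z\<^sup>\<star> (1 - q)^k z\<close> is -P (1 + P)^k, of
  norm at most 1 for every k. Bernoulli's inequality then bounds k P^2 by 1.\<close>

lemma star_mult_eq_minus_contraction:
  assumes z: "z \<in> carrier A" "nrm A z \<le> 1" and P: "P \<in> squares A" "P \<in> D" and eq: "z\<^sup>\<star> \<otimes> z = \<ominus> P"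
  shows "P = \<zero>"
proof -
  note [simp] = z(1) P(2)
  define q where "q = z \<otimes> z\<^sup>\<star>"
  have q [simp]: "q \<in> carrier A"
    by (simp add: q_def)
  have "(z\<^sup>\<star> \<otimes> z \<oplus> q) \<oplus> P \<in> squares A"
    unfolding q_def by (rule squares_add[OF star_mult_add_mult_star_in_squares[OF z(1)] P(1)])
  moreover have "(\<ominus> P \<oplus> q) \<oplus> P = q"
    using D_carrier[OF P(2)] q by algebra
  ultimately have qS: "q \<in> squares A"
    by (simp add: eq)
  have "nrm A q \<le> nrm A z * nrm A z"
    unfolding q_def using nrm_mult[of z "z\<^sup>\<star>"] by simp
  also have "\<dots> \<le> 1"
    using z nrm_nonneg[of z] by (simp add: mult_le_one)
  finally have q1: "nrm A (\<one> \<ominus> q) \<le> 1"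
    using norm_diff_square_le[OF qS, of 1] by simp
  have pow1: "nrm A ((\<one> \<ominus> q) [^] k) \<le> 1" for k :: nat
  proof (induction k)
    case 0
    then show ?case
      by (simp add: nrm_one_le)
  next
    case (Suc k)
    have "nrm A ((\<one> \<ominus> q) [^] Suc k) \<le> nrm A ((\<one> \<ominus> q) [^] k) * nrm A (\<one> \<ominus> q)"
      by (simp add: nrm_mult)
    also have "\<dots> \<le> 1"
      using Suc q1 by (intro mult_le_one) (auto simp: nrm_nonneg)
    finally show ?case .
  qed
  have zq: "(\<one> \<ominus> q) \<otimes> z = z \<otimes> (\<one> \<oplus> P)"
  proof -
    have "q \<otimes> z = z \<otimes> (\<ominus> P)"
      unfolding q_def eq[symmetric] by (simp add: m_assoc)
    moreover have "(\<one> \<ominus> q) \<otimes> z = z \<ominus> q \<otimes> z"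
      using z(1) q by algebra
    ultimately show ?thesis
      using z(1) D_carrier[OF P(2)] by (simp add: r_distr r_minus minus_eq)
  qed
  have inter: "(\<one> \<ominus> q) [^] k \<otimes> z = z \<otimes> (\<one> \<oplus> P) [^] k" for k :: nat
  proof (induction k)
    case (Suc k)
    have "(\<one> \<ominus> q) [^] Suc k \<otimes> z = (\<one> \<ominus> q) [^] k \<otimes> (z \<otimes> (\<one> \<oplus> P))"
      by (simp add: m_assoc zq)
    also have "\<dots> = z \<otimes> (\<one> \<oplus> P) [^] k \<otimes> (\<one> \<oplus> P)"
      using Suc by (simp flip: m_assoc)
    finally show ?case
      by (simp add: m_assoc)
  qed simp
  have bound: "nrm A (P \<otimes> (\<one> \<oplus> P) [^] k) \<le> 1" for k :: nat
  proof -
    have "z\<^sup>\<star> \<otimes> ((\<one> \<ominus> q) [^] k \<otimes> z) = \<ominus> (P \<otimes> (\<one> \<oplus> P) [^] k)"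
      unfolding inter using eq by (simp flip: m_assoc add: l_minus)
    then have "nrm A (P \<otimes> (\<one> \<oplus> P) [^] k) = nrm A (z\<^sup>\<star> \<otimes> ((\<one> \<ominus> q) [^] k \<otimes> z))"
      by simp
    also have "\<dots> \<le> nrm A z * (nrm A ((\<one> \<ominus> q) [^] k) * nrm A z)"
      using nrm_mult[of "z\<^sup>\<star>" "(\<one> \<ominus> q) [^] k \<otimes> z"] nrm_mult[of "(\<one> \<ominus> q) [^] k" z] nrm_nonneg[of z]
      by (auto intro: order_trans mult_left_mono)
    also have "\<dots> \<le> 1"
      using pow1[of k] z by (intro mult_le_one mult_nonneg_nonneg) (auto simp: nrm_nonneg)
    finally show ?thesis .
  qed
  have "real k * nrm A (P \<otimes> P) \<le> 1" for k
  proof -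
    let ?r = "(\<one> \<oplus> P) [^] k" and ?c = "complex_of_real (real k) \<odot> P"
    have rD: "?r \<in> D"
      by (simp add: D_pow)
    have QS: "P \<otimes> ?r \<in> squares A"
    proof -
      have "?r \<in> squares A"
      proof (induction k)
        case (Suc k)
        then show ?case
          using P by (auto intro!: D_squares_mult squares_add simp: D_pow)
      qed simp
      then show ?thesis
        using P rD by (intro D_squares_mult)
    qed
    then have "\<one> \<ominus> P \<otimes> ?r \<in> squares A"
      using bound by (intro one_minus_in_squares) auto
    moreover have "P \<otimes> (?r \<ominus> \<one> \<ominus> ?c) \<in> squares A"
      using P rD by (intro D_squares_mult D_bernoulli) auto
    ultimately have "(\<one> \<ominus> P \<otimes> ?r) \<oplus> P \<otimes> (?r \<ominus> \<one> \<ominus> ?c) \<oplus> P \<in> squares A"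
      using P by (intro squares_add)
    moreover have "(\<one> \<ominus> P \<otimes> ?r) \<oplus> P \<otimes> (?r \<ominus> \<one> \<ominus> ?c) \<oplus> P = \<one> \<ominus> P \<otimes> ?c"
    proof -
      have c: "P \<in> carrier A" "?r \<in> carrier A" "?c \<in> carrier A" "P \<otimes> ?r \<in> carrier A" "P \<otimes> ?c \<in> carrier A"
        using rD by simp_all
      then have "P \<otimes> (?r \<ominus> \<one> \<ominus> ?c) = P \<otimes> ?r \<ominus> P \<ominus> P \<otimes> ?c"
        by (simp add: minus_eq r_distr r_minus)
      then show ?thesis
        using c by algebra
    qed
    moreover have c: "P \<otimes> ?c \<in> squares A"
      using P by (intro D_squares_mult squares_smult) auto
    ultimately have "nrm A (P \<otimes> ?c) \<le> 1"
      by (intro D_norm_le_one squares_add) auto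
    then show ?thesis
      by (simp add: smult_mult_right nrm_smult)
  qed
  then have "nrm A (P \<otimes> P) \<le> 0"
    by (meson ex_less_of_nat_mult linorder_not_le)
  then have "P\<^sup>\<star> \<otimes> P = \<zero>"
    using nrm_eq_0_iff[of "P \<otimes> P"] nrm_nonneg[of "P \<otimes> P"] P by simp
  then show ?thesis
    using sub.star_mult_eq_zero[of P] by simp
qed

lemma star_mult_eq_minus:
  assumes z: "z \<in> carrier A" and P: "P \<in> squares A" "P \<in> D" and eq: "z\<^sup>\<star> \<otimes> z = \<ominus> P"
  shows "P = \<zero>"
proof -
  define c where "c = 1 / (nrm A z + 1)"
  have c: "0 < c" "c * nrm A z \<le> 1"
    using nrm_nonneg[OF z] by (auto simp: c_def)
  have Pc: "P \<in> carrier A"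
    using P by simp
  have "complex_of_real (c * c) \<odot> P = \<zero>"
  proof (rule star_mult_eq_minus_contraction)
    show "nrm A (complex_of_real c \<odot> z) \<le> 1"
      using c z by (simp add: nrm_smult)
    show "complex_of_real (c * c) \<odot> P \<in> squares A"
      using P by (intro squares_smult) auto
    show "(complex_of_real c \<odot> z)\<^sup>\<star> \<otimes> (complex_of_real c \<odot> z) = \<ominus> (complex_of_real (c * c) \<odot> P)"
      using z Pc by (simp add: star_smult smult_mult_left smult_mult_right eq smult_minus_right)
  qed (use z P in auto)
  then have "nrm A (complex_of_real (c * c) \<odot> P) = 0"
    by simp
  then have "nrm A P = 0"
    using c Pc by (simp add: nrm_smult norm_mult)
  then show ?thesis
    using Pc nrm_eq_0_iff by blast
qed

end

context cstar_algebra
begin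

text \<open>Write \<open>b\<^sup>\<star> b\<close> = p - m with p m = 0. The element
  \<open>(b m)\<^sup>\<star> (b m)\<close> equals -m^3, so m^3 vanishes by
  \<open>star_mult_eq_minus\<close>, and with it m. The bicommutant is there because the
  decomposition into parts belongs to abelian algebras.\<close>

theorem star_mult_in_squares:
  assumes b [simp]: "b \<in> carrier A"
  shows "b\<^sup>\<star> \<otimes> b \<in> squares A"
proof -
  let ?h = "b\<^sup>\<star> \<otimes> b"
  let ?W = "commutant A (commutant A {?h})"
  have W: "abelian_cstar_subalgebra A ?W" "{?h} \<subseteq> ?W"
    by (rule bicommutant; auto simp: star_mult)+
  interpret W: abelian_subalgebra A ?W
    by unfold_locales (rule W)
  have "?h \<in> selfadjoint_elements W.sub"
    using W(2) by (simp add: W.sub_selfadjoint_iff selfadjoint_star_mult)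
  then obtain p m where pm: "p \<in> squares W.sub" "m \<in> squares W.sub" "?h = p \<ominus>\<^bsub>W.sub\<^esub> m" "p \<otimes>\<^bsub>W.sub\<^esub> m = \<zero>\<^bsub>W.sub\<^esub>"
    by (rule W.sub.pos_neg_parts)
  then have p: "p \<in> squares A" "p \<in> ?W" and m: "m \<in> squares A" "m \<in> ?W"
    by (auto simp only: W.sub_squares_iff)
  have eq: "?h = p \<ominus> m" and pm0: "p \<otimes> m = \<zero>"
    using pm p m by (simp_all add: W.sub_diff)
  have [simp]: "p \<in> carrier A" "m \<in> carrier A" "m\<^sup>\<star> = m"
    using p m by simp_all
  have "(b \<otimes> m)\<^sup>\<star> \<otimes> (b \<otimes> m) = m \<otimes> ?h \<otimes> m"
    by (simp add: star_mult m_assoc)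
  also have "\<dots> = m \<otimes> (p \<otimes> m) \<ominus> m \<otimes> m \<otimes> m"
  proof -
    have "m \<in> carrier A" "p \<in> carrier A" by simp_all
    then show ?thesis unfolding eq by algebra
  qed
  also have "\<dots> = \<ominus> (m \<otimes> m \<otimes> m)"
    by (simp add: pm0 minus_eq)
  finally have "m \<otimes> m \<otimes> m = \<zero>"
    using m by (intro W.star_mult_eq_minus[of "b \<otimes> m"] W.D_squares_mult W.D_mult) auto
  then have "(m \<otimes> m)\<^sup>\<star> \<otimes> (m \<otimes> m) = \<zero>"
    by (simp add: star_mult flip: m_assoc)
  then have "m\<^sup>\<star> \<otimes> m = \<zero>"
    using W.sub.star_mult_eq_zero[of "m \<otimes> m"] m by simp
  then have "m = \<zero>"
    using W.sub.star_mult_eq_zero[of m] m by simp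
  then show ?thesis
    using p eq by (simp add: minus_eq)
qed

end

section \<open>Columns, the algebra-valued inner product and Gram matrices\<close>

definition col :: "('a, 'm) cstar_scheme \<Rightarrow> nat \<Rightarrow> (nat \<Rightarrow> 'a) \<Rightarrow> bool" where
  "col A n \<xi> \<longleftrightarrow> (\<forall>i<n. \<xi> i \<in> carrier A)"

definition ip :: "('a, 'm) cstar_scheme \<Rightarrow> nat \<Rightarrow> (nat \<Rightarrow> 'a) \<Rightarrow> (nat \<Rightarrow> 'a) \<Rightarrow> 'a" where
  "ip A n \<xi> \<eta> = vsum A (\<lambda>i. (\<xi> i)\<^sup>\<star>\<^bsub>A\<^esub> \<otimes>\<^bsub>A\<^esub> \<eta> i) n"

definition mat_vec :: "('a, 'm) cstar_scheme \<Rightarrow> nat \<Rightarrow> (nat \<Rightarrow> nat \<Rightarrow> 'a) \<Rightarrow> (nat \<Rightarrow> 'a) \<Rightarrow> nat \<Rightarrow> 'a" where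
  "mat_vec A n T \<xi> = (\<lambda>i. vsum A (\<lambda>k. T i k \<otimes>\<^bsub>A\<^esub> \<xi> k) n)"

text \<open>Gram matrices, which up to the cut-off are the positive elements of
  \<open>matrix_algebra\<close>, always have this property (\<open>ip_gram_in_squares\<close>). Over
  an abelian algebra, a hermitian matrix with it is a Gram matrix
  (\<open>gram_decomposition\<close>).\<close>

definition form_nonneg :: "('a, 'm) cstar_scheme \<Rightarrow> nat \<Rightarrow> (nat \<Rightarrow> nat \<Rightarrow> 'a) \<Rightarrow> bool" where
  "form_nonneg A n T \<longleftrightarrow> (\<forall>\<xi>. col A n \<xi> \<longrightarrow> ip A n \<xi> (mat_vec A n T \<xi>) \<in> squares A)"

lemma ip_cong:
  "(\<And>i. i < n \<Longrightarrow> \<xi> i = \<xi>' i) \<Longrightarrow> (\<And>i. i < n \<Longrightarrow> \<eta> i = \<eta>' i) \<Longrightarrow> ip A n \<xi> \<eta> = ip A n \<xi>' \<eta>'"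
  by (auto simp: ip_def intro!: vsum_cong)

context cstar_algebra
begin

lemma colD [simp]: "col A n \<xi> \<Longrightarrow> i < n \<Longrightarrow> \<xi> i \<in> carrier A"
  by (simp add: col_def)

lemma entries_inD [simp]: "entries_in A n T \<Longrightarrow> i < n \<Longrightarrow> j < n \<Longrightarrow> T i j \<in> carrier A"
  by (simp add: entries_in_def)

lemma ip_closed [simp]: "col A n \<xi> \<Longrightarrow> col A n \<eta> \<Longrightarrow> ip A n \<xi> \<eta> \<in> carrier A"
  by (auto simp: ip_def)

lemma mat_vec_col [simp]: "entries_in A n T \<Longrightarrow> col A n \<xi> \<Longrightarrow> col A n (mat_vec A n T \<xi>)"
  by (auto simp: col_def mat_vec_def)

lemma mat_adj_entries [simp]: "entries_in A n T \<Longrightarrow> entries_in A n (mat_adj A T)"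
  by (auto simp: entries_in_def mat_adj_def)

lemma col_add [simp]: "col A n \<xi> \<Longrightarrow> col A n \<eta> \<Longrightarrow> col A n (\<lambda>i. \<xi> i \<oplus> \<eta> i)"
  and col_diff [simp]: "col A n \<xi> \<Longrightarrow> col A n \<eta> \<Longrightarrow> col A n (\<lambda>i. \<xi> i \<ominus> \<eta> i)"
  and col_smult [simp]: "col A n \<xi> \<Longrightarrow> col A n (\<lambda>i. c \<odot> \<xi> i)"
  by (simp_all add: col_def)

lemma ip_star: "col A n \<xi> \<Longrightarrow> col A n \<eta> \<Longrightarrow> (ip A n \<xi> \<eta>)\<^sup>\<star> = ip A n \<eta> \<xi>"
  unfolding ip_def by (subst vsum_star) (auto simp: star_mult intro!: vsum_cong)

lemma ip_self_in_squares: "col A n \<xi> \<Longrightarrow> ip A n \<xi> \<xi> \<in> squares A"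
  unfolding ip_def by (intro squares_vsum star_mult_in_squares) simp

lemma ip_add_right: "col A n \<xi> \<Longrightarrow> col A n \<eta> \<Longrightarrow> col A n \<zeta> \<Longrightarrow>
    ip A n \<xi> (\<lambda>i. \<eta> i \<oplus> \<zeta> i) = ip A n \<xi> \<eta> \<oplus> ip A n \<xi> \<zeta>"
  unfolding ip_def by (subst vsum_add[symmetric]) (auto simp: r_distr intro!: vsum_cong)

lemma ip_add_left: "col A n \<xi> \<Longrightarrow> col A n \<eta> \<Longrightarrow> col A n \<zeta> \<Longrightarrow>
    ip A n (\<lambda>i. \<eta> i \<oplus> \<zeta> i) \<xi> = ip A n \<eta> \<xi> \<oplus> ip A n \<zeta> \<xi>"
  unfolding ip_def by (subst vsum_add[symmetric]) (auto simp: l_distr star_add intro!: vsum_cong)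

lemma ip_smult_right: "col A n \<xi> \<Longrightarrow> col A n \<eta> \<Longrightarrow> ip A n \<xi> (\<lambda>i. c \<odot> \<eta> i) = c \<odot> ip A n \<xi> \<eta>"
  unfolding ip_def by (subst vsum_smult[symmetric]) (auto simp: smult_mult_right intro!: vsum_cong)

lemma ip_smult_left: "col A n \<xi> \<Longrightarrow> col A n \<eta> \<Longrightarrow> ip A n (\<lambda>i. c \<odot> \<xi> i) \<eta> = cnj c \<odot> ip A n \<xi> \<eta>"
  unfolding ip_def by (subst vsum_smult[symmetric]) (auto simp: star_smult smult_mult_left intro!: vsum_cong)

lemma ip_diff_right: "col A n \<xi> \<Longrightarrow> col A n \<eta> \<Longrightarrow> col A n \<zeta> \<Longrightarrow>
    ip A n \<xi> (\<lambda>i. \<eta> i \<ominus> \<zeta> i) = ip A n \<xi> \<eta> \<ominus> ip A n \<xi> \<zeta>"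
  unfolding ip_def
  by (subst vsum_diff[symmetric]) (auto simp: minus_eq r_distr r_minus intro!: vsum_cong)

lemma ip_diff_left: "col A n \<xi> \<Longrightarrow> col A n \<eta> \<Longrightarrow> col A n \<zeta> \<Longrightarrow>
    ip A n (\<lambda>i. \<eta> i \<ominus> \<zeta> i) \<xi> = ip A n \<eta> \<xi> \<ominus> ip A n \<zeta> \<xi>"
  unfolding ip_def
  by (subst vsum_diff[symmetric]) (auto simp: minus_eq l_distr l_minus star_add star_minus intro!: vsum_cong)

lemma ip_mat_vec_left:
  assumes "entries_in A n T" "col A n \<xi>" "col A n \<eta>"
  shows "ip A n (mat_vec A n T \<xi>) \<eta> = ip A n \<xi> (mat_vec A n (mat_adj A T) \<eta>)"
proof -
  have [simp]: "T i k \<in> carrier A" "\<xi> k \<in> carrier A" "\<eta> k \<in> carrier A" if "i < n" "k < n" for i k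
    using assms that by auto
  have "ip A n (mat_vec A n T \<xi>) \<eta> = vsum A (\<lambda>i. vsum A (\<lambda>k. (\<xi> k)\<^sup>\<star> \<otimes> ((T i k)\<^sup>\<star> \<otimes> \<eta> i)) n) n"
    unfolding ip_def mat_vec_def
    by (intro vsum_cong, subst vsum_star, simp, subst vsum_mult_right)
      (auto simp: star_mult m_assoc intro!: vsum_cong)
  also have "\<dots> = vsum A (\<lambda>k. vsum A (\<lambda>i. (\<xi> k)\<^sup>\<star> \<otimes> ((T i k)\<^sup>\<star> \<otimes> \<eta> i)) n) n"
    by (rule vsum_swap) simp
  also have "\<dots> = ip A n \<xi> (mat_vec A n (mat_adj A T) \<eta>)"
    unfolding ip_def mat_vec_def mat_adj_def
    by (intro vsum_cong, subst vsum_mult_left) auto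
  finally show ?thesis .
qed

lemma mat_vec_mult:
  assumes "entries_in A n T" "entries_in A n S" "col A n \<xi>" "i < n"
  shows "mat_vec A n (mat_mult A n T S) \<xi> i = mat_vec A n T (mat_vec A n S \<xi>) i"
proof -
  have [simp]: "T i k \<in> carrier A" "S j k \<in> carrier A" "\<xi> k \<in> carrier A" if "j < n" "k < n" for j k
    using assms that by auto
  have "mat_vec A n (mat_mult A n T S) \<xi> i = vsum A (\<lambda>k. vsum A (\<lambda>l. T i l \<otimes> (S l k \<otimes> \<xi> k)) n) n"
    unfolding mat_vec_def mat_mult_def
    by (intro vsum_cong, subst vsum_mult_right) (auto simp: m_assoc intro!: vsum_cong)
  also have "\<dots> = vsum A (\<lambda>l. vsum A (\<lambda>k. T i l \<otimes> (S l k \<otimes> \<xi> k)) n) n"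
    by (rule vsum_swap) simp
  also have "\<dots> = mat_vec A n T (mat_vec A n S \<xi>) i"
    unfolding mat_vec_def by (intro vsum_cong, subst vsum_mult_left) auto
  finally show ?thesis .
qed

lemma mat_vec_cong:
  "(\<And>k. k < n \<Longrightarrow> T i k = S i k) \<Longrightarrow> mat_vec A n T \<xi> i = mat_vec A n S \<xi> i"
  by (auto simp: mat_vec_def intro!: vsum_cong)

lemma ip_gram_in_squares:
  assumes Y: "entries_in A n Y" and \<xi>: "col A n \<xi>"
    and M: "\<And>i j. i < n \<Longrightarrow> j < n \<Longrightarrow> M i j = mat_mult A n (mat_adj A Y) Y i j"
  shows "ip A n \<xi> (mat_vec A n M \<xi>) \<in> squares A"
proof -
  have "mat_vec A n M \<xi> i = mat_vec A n (mat_adj A Y) (mat_vec A n Y \<xi>) i" if "i < n" for i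
    using M Y \<xi> that mat_vec_cong[of n M i "mat_mult A n (mat_adj A Y) Y" \<xi>]
    by (simp add: mat_vec_mult)
  then have "ip A n \<xi> (mat_vec A n M \<xi>) = ip A n \<xi> (mat_vec A n (mat_adj A Y) (mat_vec A n Y \<xi>))"
    by (intro ip_cong) auto
  also have "\<dots> = ip A n (mat_vec A n Y \<xi>) (mat_vec A n Y \<xi>)"
    using Y \<xi> by (simp add: ip_mat_vec_left)
  finally show ?thesis
    using Y \<xi> by (simp add: ip_self_in_squares)
qed

text \<open>The bridge between the cut-off matrices of \<open>matrix_algebra\<close>, multiplied by
  \<open>finsum\<close>, and the unconstrained ones multiplied by \<open>vsum\<close>. Everything
  later about positive matrices passes through it.\<close>

lemma positive_matrix_iff:
  "M \<in> positive_elements (matrix_algebra n A) \<longleftrightarrow>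
    (\<exists>Y. entries_in A n Y \<and> (\<forall>i<n. \<forall>j<n. M i j = mat_mult A n (mat_adj A Y) Y i j)) \<and>
    (\<forall>i j. \<not> (i < n \<and> j < n) \<longrightarrow> M i j = \<zero>)" (is "_ \<longleftrightarrow> ?R")
proof
  assume "M \<in> positive_elements (matrix_algebra n A)"
  then obtain Y where *: "Y \<in> carrier (matrix_algebra n A)"
    "M = Y\<^sup>\<star>\<^bsub>matrix_algebra n A\<^esub> \<otimes>\<^bsub>matrix_algebra n A\<^esub> Y"
    unfolding positive_elements_def by blast
  have Y: "Y i j \<in> carrier A" if "i < n" "j < n" for i j
    using *(1) that by (simp add: matrix_algebra_def)
  have Y2: "M = (\<lambda>i j. if i < n \<and> j < n then finsum A (\<lambda>k. (Y k i)\<^sup>\<star> \<otimes> Y k j) {..<n} else \<zero>)"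
    using *(2) by (simp add: matrix_algebra_def)
  have "entries_in A n Y"
    using Y by (simp add: entries_in_def)
  moreover have "M i j = mat_mult A n (mat_adj A Y) Y i j" if "i < n" "j < n" for i j
    unfolding Y2 mat_mult_def mat_adj_def using Y that by (simp add: finsum_eq_vsum)
  ultimately show ?R
    using Y2 by auto
next
  assume ?R
  then obtain Y where Y: "entries_in A n Y" "\<And>i j. i < n \<Longrightarrow> j < n \<Longrightarrow> M i j = mat_mult A n (mat_adj A Y) Y i j"
    and M0: "\<And>i j. \<not> (i < n \<and> j < n) \<Longrightarrow> M i j = \<zero>"
    by blast
  let ?Y = "\<lambda>i j. if i < n \<and> j < n then Y i j else \<zero>"
  have "?Y \<in> carrier (matrix_algebra n A)"
    using Y(1) by (auto simp: matrix_algebra_def)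
  moreover have "M = ?Y\<^sup>\<star>\<^bsub>matrix_algebra n A\<^esub> \<otimes>\<^bsub>matrix_algebra n A\<^esub> ?Y"
  proof (intro ext)
    fix i j
    show "M i j = (?Y\<^sup>\<star>\<^bsub>matrix_algebra n A\<^esub> \<otimes>\<^bsub>matrix_algebra n A\<^esub> ?Y) i j"
    proof (cases "i < n \<and> j < n")
      case True
      then have "finsum A (\<lambda>k. (?Y k i)\<^sup>\<star> \<otimes> ?Y k j) {..<n} = vsum A (\<lambda>k. (?Y k i)\<^sup>\<star> \<otimes> ?Y k j) n"
        using Y(1) by (intro finsum_eq_vsum) auto
      also have "\<dots> = M i j"
        using True by (auto simp: Y(2) mat_mult_def mat_adj_def intro!: vsum_cong)
      finally show ?thesis
        using True by (simp add: matrix_algebra_def)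
    next
      case False
      then have "M i j = \<zero>"
        by (rule M0)
      with False show ?thesis
        by (auto simp: matrix_algebra_def)
    qed
  qed
  ultimately show "M \<in> positive_elements (matrix_algebra n A)"
    unfolding positive_elements_def by blast
qed

end

section \<open>Positive matrices over an abelian C*-algebra\<close>

text \<open>The operator-norm bound ||T|| \<le> c as an order relation in A rather than a supremum.
  It is the predicate \<open>bd\<close> with which \<open>root_iter_converges\<close> is used for
  matrices.\<close>

definition mat_bound :: "('a, 'm) cstar_scheme \<Rightarrow> nat \<Rightarrow> (nat \<Rightarrow> nat \<Rightarrow> 'a) \<Rightarrow> real \<Rightarrow> bool" where
  "mat_bound A n T c \<longleftrightarrow> (\<forall>\<xi>. col A n \<xi> \<longrightarrow>
    complex_of_real (c\<^sup>2) \<odot>\<^bsub>A\<^esub> ip A n \<xi> \<xi> \<ominus>\<^bsub>A\<^esub> ip A n (mat_vec A n T \<xi>) (mat_vec A n T \<xi>) \<in> squares A)"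

context cstar_algebra
begin

lemma positive_elements_eq_squares: "positive_elements A = squares A"
proof
  show "positive_elements A \<subseteq> squares A"
    by (auto simp: positive_elements_def star_mult_in_squares)
  show "squares A \<subseteq> positive_elements A"
  proof
    fix h assume "h \<in> squares A"
    then obtain k where "k \<in> selfadjoint_elements A" "h = k \<otimes> k"
      by (rule squaresE)
    then have "k \<in> carrier A" "h = k\<^sup>\<star> \<otimes> k"
      by simp_all
    then show "h \<in> positive_elements A"
      unfolding positive_elements_def by blast
  qed
qed

lemma mat_vec_add: "entries_in A n T \<Longrightarrow> entries_in A n S \<Longrightarrow> col A n \<xi> \<Longrightarrow> i < n \<Longrightarrow>
    mat_vec A n (\<lambda>i j. T i j \<oplus> S i j) \<xi> i = mat_vec A n T \<xi> i \<oplus> mat_vec A n S \<xi> i"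
  unfolding mat_vec_def by (subst vsum_add[symmetric]) (auto simp: l_distr intro!: vsum_cong)

lemma mat_vec_smult: "entries_in A n T \<Longrightarrow> col A n \<xi> \<Longrightarrow> i < n \<Longrightarrow>
    mat_vec A n (\<lambda>i j. c \<odot> T i j) \<xi> i = c \<odot> mat_vec A n T \<xi> i"
  unfolding mat_vec_def by (subst vsum_smult[symmetric]) (auto simp: smult_mult_left intro!: vsum_cong)

lemma mat_vec_diff_vec: "entries_in A n T \<Longrightarrow> col A n \<xi> \<Longrightarrow> col A n \<eta> \<Longrightarrow> i < n \<Longrightarrow>
    mat_vec A n T (\<lambda>i. \<xi> i \<ominus> \<eta> i) i = mat_vec A n T \<xi> i \<ominus> mat_vec A n T \<eta> i"
  unfolding mat_vec_def
  by (subst vsum_diff[symmetric]) (auto simp: minus_eq r_distr r_minus intro!: vsum_cong)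

lemma mat_vec_id_diff: "entries_in A n T \<Longrightarrow> col A n \<xi> \<Longrightarrow> i < n \<Longrightarrow>
    mat_vec A n (\<lambda>i j. mat_id A i j \<ominus> T i j) \<xi> i = \<xi> i \<ominus> mat_vec A n T \<xi> i"
proof -
  assume *: "entries_in A n T" "col A n \<xi>" "i < n"
  have [simp]: "mat_id A i k \<in> carrier A" for k
    by (simp add: mat_id_def)
  have "vsum A (\<lambda>k. mat_id A i k \<otimes> \<xi> k) n = \<xi> i"
    using * by (subst vsum_delta[of i]) (auto simp: mat_id_def)
  moreover have "mat_vec A n (\<lambda>i j. mat_id A i j \<ominus> T i j) \<xi> i =
      vsum A (\<lambda>k. mat_id A i k \<otimes> \<xi> k \<ominus> T i k \<otimes> \<xi> k) n"
    unfolding mat_vec_def using * by (intro vsum_cong) (simp add: minus_eq l_distr l_minus)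
  ultimately show ?thesis
    unfolding mat_vec_def using * by (simp add: vsum_diff)
qed

lemma vsum_const: "x \<in> carrier A \<Longrightarrow> vsum A (\<lambda>_. x) n = of_nat n \<odot> x"
  by (induction n) (auto simp: smult_add_left a_comm)

lemma vsum_diff_term_in_squares:
  "(\<And>k. k < n \<Longrightarrow> f k \<in> squares A) \<Longrightarrow> i < n \<Longrightarrow> vsum A f n \<ominus> f i \<in> squares A"
proof (induction n)
  case (Suc n)
  have S: "vsum A f n \<in> squares A" "f n \<in> squares A" "f i \<in> squares A"
    using Suc.prems by (auto intro: squares_vsum)
  then have c: "vsum A f n \<in> carrier A" "f n \<in> carrier A" "f i \<in> carrier A"
    by simp_all
  show ?case
  proof (cases "i = n")
    case True
    have "vsum A f n \<oplus> f n \<ominus> f n = vsum A f n"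
      using c by algebra
    with S True show ?thesis
      by simp
  next
    case False
    then have "vsum A f n \<ominus> f i \<in> squares A"
      using Suc by simp
    moreover have "vsum A f n \<oplus> f n \<ominus> f i = (vsum A f n \<ominus> f i) \<oplus> f n"
      using c by algebra
    ultimately show ?thesis
      using S by (simp add: squares_add)
  qed
qed simp

lemma squares_smult_iff:
  assumes "x \<in> carrier A" "0 < c" "complex_of_real c \<odot> x \<in> squares A"
  shows "x \<in> squares A"
  using squares_smult[OF assms(3), of "1/c"] assms(1,2) by simp

end

context comm_cstar_algebra
begin

lemma norm_le:
  assumes a: "a \<in> squares A" and c: "complex_of_real c \<odot> \<one> \<ominus> a \<in> squares A" "0 < c"
  shows "nrm A a \<le> c"
proof -
  let ?a = "complex_of_real (1/c) \<odot> a"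
  have ac [simp]: "a \<in> carrier A" using a by simp
  have "complex_of_real (1/c) \<odot> (complex_of_real c \<odot> \<one> \<ominus> a) \<in> squares A"
    using c by (intro squares_smult) auto
  then have "\<one> \<ominus> ?a \<in> squares A"
    using c by (simp add: smult_diff_right)
  moreover have "?a \<in> squares A"
    using a c by (intro squares_smult) auto
  ultimately have "nrm A ?a \<le> 1"
    by (intro norm_le_one squares_add) auto
  then show ?thesis
    using c by (simp add: nrm_smult norm_divide field_simps)
qed

lemma mat_bound_cong:
  assumes "\<And>i j. i < n \<Longrightarrow> j < n \<Longrightarrow> T i j = S i j" "mat_bound A n T c"
  shows "mat_bound A n S c"
proof -
  have "ip A n (mat_vec A n T \<xi>) (mat_vec A n T \<xi>) = ip A n (mat_vec A n S \<xi>) (mat_vec A n S \<xi>)" for \<xi>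
    using assms(1) by (intro ip_cong) (auto intro!: mat_vec_cong)
  with assms(2) show ?thesis
    by (simp add: mat_bound_def)
qed

text \<open>Applied to the basis column j, the bound says that the modulus squares of the entries of
  column j of T add up to at most c^2; each summand is then bounded as well.\<close>

lemma mat_bound_entry:
  assumes T: "entries_in A n T" "mat_bound A n T c" and c: "0 < c" and ij: "i < n" "j < n"
  shows "nrm A (T i j) \<le> c"
proof -
  let ?e = "\<lambda>k. mat_id A k j"
  have col: "col A n ?e"
    by (auto simp: col_def mat_id_def)
  have 1: "ip A n ?e ?e = \<one>"
    unfolding ip_def using ij by (subst vsum_delta[of j]) (auto simp: mat_id_def)
  have "mat_vec A n T ?e k = T k j" if "k < n" for k
    unfolding mat_vec_def using T ij that by (subst vsum_delta[of j]) (auto simp: mat_id_def)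
  then have 2: "ip A n (mat_vec A n T ?e) (mat_vec A n T ?e) = vsum A (\<lambda>k. (T k j)\<^sup>\<star> \<otimes> T k j) n"
    unfolding ip_def by (intro vsum_cong) simp
  let ?s = "vsum A (\<lambda>k. (T k j)\<^sup>\<star> \<otimes> T k j) n" and ?t = "(T i j)\<^sup>\<star> \<otimes> T i j"
  have sq: "(T k j)\<^sup>\<star> \<otimes> T k j \<in> squares A" if "k < n" for k
    using T ij that by (intro star_mult_in_squares) simp
  have "complex_of_real (c\<^sup>2) \<odot> \<one> \<ominus> ?s \<in> squares A"
    using T(2) col unfolding mat_bound_def by (metis 1 2)
  then have "(complex_of_real (c\<^sup>2) \<odot> \<one> \<ominus> ?s) \<oplus> (?s \<ominus> ?t) \<in> squares A"
    using sq ij by (intro squares_add vsum_diff_term_in_squares)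
  moreover have "?s \<in> carrier A" "?t \<in> carrier A"
    using sq ij by auto
  ultimately have "complex_of_real (c\<^sup>2) \<odot> \<one> \<ominus> ?t \<in> squares A"
    by (simp only: diff_add_diff smult_cl one_closed)
  then have "nrm A ?t \<le> c\<^sup>2"
    using sq ij c by (intro norm_le) auto
  then have "(nrm A (T i j))\<^sup>2 \<le> c\<^sup>2"
    using T ij by (simp add: cstar_identity)
  then show ?thesis
    using c power2_le_imp_le[of "nrm A (T i j)" c] by simp
qed

text \<open>With a = T \<xi> and b = S \<xi>, positivity of the inner square of d a - c b estimates
  the mixed terms: c d (<a, b> + <b, a>) \<le> d^2 <a, a> + c^2 <b, b>. Hence c d <a + b, a + b>
  \<le> d (c + d) <a, a> + c (c + d) <b, b>, which the two hypotheses bound by c d (c + d)^2 <\<xi>,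
  \<xi>>; the factor c d > 0 is cancelled.\<close>

lemma mat_bound_add:
  assumes T: "entries_in A n T" "mat_bound A n T c" and S: "entries_in A n S" "mat_bound A n S d"
    and pos: "0 < c" "0 < d"
  shows "mat_bound A n (\<lambda>i j. T i j \<oplus> S i j) (c + d)"
  unfolding mat_bound_def
proof (intro allI impI)
  fix \<xi> assume \<xi>: "col A n \<xi>"
  define a b where "a = mat_vec A n T \<xi>" and "b = mat_vec A n S \<xi>"
  \<comment> \<open>The scalars c and d become the ring elements \<open>C\<close> and
    \<open>E\<close>, so that \<open>algebra\<close> can treat them like any other element.\<close>
  define N C E where "N = ip A n \<xi> \<xi>" and "C = complex_of_real c \<odot> \<one>" and "E = complex_of_real d \<odot> \<one>"
  have ab [simp]: "col A n a" "col A n b"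
    using T S \<xi> by (auto simp: a_def b_def)
  let ?w = "\<lambda>i. complex_of_real d \<odot> a i \<ominus> complex_of_real c \<odot> b i"
  have c: "N \<in> carrier A" "C \<in> carrier A" "E \<in> carrier A" "ip A n a a \<in> carrier A"
    "ip A n a b \<in> carrier A" "ip A n b a \<in> carrier A" "ip A n b b \<in> carrier A"
    using \<xi> by (simp_all add: N_def C_def E_def)
  have sC: "complex_of_real c \<odot> x = C \<otimes> x" and sE: "complex_of_real d \<odot> x = E \<otimes> x" if "x \<in> carrier A" for x
    using that by (simp_all add: C_def E_def smult_mult_left)
  have w: "ip A n ?w ?w = E \<otimes> (E \<otimes> ip A n a a \<ominus> C \<otimes> ip A n b a) \<ominus> C \<otimes> (E \<otimes> ip A n a b \<ominus> C \<otimes> ip A n b b)"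
    using c by (simp add: ip_diff_left ip_diff_right ip_smult_left ip_smult_right sC sE)
      (use c in algebra)
  have X: "C \<otimes> (C \<otimes> N) \<ominus> ip A n a a \<in> squares A"
    using T(2) \<xi> c by (simp add: mat_bound_def a_def N_def power2_eq_square flip: smult_smult sC)
  have Y: "E \<otimes> (E \<otimes> N) \<ominus> ip A n b b \<in> squares A"
    using S(2) \<xi> c by (simp add: mat_bound_def b_def N_def power2_eq_square flip: smult_smult sE)
  have CS: "C \<in> squares A" "E \<in> squares A"
    using pos unfolding C_def E_def by (auto intro!: squares_smult)
  \<comment> \<open>These weights make the three summands combine to a multiple of c d; the
    coefficients are those of the estimate for <a + b, a + b>.\<close>
  have "E \<otimes> (C \<oplus> E) \<otimes> (C \<otimes> (C \<otimes> N) \<ominus> ip A n a a) \<oplus> C \<otimes> (C \<oplus> E) \<otimes> (E \<otimes> (E \<otimes> N) \<ominus> ip A n b b) \<oplus> ip A n ?w ?w \<in> squares A"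
    by (intro squares_add squares_mult X Y CS ip_self_in_squares) simp
  moreover have "E \<otimes> (C \<oplus> E) \<otimes> (C \<otimes> (C \<otimes> N) \<ominus> ip A n a a) \<oplus> C \<otimes> (C \<oplus> E) \<otimes> (E \<otimes> (E \<otimes> N) \<ominus> ip A n b b) \<oplus> ip A n ?w ?w
      = C \<otimes> (E \<otimes> ((C \<oplus> E) \<otimes> ((C \<oplus> E) \<otimes> N) \<ominus> (ip A n a a \<oplus> ip A n b a \<oplus> (ip A n a b \<oplus> ip A n b b))))"
  proof -
    have 1: "E \<otimes> S \<otimes> (C \<otimes> (C \<otimes> N)) \<oplus> C \<otimes> S \<otimes> (E \<otimes> (E \<otimes> N)) = C \<otimes> (E \<otimes> (S \<otimes> ((C \<oplus> E) \<otimes> N)))"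
      if "S \<in> carrier A" for S
      using that c(1-3) by algebra
    have 2: "E \<otimes> (C \<oplus> E) \<otimes> (x \<ominus> y) = E \<otimes> (C \<oplus> E) \<otimes> x \<ominus> (C \<otimes> (E \<otimes> y) \<oplus> E \<otimes> (E \<otimes> y))"
      and 3: "C \<otimes> (C \<oplus> E) \<otimes> (x \<ominus> y) = C \<otimes> (C \<oplus> E) \<otimes> x \<ominus> (C \<otimes> (E \<otimes> y) \<oplus> C \<otimes> (C \<otimes> y))"
      and 4: "x \<otimes> (y \<otimes> p \<ominus> z \<otimes> q) = x \<otimes> (y \<otimes> p) \<ominus> x \<otimes> (z \<otimes> q)"
      if "x \<in> carrier A" "y \<in> carrier A" "z \<in> carrier A" "p \<in> carrier A" "q \<in> carrier A" for x y z p q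
      using that c(2,3) by algebra+
    have 5: "(p \<ominus> (f1 \<oplus> a2)) \<oplus> (q \<ominus> (f2 \<oplus> b2)) \<oplus> (a2 \<ominus> m1 \<ominus> (m2 \<ominus> b2)) = (p \<oplus> q) \<ominus> (f1 \<oplus> m1 \<oplus> (m2 \<oplus> f2))"
      if "p \<in> carrier A" "q \<in> carrier A" "f1 \<in> carrier A" "f2 \<in> carrier A" "a2 \<in> carrier A"
        "b2 \<in> carrier A" "m1 \<in> carrier A" "m2 \<in> carrier A" for p q f1 f2 a2 b2 m1 m2
      using that by algebra
    have 6: "C \<otimes> (E \<otimes> x) = E \<otimes> (C \<otimes> x)" if "x \<in> carrier A" for x
      using that c(2,3) by (simp add: m_lcomm)
    show ?thesis
      unfolding w using c 1[of "C \<oplus> E"]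
      by (simp add: 2 3 4 5) (simp add: minus_eq r_distr r_minus minus_add 6)
  qed
  moreover have "(C \<oplus> E) \<otimes> ((C \<oplus> E) \<otimes> N) = complex_of_real ((c + d)\<^sup>2) \<odot> N"
    using c by (simp add: power2_eq_square C_def E_def smult_mult_left flip: smult_add_left)
  moreover have "ip A n a a \<oplus> ip A n b a \<oplus> (ip A n a b \<oplus> ip A n b b) = ip A n (\<lambda>i. a i \<oplus> b i) (\<lambda>i. a i \<oplus> b i)"
    by (simp add: ip_add_left ip_add_right a_ac)
  moreover have "\<dots> = ip A n (mat_vec A n (\<lambda>i j. T i j \<oplus> S i j) \<xi>) (mat_vec A n (\<lambda>i j. T i j \<oplus> S i j) \<xi>)"
    using T S \<xi> by (intro ip_cong) (simp_all add: mat_vec_add a_def b_def)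
  ultimately have *: "C \<otimes> (E \<otimes> (complex_of_real ((c + d)\<^sup>2) \<odot> N \<ominus>
      ip A n (mat_vec A n (\<lambda>i j. T i j \<oplus> S i j) \<xi>) (mat_vec A n (\<lambda>i j. T i j \<oplus> S i j) \<xi>))) \<in> squares A"
    (is "C \<otimes> (E \<otimes> ?G) \<in> _")
    by simp
  have "entries_in A n (\<lambda>i j. T i j \<oplus> S i j)"
    using T S by (simp add: entries_in_def)
  then have G: "?G \<in> carrier A"
    using \<xi> c by simp
  then have "complex_of_real c \<odot> (complex_of_real d \<odot> ?G) \<in> squares A"
    using * by (simp only: sC sE smult_cl m_closed c)
  then show "complex_of_real ((c + d)\<^sup>2) \<odot> ip A n \<xi> \<xi> \<ominus>
      ip A n (mat_vec A n (\<lambda>i j. T i j \<oplus> S i j) \<xi>) (mat_vec A n (\<lambda>i j. T i j \<oplus> S i j) \<xi>) \<in> squares A"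
    using pos G unfolding N_def by (blast intro: squares_smult_iff smult_cl)
qed

lemma mat_bound_mult:
  assumes T: "entries_in A n T" "mat_bound A n T c" and S: "entries_in A n S" "mat_bound A n S d"
  shows "mat_bound A n (mat_mult A n T S) (c * d)"
  unfolding mat_bound_def
proof (intro allI impI)
  fix \<xi> assume \<xi>: "col A n \<xi>"
  let ?b = "mat_vec A n S \<xi>"
  let ?a = "mat_vec A n T ?b"
  have col: "col A n ?b" "col A n ?a"
    using T S \<xi> by auto
  have "complex_of_real (c\<^sup>2) \<odot> (complex_of_real (d\<^sup>2) \<odot> ip A n \<xi> \<xi> \<ominus> ip A n ?b ?b) \<oplus>
      (complex_of_real (c\<^sup>2) \<odot> ip A n ?b ?b \<ominus> ip A n ?a ?a) \<in> squares A"
    using T(2) S(2) \<xi> col unfolding mat_bound_def by (intro squares_add squares_smult) auto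
  moreover have "complex_of_real (c\<^sup>2) \<odot> (complex_of_real (d\<^sup>2) \<odot> ip A n \<xi> \<xi> \<ominus> ip A n ?b ?b) =
      complex_of_real ((c * d)\<^sup>2) \<odot> ip A n \<xi> \<xi> \<ominus> complex_of_real (c\<^sup>2) \<odot> ip A n ?b ?b"
    using \<xi> col by (simp add: smult_diff_right power_mult_distrib)
  moreover have "ip A n ?a ?a = ip A n (mat_vec A n (mat_mult A n T S) \<xi>) (mat_vec A n (mat_mult A n T S) \<xi>)"
    using T S \<xi> by (intro ip_cong) (simp_all add: mat_vec_mult)
  ultimately show "complex_of_real ((c * d)\<^sup>2) \<odot> ip A n \<xi> \<xi> \<ominus>
      ip A n (mat_vec A n (mat_mult A n T S) \<xi>) (mat_vec A n (mat_mult A n T S) \<xi>) \<in> squares A"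
    using \<xi> col by (metis diff_add_diff ip_closed smult_cl)
qed

lemma mat_bound_half:
  assumes T: "entries_in A n T" "mat_bound A n T c"
  shows "mat_bound A n (\<lambda>i j. (1/2) \<odot> T i j) (c / 2)"
  unfolding mat_bound_def
proof (intro allI impI)
  fix \<xi> assume \<xi>: "col A n \<xi>"
  let ?a = "mat_vec A n T \<xi>"
  have col: "col A n ?a"
    using T \<xi> by auto
  have "complex_of_real (1/4) \<odot> (complex_of_real (c\<^sup>2) \<odot> ip A n \<xi> \<xi> \<ominus> ip A n ?a ?a) \<in> squares A"
    using T(2) \<xi> unfolding mat_bound_def by (intro squares_smult) auto
  moreover have "complex_of_real (1/4) \<odot> (complex_of_real (c\<^sup>2) \<odot> ip A n \<xi> \<xi> \<ominus> ip A n ?a ?a) =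
      complex_of_real ((c / 2)\<^sup>2) \<odot> ip A n \<xi> \<xi> \<ominus> ip A n (\<lambda>i. (1/2) \<odot> ?a i) (\<lambda>i. (1/2) \<odot> ?a i)"
    using \<xi> col by (simp add: smult_diff_right power_divide ip_smult_left ip_smult_right)
  moreover have "ip A n (\<lambda>i. (1/2) \<odot> ?a i) (\<lambda>i. (1/2) \<odot> ?a i) =
      ip A n (mat_vec A n (\<lambda>i j. (1/2) \<odot> T i j) \<xi>) (mat_vec A n (\<lambda>i j. (1/2) \<odot> T i j) \<xi>)"
    using T \<xi> by (intro ip_cong) (simp_all add: mat_vec_smult)
  ultimately show "complex_of_real ((c / 2)\<^sup>2) \<odot> ip A n \<xi> \<xi> \<ominus>
      ip A n (mat_vec A n (\<lambda>i j. (1/2) \<odot> T i j) \<xi>) (mat_vec A n (\<lambda>i j. (1/2) \<odot> T i j) \<xi>) \<in> squares A"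
    by simp
qed

text \<open>For \<open>0 \<le> X \<le> 1\<close> we have \<open>X - X\<^sup>2 = (1 - X) X (1 - X) + X (1 - X) X \<ge> 0\<close>.\<close>

lemma mat_bound_one:
  assumes X: "entries_in A n X" "\<And>i j. i < n \<Longrightarrow> j < n \<Longrightarrow> (X j i)\<^sup>\<star> = X i j"
    and lower: "\<And>\<xi>. col A n \<xi> \<Longrightarrow> ip A n \<xi> (mat_vec A n X \<xi>) \<in> squares A"
    and upper: "\<And>\<xi>. col A n \<xi> \<Longrightarrow> ip A n \<xi> \<xi> \<ominus> ip A n \<xi> (mat_vec A n X \<xi>) \<in> squares A"
  shows "mat_bound A n X 1"
  unfolding mat_bound_def
proof (intro allI impI)
  fix \<xi> assume \<xi>: "col A n \<xi>"
  define \<zeta> where "\<zeta> = mat_vec A n X \<xi>"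
  define \<eta> where "\<eta> = (\<lambda>i. \<xi> i \<ominus> \<zeta> i)"
  have col [simp]: "col A n \<xi>" "col A n \<zeta>" "col A n \<eta>" "col A n (mat_vec A n X \<zeta>)"
    using X \<xi> by (auto simp: \<zeta>_def \<eta>_def)
  have "mat_vec A n (mat_adj A X) \<zeta> i = mat_vec A n X \<zeta> i" if "i < n" for i
    using X that by (intro mat_vec_cong) (simp add: mat_adj_def)
  then have adj: "ip A n \<xi> (mat_vec A n X \<zeta>) = ip A n \<zeta> \<zeta>"
    using X \<xi> ip_mat_vec_left[of n X \<xi> \<zeta>] ip_cong[of n \<xi> \<xi> "mat_vec A n (mat_adj A X) \<zeta>" "mat_vec A n X \<zeta>" A]
    by (simp add: \<zeta>_def[symmetric])
  have "ip A n \<eta> (mat_vec A n X \<eta>) = ip A n \<eta> (\<lambda>i. \<zeta> i \<ominus> mat_vec A n X \<zeta> i)"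
    using X by (intro ip_cong) (simp_all add: \<eta>_def mat_vec_diff_vec \<zeta>_def[symmetric])
  also have "\<dots> = (ip A n \<xi> \<zeta> \<ominus> ip A n \<zeta> \<zeta>) \<ominus> (ip A n \<zeta> \<zeta> \<ominus> ip A n \<zeta> (mat_vec A n X \<zeta>))"
  proof -
    have "ip A n \<eta> \<zeta> = ip A n \<xi> \<zeta> \<ominus> ip A n \<zeta> \<zeta>"
      unfolding \<eta>_def by (simp add: ip_diff_left)
    moreover have "ip A n \<eta> (mat_vec A n X \<zeta>) = ip A n \<zeta> \<zeta> \<ominus> ip A n \<zeta> (mat_vec A n X \<zeta>)"
      unfolding adj[symmetric] \<eta>_def by (simp add: ip_diff_left)
    ultimately show ?thesis
      by (simp add: ip_diff_right)
  qed
  finally have \<eta>: "ip A n \<eta> (mat_vec A n X \<eta>) = (ip A n \<xi> \<zeta> \<ominus> ip A n \<zeta> \<zeta>) \<ominus> (ip A n \<zeta> \<zeta> \<ominus> ip A n \<zeta> (mat_vec A n X \<zeta>))" .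
  \<comment> \<open>This is 1 - X^2 = (1 - X) + (1 - X) X (1 - X) + X (1 - X) X, evaluated on
    \<xi>.\<close>
  have "(ip A n \<xi> \<xi> \<ominus> ip A n \<xi> \<zeta>) \<oplus> (ip A n \<eta> (mat_vec A n X \<eta>) \<oplus> (ip A n \<zeta> \<zeta> \<ominus> ip A n \<zeta> (mat_vec A n X \<zeta>))) \<in> squares A"
    using upper[of \<xi>] lower[of \<eta>] upper[of \<zeta>] by (intro squares_add) (auto simp: \<zeta>_def[symmetric])
  moreover have "(ip A n \<xi> \<xi> \<ominus> ip A n \<xi> \<zeta>) \<oplus> (ip A n \<eta> (mat_vec A n X \<eta>) \<oplus> (ip A n \<zeta> \<zeta> \<ominus> ip A n \<zeta> (mat_vec A n X \<zeta>)))
      = ip A n \<xi> \<xi> \<ominus> ip A n \<zeta> \<zeta>"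
  proof -
    have "ip A n \<xi> \<xi> \<in> carrier A" "ip A n \<xi> \<zeta> \<in> carrier A" "ip A n \<zeta> \<zeta> \<in> carrier A" "ip A n \<zeta> (mat_vec A n X \<zeta>) \<in> carrier A"
      by simp_all
    then show ?thesis
      unfolding \<eta> by algebra
  qed
  ultimately show "complex_of_real (1\<^sup>2) \<odot> ip A n \<xi> \<xi> \<ominus> ip A n (mat_vec A n X \<xi>) (mat_vec A n X \<xi>) \<in> squares A"
    by (simp add: \<zeta>_def)
qed

text \<open>For a contraction m = \<open>M i j\<close>, the modulus square of \<xi> i - m \<xi> j
  and the positive element \<open>(\<xi> j)\<^sup>\<star> (\<xi> j) (1 - m\<^sup>\<star> m)\<close>
  together give f i j + f j i \<le> a i + a j. Summed over all pairs, the left side is twice the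
  form and the right side 2n times the inner product.\<close>

lemma form_upper_bound:
  assumes M: "entries_in A n M" "\<And>i j. i < n \<Longrightarrow> j < n \<Longrightarrow> (M j i)\<^sup>\<star> = M i j"
    and M1: "\<And>i j. i < n \<Longrightarrow> j < n \<Longrightarrow> nrm A (M i j) \<le> 1" and \<xi>: "col A n \<xi>"
  shows "of_nat n \<odot> ip A n \<xi> \<xi> \<ominus> ip A n \<xi> (mat_vec A n M \<xi>) \<in> squares A"
proof -
  define a where "a i = (\<xi> i)\<^sup>\<star> \<otimes> \<xi> i" for i
  define f where "f i j = (\<xi> i)\<^sup>\<star> \<otimes> (M i j \<otimes> \<xi> j)" for i j
  have Mc [simp]: "M i j \<in> carrier A" if "i < n" "j < n" for i j
    using M that by simp
  have xc [simp]: "\<xi> i \<in> carrier A" if "i < n" for i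
    using \<xi> that by simp
  have ac [simp]: "a i \<in> carrier A" if "i < n" for i
    using that by (simp add: a_def)
  have fc [simp]: "f i j \<in> carrier A" if "i < n" "j < n" for i j
    using that by (simp add: f_def)
  let ?N = "ip A n \<xi> \<xi>" and ?F = "ip A n \<xi> (mat_vec A n M \<xi>)"
  have N: "vsum A a n = ?N"
    unfolding ip_def a_def ..
  have F: "vsum A (\<lambda>i. vsum A (f i) n) n = ?F"
    unfolding ip_def mat_vec_def f_def
    by (intro vsum_cong, subst vsum_mult_left) auto
  have D: "(a i \<oplus> a j) \<ominus> (f i j \<oplus> f j i) \<in> squares A" if ij: "i < n" "j < n" for i j
  proof -
    let ?m = "M i j"
    have "nrm A (?m\<^sup>\<star> \<otimes> ?m) \<le> 1"
      using M1[OF ij] nrm_nonneg[of ?m] ij by (simp add: cstar_identity power_le_one)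
    then have "\<one> \<ominus> ?m\<^sup>\<star> \<otimes> ?m \<in> squares A"
      using ij by (intro one_minus_in_squares selfadjoint_star_mult) auto
    then have "(\<xi> i \<ominus> ?m \<otimes> \<xi> j)\<^sup>\<star> \<otimes> (\<xi> i \<ominus> ?m \<otimes> \<xi> j) \<oplus> (\<xi> j)\<^sup>\<star> \<otimes> \<xi> j \<otimes> (\<one> \<ominus> ?m\<^sup>\<star> \<otimes> ?m) \<in> squares A"
      using ij by (intro squares_add squares_mult star_mult_in_squares) auto
    moreover have "(\<xi> i \<ominus> ?m \<otimes> \<xi> j)\<^sup>\<star> = (\<xi> i)\<^sup>\<star> \<ominus> (\<xi> j)\<^sup>\<star> \<otimes> ?m\<^sup>\<star>"
      using ij by (simp add: star_diff star_mult)
    moreover have "((\<xi> i)\<^sup>\<star> \<ominus> (\<xi> j)\<^sup>\<star> \<otimes> ?m\<^sup>\<star>) \<otimes> (\<xi> i \<ominus> ?m \<otimes> \<xi> j) \<oplus> (\<xi> j)\<^sup>\<star> \<otimes> \<xi> j \<otimes> (\<one> \<ominus> ?m\<^sup>\<star> \<otimes> ?m)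
        = (a i \<oplus> a j) \<ominus> (f i j \<oplus> (\<xi> j)\<^sup>\<star> \<otimes> (?m\<^sup>\<star> \<otimes> \<xi> i))"
    proof -
      have "\<xi> i \<in> carrier A" "(\<xi> i)\<^sup>\<star> \<in> carrier A" "\<xi> j \<in> carrier A" "(\<xi> j)\<^sup>\<star> \<in> carrier A" "?m \<in> carrier A" "?m\<^sup>\<star> \<in> carrier A"
        using ij by simp_all
      then show ?thesis
        unfolding a_def f_def by algebra
    qed
    moreover have "(\<xi> j)\<^sup>\<star> \<otimes> (?m\<^sup>\<star> \<otimes> \<xi> i) = f j i"
      using M(2)[of j i] ij by (simp add: f_def)
    ultimately show ?thesis
      by simp
  qed
  have "vsum A (\<lambda>i. vsum A (\<lambda>j. (a i \<oplus> a j) \<ominus> (f i j \<oplus> f j i)) n) n \<in> squares A"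
    by (intro squares_vsum D)
  also have "vsum A (\<lambda>i. vsum A (\<lambda>j. (a i \<oplus> a j) \<ominus> (f i j \<oplus> f j i)) n) n =
      vsum A (\<lambda>i. (of_nat n \<odot> a i \<oplus> ?N) \<ominus> (vsum A (f i) n \<oplus> vsum A (\<lambda>j. f j i) n)) n"
    by (intro vsum_cong) (simp add: vsum_diff vsum_add vsum_const N)
  also have "\<dots> = (of_nat n \<odot> ?N \<oplus> of_nat n \<odot> ?N) \<ominus> (?F \<oplus> ?F)"
    using \<xi> vsum_swap[of n n f] by (simp add: vsum_diff vsum_add vsum_const vsum_smult N F)
  also have "\<dots> = (of_nat n \<odot> ?N \<ominus> ?F) \<oplus> (of_nat n \<odot> ?N \<ominus> ?F)"
  proof -
    have "of_nat n \<odot> ?N \<in> carrier A" "?F \<in> carrier A"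
      using \<xi> M by simp_all
    then show ?thesis by algebra
  qed
  also have "\<dots> = complex_of_real 2 \<odot> (of_nat n \<odot> ?N \<ominus> ?F)"
    using \<xi> M smult_add_left[of "of_nat n \<odot> ?N \<ominus> ?F" 1 1] by simp
  finally show ?thesis
    using \<xi> M by (rule_tac squares_smult_iff[of _ 2]) auto
qed

text \<open>The matrix X = 1 - M/n lies between 0 and 1, by \<open>form_upper_bound\<close> and by
  the hypothesis on the form, so the iteration for t = X converges. Its limit Y satisfies (1 - Y)^2
  = M/n, and sqrt n times the hermitian matrix 1 - Y is the required Gram root.\<close>

lemma gram_decomposition_contraction:
  assumes M: "entries_in A n M" "\<And>i j. i < n \<Longrightarrow> j < n \<Longrightarrow> (M j i)\<^sup>\<star> = M i j"
    and M1: "\<And>i j. i < n \<Longrightarrow> j < n \<Longrightarrow> nrm A (M i j) \<le> 1" and pos: "form_nonneg A n M"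
  shows "\<exists>Z. entries_in A n Z \<and> (\<forall>i<n. \<forall>j<n. M i j = mat_mult A n (mat_adj A Z) Z i j)"
proof (cases "n = 0")
  case False
  then have n: "0 < real n"
    by simp
  let ?c = "complex_of_real (1 / real n)"
  define X where "X = (\<lambda>i j. mat_id A i j \<ominus> ?c \<odot> M i j)"
  have idc [simp]: "mat_id A i j \<in> carrier A" for i j
    by (simp add: mat_id_def)
  have X: "entries_in A n X"
    using M by (simp add: entries_in_def X_def)
  have Xh: "(X j i)\<^sup>\<star> = X i j" if "i < n" "j < n" for i j
    using M that by (simp add: X_def star_simps) (simp add: mat_id_def)
  have Mc: "entries_in A n (\<lambda>i j. ?c \<odot> M i j)"
    using M by (simp add: entries_in_def)
  have ipX: "ip A n \<xi> (mat_vec A n X \<xi>) = ip A n \<xi> \<xi> \<ominus> ?c \<odot> ip A n \<xi> (mat_vec A n M \<xi>)" if \<xi>: "col A n \<xi>" for \<xi>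
  proof -
    have "ip A n \<xi> (mat_vec A n X \<xi>) = ip A n \<xi> (\<lambda>i. \<xi> i \<ominus> ?c \<odot> mat_vec A n M \<xi> i)"
      unfolding X_def using M Mc \<xi> by (intro ip_cong) (simp_all only: mat_vec_id_diff mat_vec_smult)
    then show ?thesis
      using M \<xi> by (simp only: ip_diff_right ip_smult_right mat_vec_col col_smult)
  qed
  have "mat_bound A n X 1"
  proof (rule mat_bound_one[OF X Xh])
    fix \<xi> assume \<xi>: "col A n \<xi>"
    have c: "ip A n \<xi> \<xi> \<in> carrier A" "ip A n \<xi> (mat_vec A n M \<xi>) \<in> carrier A"
      using M \<xi> by simp_all
    have "?c \<odot> (of_nat n \<odot> ip A n \<xi> \<xi> \<ominus> ip A n \<xi> (mat_vec A n M \<xi>)) \<in> squares A"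
      using form_upper_bound[OF M M1 \<xi>] n by (intro squares_smult) auto
    also have "?c \<odot> (of_nat n \<odot> ip A n \<xi> \<xi> \<ominus> ip A n \<xi> (mat_vec A n M \<xi>)) = ip A n \<xi> (mat_vec A n X \<xi>)"
      using c n by (simp add: ipX[OF \<xi>] smult_diff_right)
    finally show "ip A n \<xi> (mat_vec A n X \<xi>) \<in> squares A" .
    have "?c \<odot> ip A n \<xi> (mat_vec A n M \<xi>) \<in> squares A"
      using pos \<xi> n unfolding form_nonneg_def by (intro squares_smult) auto
    also have "?c \<odot> ip A n \<xi> (mat_vec A n M \<xi>) = ip A n \<xi> \<xi> \<ominus> ip A n \<xi> (mat_vec A n X \<xi>)"
    proof -
      have "?c \<odot> ip A n \<xi> (mat_vec A n M \<xi>) \<in> carrier A"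
        using c by simp
      then show ?thesis
        unfolding ipX[OF \<xi>] using c(1) by algebra
    qed
    finally show "ip A n \<xi> \<xi> \<ominus> ip A n \<xi> (mat_vec A n X \<xi>) \<in> squares A" .
  qed
  have "\<exists>Y. \<forall>i<n. \<forall>j<n. converges A (\<lambda>k. root_iter A n X k i j) (Y i j)"
  proof (rule conjunct2[OF root_iter_converges[where bd = "mat_bound A n"]])
    show "mat_bound A n X 1" by fact
    show "mat_bound A n S c" if "\<And>i j. i < n \<Longrightarrow> j < n \<Longrightarrow> T i j = S i j" "mat_bound A n T c" for T S c
      using that by (rule mat_bound_cong)
    show "mat_bound A n (\<lambda>i j. (1/2) \<odot> T i j) (c / 2)" if "entries_in A n T" "mat_bound A n T c" "0 < c" for T c
      using that by (intro mat_bound_half)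
  qed (intro X mat_bound_entry mat_bound_add mat_bound_mult; assumption)+
  then obtain Y where Y: "\<And>i j. i < n \<Longrightarrow> j < n \<Longrightarrow> converges A (\<lambda>k. root_iter A n X k i j) (Y i j)"
    by blast
  have it: "root_iter A n X k i j \<in> carrier A" if "i < n" "j < n" for i j k
    using converges_closed(1)[OF Y[OF that]] .
  have Yc [simp]: "Y i j \<in> carrier A" if "i < n" "j < n" for i j
    using converges_closed(2)[OF Y[OF that]] .
  have ith: "(root_iter A n X k j i)\<^sup>\<star> = root_iter A n X k i j" if "i < n" "j < n" for i j k
    using that
  proof (induction k arbitrary: i j)
    case 0
    then show ?case
      using X Xh by (simp add: star_smult)
  next
    case (Suc k)
    have "(mat_mult A n (root_iter A n X k) (root_iter A n X k) j i)\<^sup>\<star> =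
        mat_mult A n (root_iter A n X k) (root_iter A n X k) i j"
      unfolding mat_mult_def using Suc it
      by (subst vsum_star) (auto simp: star_mult intro!: vsum_cong)
    moreover have "mat_mult A n (root_iter A n X k) (root_iter A n X k) j i \<in> carrier A"
      unfolding mat_mult_def using Suc it by auto
    ultimately show ?case
      using Suc X Xh by (simp add: star_smult star_add)
  qed
  have Yh: "(Y j i)\<^sup>\<star> = Y i j" if "i < n" "j < n" for i j
    using converges_unique[OF converges_star[OF Y[OF that(2,1)]]] Y[OF that] ith[OF that] by simp
  define Z where "Z = (\<lambda>i j. mat_id A i j \<ominus> Y i j)"
  define W where "W = (\<lambda>i j. complex_of_real (sqrt (real n)) \<odot> Z i j)"
  have Z: "Z i j \<in> carrier A" if "i < n" "j < n" for i j
    using that by (simp add: Z_def)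
  have Zh: "(Z j i)\<^sup>\<star> = Z i j" if "i < n" "j < n" for i j
    using that Yh by (simp add: Z_def star_diff) (simp add: mat_id_def)
  have "mat_mult A n (mat_adj A W) W i j = M i j" if ij: "i < n" "j < n" for i j
  proof -
    have "mat_mult A n (mat_adj A W) W i j = vsum A (\<lambda>k. complex_of_real (real n) \<odot> (Z i k \<otimes> Z k j)) n"
      unfolding mat_mult_def mat_adj_def W_def using ij Z Zh
      by (intro vsum_cong) (simp add: star_smult smult_mult_left smult_mult_right flip: of_real_mult)
    also have "\<dots> = complex_of_real (real n) \<odot> mat_mult A n Z Z i j"
      unfolding mat_mult_def using ij Z by (intro vsum_smult) simp
    also have "mat_mult A n Z Z i j = ?c \<odot> M i j"
    proof -
      have "mat_id A i j \<in> carrier A" "?c \<odot> M i j \<in> carrier A"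
        using M ij by simp_all
      then have "mat_id A i j \<ominus> X i j = ?c \<odot> M i j"
        unfolding X_def by algebra
      then show ?thesis
        using root_iter_limit[OF X Y ij] by (simp add: Z_def)
    qed
    finally show ?thesis
      using n M ij by simp
  qed
  moreover have "entries_in A n W"
    using Z by (simp add: entries_in_def W_def)
  ultimately show ?thesis
    by metis
qed (auto simp: entries_in_def)

theorem gram_decomposition:
  assumes M: "entries_in A n M" "\<And>i j. i < n \<Longrightarrow> j < n \<Longrightarrow> (M j i)\<^sup>\<star> = M i j"
    and pos: "form_nonneg A n M"
  shows "\<exists>Z. entries_in A n Z \<and> (\<forall>i<n. \<forall>j<n. M i j = mat_mult A n (mat_adj A Z) Z i j)"
proof -
  \<comment> \<open>An upper bound for the norms of all entries; the summand 1 keeps it positive for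
    the division below.\<close>
  define \<mu> where "\<mu> = 1 + (\<Sum>i<n. \<Sum>j<n. nrm A (M i j))"
  have nn: "0 \<le> nrm A (M i j)" if "i < n" "j < n" for i j
    using M that by (simp add: nrm_nonneg)
  have le: "nrm A (M i j) \<le> \<mu>" if ij: "i < n" "j < n" for i j
  proof -
    have "nrm A (M i j) \<le> (\<Sum>j<n. nrm A (M i j))"
      using ij nn by (intro member_le_sum) auto
    also have "\<dots> \<le> (\<Sum>i<n. \<Sum>j<n. nrm A (M i j))"
      using ij nn by (intro member_le_sum[of i _ "\<lambda>i. \<Sum>j<n. nrm A (M i j)"] sum_nonneg) auto
    finally show ?thesis
      by (simp add: \<mu>_def)
  qed
  have "0 \<le> (\<Sum>i<n. \<Sum>j<n. nrm A (M i j))"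
    using nn by (intro sum_nonneg) auto
  then have \<mu>: "0 < \<mu>"
    by (simp add: \<mu>_def)
  let ?M = "\<lambda>i j. complex_of_real (1/\<mu>) \<odot> M i j"
  have "\<exists>Z. entries_in A n Z \<and> (\<forall>i<n. \<forall>j<n. ?M i j = mat_mult A n (mat_adj A Z) Z i j)"
  proof (rule gram_decomposition_contraction)
    show "entries_in A n ?M"
      using M by (simp add: entries_in_def)
    show "(?M j i)\<^sup>\<star> = ?M i j" if "i < n" "j < n" for i j
      using M that by (simp add: star_smult)
    show "nrm A (?M i j) \<le> 1" if "i < n" "j < n" for i j
      using M le[OF that] \<mu> that by (simp add: nrm_smult norm_divide)
    show "form_nonneg A n ?M"
      unfolding form_nonneg_def
    proof (intro allI impI)
      fix \<xi> assume \<xi>: "col A n \<xi>"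
      have "ip A n \<xi> (mat_vec A n ?M \<xi>) = ip A n \<xi> (\<lambda>i. complex_of_real (1/\<mu>) \<odot> mat_vec A n M \<xi> i)"
        using M \<xi> by (intro ip_cong) (simp_all only: mat_vec_smult)
      also have "\<dots> = complex_of_real (1/\<mu>) \<odot> ip A n \<xi> (mat_vec A n M \<xi>)"
        using M \<xi> by (simp only: ip_smult_right mat_vec_col)
      also have "\<dots> \<in> squares A"
        using pos \<xi> \<mu> unfolding form_nonneg_def by (intro squares_smult) auto
      finally show "ip A n \<xi> (mat_vec A n ?M \<xi>) \<in> squares A" .
    qed
  qed
  then obtain Z where Z: "entries_in A n Z" "\<And>i j. i < n \<Longrightarrow> j < n \<Longrightarrow> ?M i j = mat_mult A n (mat_adj A Z) Z i j"
    by blast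
  let ?W = "\<lambda>i j. complex_of_real (sqrt \<mu>) \<odot> Z i j"
  have "mat_mult A n (mat_adj A ?W) ?W i j = M i j" if ij: "i < n" "j < n" for i j
  proof -
    have "mat_mult A n (mat_adj A ?W) ?W i j = vsum A (\<lambda>k. complex_of_real \<mu> \<odot> (mat_adj A Z i k \<otimes> Z k j)) n"
      unfolding mat_mult_def mat_adj_def using ij Z(1) \<mu>
      by (intro vsum_cong) (simp add: star_smult smult_mult_left smult_mult_right flip: of_real_mult)
    also have "\<dots> = complex_of_real \<mu> \<odot> ?M i j"
      unfolding Z(2)[OF ij] mat_mult_def using ij Z(1) by (intro vsum_smult) (simp add: mat_adj_def)
    finally show ?thesis
      using \<mu> M ij by simp
  qed
  moreover have "entries_in A n ?W"
    using Z by (simp add: entries_in_def)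
  ultimately show ?thesis
    by metis
qed

end

section \<open>Unital completely positive maps\<close>

locale ucp_map = B: cstar_algebra B + A: comm_cstar_algebra A
  for B :: "('b, 'n) cstar_scheme" and A :: "('a, 'm) cstar_scheme" +
  fixes \<psi> :: "'b \<Rightarrow> 'a"
  assumes ucp: "ucp B (carrier B) A \<psi>"
begin

lemma map_closed [simp]: "x \<in> carrier B \<Longrightarrow> \<psi> x \<in> carrier A"
  and map_add: "x \<in> carrier B \<Longrightarrow> y \<in> carrier B \<Longrightarrow> \<psi> (x \<oplus>\<^bsub>B\<^esub> y) = \<psi> x \<oplus>\<^bsub>A\<^esub> \<psi> y"
  and map_smult: "x \<in> carrier B \<Longrightarrow> \<psi> (c \<odot>\<^bsub>B\<^esub> x) = c \<odot>\<^bsub>A\<^esub> \<psi> x"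
  and map_one [simp]: "\<psi> \<one>\<^bsub>B\<^esub> = \<one>\<^bsub>A\<^esub>"
  and map_positive: "M \<in> positive_elements (matrix_algebra n B) \<Longrightarrow> (\<forall>i<n. \<forall>j<n. M i j \<in> carrier B) \<Longrightarrow>
    amplify \<psi> M \<in> positive_elements (matrix_algebra n A)"
  using ucp by (auto simp: ucp_def)

lemma map_zero [simp]: "\<psi> \<zero>\<^bsub>B\<^esub> = \<zero>\<^bsub>A\<^esub>"
  using map_smult[of "\<zero>\<^bsub>B\<^esub>" 0] by simp

lemma map_minus: "x \<in> carrier B \<Longrightarrow> \<psi> (\<ominus>\<^bsub>B\<^esub> x) = \<ominus>\<^bsub>A\<^esub> \<psi> x"
  by (simp add: B.minus_as_smult A.minus_as_smult map_smult)

lemma map_diff: "x \<in> carrier B \<Longrightarrow> y \<in> carrier B \<Longrightarrow> \<psi> (x \<ominus>\<^bsub>B\<^esub> y) = \<psi> x \<ominus>\<^bsub>A\<^esub> \<psi> y"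
  by (simp add: B.minus_eq A.minus_eq map_add map_minus)

text \<open>The source of everything drawn from complete positivity here: the matrix of the products
  of \<open>w i\<close> starred with \<open>w j\<close> is a Gram matrix, with root the row w padded
  by zero rows. It is applied to families of one, two and three elements.\<close>

lemma map_gram:
  assumes w: "\<And>i. i < n \<Longrightarrow> w i \<in> carrier B"
  shows "\<exists>Z. entries_in A n Z \<and>
    (\<forall>i<n. \<forall>j<n. \<psi> ((w i)\<^sup>\<star>\<^bsub>B\<^esub> \<otimes>\<^bsub>B\<^esub> w j) = mat_mult A n (mat_adj A Z) Z i j)"
proof -
  define M where "M i j = (if i < n \<and> j < n then (w i)\<^sup>\<star>\<^bsub>B\<^esub> \<otimes>\<^bsub>B\<^esub> w j else \<zero>\<^bsub>B\<^esub>)" for i j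
  define Y where "Y k i = (if k = (0::nat) then w i else \<zero>\<^bsub>B\<^esub>)" for k i
  have "M i j = mat_mult B n (mat_adj B Y) Y i j" if "i < n" "j < n" for i j
    unfolding mat_mult_def mat_adj_def using that w
    by (subst B.vsum_delta[of 0]) (auto simp: Y_def M_def)
  moreover have "entries_in B n Y"
    using w by (auto simp: entries_in_def Y_def)
  ultimately have "M \<in> positive_elements (matrix_algebra n B)"
    unfolding B.positive_matrix_iff by (auto simp: M_def)
  then have "amplify \<psi> M \<in> positive_elements (matrix_algebra n A)"
    using w by (intro map_positive) (auto simp: M_def)
  then obtain Z where Z: "entries_in A n Z" "\<forall>i<n. \<forall>j<n. amplify \<psi> M i j = mat_mult A n (mat_adj A Z) Z i j"
    unfolding A.positive_matrix_iff by blast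
  then have "\<forall>i<n. \<forall>j<n. \<psi> ((w i)\<^sup>\<star>\<^bsub>B\<^esub> \<otimes>\<^bsub>B\<^esub> w j) = mat_mult A n (mat_adj A Z) Z i j"
    by (simp add: amplify_def M_def)
  with Z(1) show ?thesis
    by blast
qed

text \<open>The off-diagonal entries of the image of a 2 by 2 Gram matrix are adjoint to each other.
  Taking one element to be 1 gives compatibility with the star.\<close>

lemma map_star_mult: 
  assumes "x \<in> carrier B" "y \<in> carrier B"
  shows "(\<psi> (x\<^sup>\<star>\<^bsub>B\<^esub> \<otimes>\<^bsub>B\<^esub> y))\<^sup>\<star>\<^bsub>A\<^esub> = \<psi> (y\<^sup>\<star>\<^bsub>B\<^esub> \<otimes>\<^bsub>B\<^esub> x)"
proof -
  let ?w = "\<lambda>i::nat. if i = 0 then x else y"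
  have "\<exists>Z. entries_in A 2 Z \<and>
      (\<forall>i<2. \<forall>j<2. \<psi> ((?w i)\<^sup>\<star>\<^bsub>B\<^esub> \<otimes>\<^bsub>B\<^esub> ?w j) = mat_mult A 2 (mat_adj A Z) Z i j)"
    by (rule map_gram) (use assms in simp)
  then obtain Z where Z: "entries_in A 2 Z" "\<And>i j. i < 2 \<Longrightarrow> j < 2 \<Longrightarrow>
      \<psi> ((?w i)\<^sup>\<star>\<^bsub>B\<^esub> \<otimes>\<^bsub>B\<^esub> ?w j) = mat_mult A 2 (mat_adj A Z) Z i j"
    by blast
  have "(mat_mult A 2 (mat_adj A Z) Z 0 1)\<^sup>\<star>\<^bsub>A\<^esub> = mat_mult A 2 (mat_adj A Z) Z 1 0"
    unfolding mat_mult_def mat_adj_def using Z(1)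
    by (subst A.vsum_star) (auto simp: A.star_mult entries_in_def intro!: vsum_cong)
  then show ?thesis
    using Z(2)[of 0 1] Z(2)[of 1 0] by simp
qed

lemma map_star: "x \<in> carrier B \<Longrightarrow> \<psi> (x\<^sup>\<star>\<^bsub>B\<^esub>) = (\<psi> x)\<^sup>\<star>\<^bsub>A\<^esub>"
  using map_star_mult[of "\<one>\<^bsub>B\<^esub>" x] by simp

lemma map_square: 
  assumes "x \<in> carrier B"
  shows "\<psi> (x\<^sup>\<star>\<^bsub>B\<^esub> \<otimes>\<^bsub>B\<^esub> x) \<in> squares A"
proof -
  have "\<exists>Z. entries_in A 1 Z \<and>
      (\<forall>i<1. \<forall>j<1. \<psi> (x\<^sup>\<star>\<^bsub>B\<^esub> \<otimes>\<^bsub>B\<^esub> x) = mat_mult A 1 (mat_adj A Z) Z i j)"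
    by (rule map_gram) (use assms in simp)
  then obtain Z where Z: "entries_in A 1 Z" "\<psi> (x\<^sup>\<star>\<^bsub>B\<^esub> \<otimes>\<^bsub>B\<^esub> x) = mat_mult A 1 (mat_adj A Z) Z 0 0"
    by blast
  then show ?thesis
    by (auto simp: mat_mult_def mat_adj_def entries_in_def intro: A.star_mult_in_squares)
qed

lemma map_squares: "h \<in> squares B \<Longrightarrow> \<psi> h \<in> squares A"
  by (metis B.selfadjointD B.squaresE map_square)

lemma map_norm_selfadjoint:
  assumes x: "x \<in> selfadjoint_elements B" "nrm B x \<le> c" and c: "0 < c"
  shows "nrm A (\<psi> x) \<le> c"
proof -
  let ?x = "complex_of_real (1/c) \<odot>\<^bsub>B\<^esub> x"
  have xc [simp]: "x \<in> carrier B" "\<psi> x \<in> carrier A"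
    using x by simp_all
  have x': "?x \<in> selfadjoint_elements B" "nrm B ?x \<le> 1"
    using B.selfadjoint_smult[OF x(1), of "1/c"] x c by (simp_all add: B.nrm_smult norm_divide)
  have "\<one>\<^bsub>B\<^esub> \<ominus>\<^bsub>B\<^esub> ?x \<in> squares B" "\<one>\<^bsub>B\<^esub> \<ominus>\<^bsub>B\<^esub> (\<ominus>\<^bsub>B\<^esub> ?x) \<in> squares B"
    using x' by (auto intro!: B.one_minus_in_squares B.selfadjoint_minus)
  then have "\<psi> (\<one>\<^bsub>B\<^esub> \<ominus>\<^bsub>B\<^esub> ?x) \<in> squares A" "\<psi> (\<one>\<^bsub>B\<^esub> \<ominus>\<^bsub>B\<^esub> (\<ominus>\<^bsub>B\<^esub> ?x)) \<in> squares A"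
    by (auto intro: map_squares)
  then have "\<one>\<^bsub>A\<^esub> \<ominus>\<^bsub>A\<^esub> \<psi> ?x \<in> squares A" "\<one>\<^bsub>A\<^esub> \<oplus>\<^bsub>A\<^esub> \<psi> ?x \<in> squares A"
    by (simp_all add: map_diff map_minus A.minus_eq)
  moreover have "\<psi> ?x \<in> selfadjoint_elements A"
    using x'(1) map_star[of ?x] by (intro A.selfadjointI) auto
  ultimately have "nrm A (\<psi> ?x) \<le> 1"
    by (intro A.norm_le_one)
  then show ?thesis
    using c by (simp add: map_smult A.nrm_smult norm_divide field_simps)
qed

text \<open>The bound passes through the two self-adjoint parts, where positivity of 1 - x/c and 1 +
  x/c suffices. The summand 1 keeps the bound positive; homogeneity removes it afterwards and leaves
  the factor 4 of \<open>map_norm_le\<close>, which is crude but gives continuity.\<close>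

lemma map_norm:
  assumes x: "x \<in> carrier B"
  shows "nrm A (\<psi> x) \<le> 2 * (nrm B x + 1)"
proof -
  let ?c = "2 * (nrm B x + 1)"
  let ?a = "x \<oplus>\<^bsub>B\<^esub> x\<^sup>\<star>\<^bsub>B\<^esub>" and ?b = "\<i> \<odot>\<^bsub>B\<^esub> (x \<ominus>\<^bsub>B\<^esub> x\<^sup>\<star>\<^bsub>B\<^esub>)"
  note [simp] = x
  note sa = B.cartesian_decomposition(1,2)[OF x]
  have n: "nrm B ?a \<le> ?c" "nrm B ?b \<le> ?c" "0 < ?c"
    using B.nrm_triangle[of x "x\<^sup>\<star>\<^bsub>B\<^esub>"] B.nrm_diff_le[of x "x\<^sup>\<star>\<^bsub>B\<^esub>"] B.nrm_nonneg[of x]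
    by (simp_all add: B.nrm_smult)
  have "(1/2) \<odot>\<^bsub>B\<^esub> (?a \<oplus>\<^bsub>B\<^esub> (- \<i>) \<odot>\<^bsub>B\<^esub> ?b) = x"
    by (rule B.cartesian_decomposition[OF x])
  then have "\<psi> x = (1/2) \<odot>\<^bsub>A\<^esub> (\<psi> ?a \<oplus>\<^bsub>A\<^esub> (- \<i>) \<odot>\<^bsub>A\<^esub> \<psi> ?b)"
    using map_smult[of "?a \<oplus>\<^bsub>B\<^esub> (- \<i>) \<odot>\<^bsub>B\<^esub> ?b" "1/2"] map_add[of ?a "(- \<i>) \<odot>\<^bsub>B\<^esub> ?b"]
      map_smult[of ?b "- \<i>"] by (metis B.a_closed B.minus_closed B.smult_cl B.star_closed x)
  then have "nrm A (\<psi> x) = 1/2 * nrm A (\<psi> ?a \<oplus>\<^bsub>A\<^esub> (- \<i>) \<odot>\<^bsub>A\<^esub> \<psi> ?b)"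
    by (simp add: A.nrm_smult norm_divide)
  also have "\<dots> \<le> 1/2 * (nrm A (\<psi> ?a) + nrm A (\<psi> ?b))"
    using A.nrm_triangle[of "\<psi> ?a" "(- \<i>) \<odot>\<^bsub>A\<^esub> \<psi> ?b"] by (simp add: A.nrm_smult)
  also have "\<dots> \<le> ?c"
    using map_norm_selfadjoint[OF sa(1) n(1,3)] map_norm_selfadjoint[OF sa(2) n(2,3)] by simp
  finally show ?thesis .
qed

lemma map_norm_le:
  assumes x: "x \<in> carrier B"
  shows "nrm A (\<psi> x) \<le> 4 * nrm B x"
proof (cases "nrm B x = 0")
  case True
  then show ?thesis
    using x by (simp add: B.nrm_eq_0_iff)
next
  case False
  then have pos: "0 < nrm B x"
    using B.nrm_nonneg[OF x] by simp
  have "nrm A (\<psi> (complex_of_real (1 / nrm B x) \<odot>\<^bsub>B\<^esub> x)) \<le> 2 * (1 + 1)"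
    using map_norm[of "complex_of_real (1 / nrm B x) \<odot>\<^bsub>B\<^esub> x"] x pos by (simp add: B.nrm_smult norm_divide)
  then show ?thesis
    using x pos by (simp add: map_smult A.nrm_smult norm_divide field_simps)
qed

lemma map_converges:
  assumes "converges B f l"
  shows "converges A (\<lambda>n. \<psi> (f n)) (\<psi> l)"
proof (rule A.converges_bound)
  show "nrm A (\<psi> (f n) \<ominus>\<^bsub>A\<^esub> \<psi> l) \<le> 4 * nrm B (f n \<ominus>\<^bsub>B\<^esub> l)" for n
    using B.converges_closed[OF assms] map_norm_le[of "f n \<ominus>\<^bsub>B\<^esub> l"] by (simp add: map_diff)
  show "(\<lambda>n. 4 * nrm B (f n \<ominus>\<^bsub>B\<^esub> l)) \<longlonglongrightarrow> 0"
    using assms tendsto_mult_left[of _ 0 _ 4] by (fastforce simp: converges_def)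
qed (use B.converges_closed[OF assms] in auto)

text \<open>The Gram matrix of \<open>1, s, x\<^sup>\<star>\<close> is mapped to a positive matrix that annihilates the column
  \<open>(-\<psi> s, 1, 0)\<close>; the last row of this equation is the claim.\<close>

lemma map_multiplicative_domain:
  assumes s: "s \<in> carrier B" "\<psi> (s\<^sup>\<star>\<^bsub>B\<^esub> \<otimes>\<^bsub>B\<^esub> s) = (\<psi> s)\<^sup>\<star>\<^bsub>A\<^esub> \<otimes>\<^bsub>A\<^esub> \<psi> s" and x: "x \<in> carrier B"
  shows "\<psi> (x \<otimes>\<^bsub>B\<^esub> s) = \<psi> x \<otimes>\<^bsub>A\<^esub> \<psi> s"
proof -
  note [simp] = s(1) x
  let ?w = "\<lambda>i::nat. if i = 0 then \<one>\<^bsub>B\<^esub> else if i = 1 then s else x\<^sup>\<star>\<^bsub>B\<^esub>"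
  have "\<exists>Z. entries_in A 3 Z \<and>
      (\<forall>i<3. \<forall>j<3. \<psi> ((?w i)\<^sup>\<star>\<^bsub>B\<^esub> \<otimes>\<^bsub>B\<^esub> ?w j) = mat_mult A 3 (mat_adj A Z) Z i j)"
    by (rule map_gram) simp
  then obtain Z where Z: "entries_in A 3 Z" "\<And>i j. i < 3 \<Longrightarrow> j < 3 \<Longrightarrow>
      \<psi> ((?w i)\<^sup>\<star>\<^bsub>B\<^esub> \<otimes>\<^bsub>B\<^esub> ?w j) = mat_mult A 3 (mat_adj A Z) Z i j"
    by blast
  let ?G = "mat_mult A 3 (mat_adj A Z) Z"
  have G: "?G 0 0 = \<one>\<^bsub>A\<^esub>" "?G 0 1 = \<psi> s" "?G 1 0 = (\<psi> s)\<^sup>\<star>\<^bsub>A\<^esub>" "?G 1 1 = (\<psi> s)\<^sup>\<star>\<^bsub>A\<^esub> \<otimes>\<^bsub>A\<^esub> \<psi> s"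
    "?G 2 0 = \<psi> x" "?G 2 1 = \<psi> (x \<otimes>\<^bsub>B\<^esub> s)"
    using s(2) Z(2)[of 0 0] Z(2)[of 0 1] Z(2)[of 1 0] Z(2)[of 1 1] Z(2)[of 2 0] Z(2)[of 2 1]
    by (simp_all add: map_star)
  have Gc: "?G i j \<in> carrier A" if "i < 3" "j < 3" for i j
    using Z(1) that A.mat_mult_closed[of 3 "mat_adj A Z" Z] by simp
  define \<xi> where "\<xi> = (\<lambda>i::nat. if i = 0 then \<ominus>\<^bsub>A\<^esub> \<psi> s else if i = 1 then \<one>\<^bsub>A\<^esub> else \<zero>\<^bsub>A\<^esub>)"
  have \<xi>: "col A 3 \<xi>"
    by (auto simp: col_def \<xi>_def)
  have G\<xi>: "mat_vec A 3 ?G \<xi> i = \<ominus>\<^bsub>A\<^esub> (?G i 0 \<otimes>\<^bsub>A\<^esub> \<psi> s) \<oplus>\<^bsub>A\<^esub> ?G i 1" if "i < 3" for i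
    using Gc[OF that, of 0] Gc[OF that, of 1] Gc[OF that, of 2]
    by (simp add: mat_vec_def \<xi>_def eval_nat_numeral A.r_minus)
  have G\<xi>01: "mat_vec A 3 ?G \<xi> 0 = \<zero>\<^bsub>A\<^esub>" "mat_vec A 3 ?G \<xi> 1 = \<zero>\<^bsub>A\<^esub>"
    using G\<xi>[of 0] G\<xi>[of 1] by (simp_all add: G A.l_neg del: One_nat_def)
  have G\<xi>Z: "mat_vec A 3 ?G \<xi> i = mat_vec A 3 (mat_adj A Z) (mat_vec A 3 Z \<xi>) i" if "i < 3" for i
    using Z(1) \<xi> that by (intro A.mat_vec_mult) auto
  \<comment> \<open>Write G for \<open>?G\<close>. Pairing \<xi> with G \<xi> gives 0, since G \<xi>
    vanishes in rows 0 and 1 and \<xi> in row 2. As G is \<open>Z\<^sup>\<star> Z\<close>, this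
    forces Z \<xi> = 0, and with it row 2 of G \<xi>.\<close>
  have "ip A 3 (mat_vec A 3 Z \<xi>) (mat_vec A 3 Z \<xi>) = ip A 3 \<xi> (mat_vec A 3 (mat_adj A Z) (mat_vec A 3 Z \<xi>))"
    using Z(1) \<xi> by (simp add: A.ip_mat_vec_left)
  also have "\<dots> = ip A 3 \<xi> (mat_vec A 3 ?G \<xi>)"
    using G\<xi>Z by (intro ip_cong) auto
  also have "\<dots> = \<zero>\<^bsub>A\<^esub>"
  proof -
    have "mat_vec A 3 ?G \<xi> 2 \<in> carrier A"
      using G\<xi>[of 2] Gc[of 2 0] Gc[of 2 1] by simp
    then show ?thesis
      using G\<xi>01 by (simp add: ip_def eval_nat_numeral \<xi>_def)
  qed
  finally have sum0: "vsum A (\<lambda>k. (mat_vec A 3 Z \<xi> k)\<^sup>\<star>\<^bsub>A\<^esub> \<otimes>\<^bsub>A\<^esub> mat_vec A 3 Z \<xi> k) 3 = \<zero>\<^bsub>A\<^esub>"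
    unfolding ip_def .
  have Z\<xi>c: "mat_vec A 3 Z \<xi> k \<in> carrier A" if "k < 3" for k
    by (rule A.colD[OF A.mat_vec_col[OF Z(1) \<xi>] that])
  have Z\<xi>: "mat_vec A 3 Z \<xi> k = \<zero>\<^bsub>A\<^esub>" if "k < 3" for k
  proof (rule A.star_mult_eq_zero[OF Z\<xi>c[OF that]])
    show "(mat_vec A 3 Z \<xi> k)\<^sup>\<star>\<^bsub>A\<^esub> \<otimes>\<^bsub>A\<^esub> mat_vec A 3 Z \<xi> k = \<zero>\<^bsub>A\<^esub>"
      by (rule A.vsum_squares_eq_zero[OF _ sum0 that]) (rule A.star_mult_in_squares, rule Z\<xi>c)
  qed
  have "mat_vec A 3 (mat_adj A Z) (mat_vec A 3 Z \<xi>) 2 = \<zero>\<^bsub>A\<^esub>"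
    unfolding mat_vec_def[of A 3 "mat_adj A Z"] using A.entries_inD[OF A.mat_adj_entries[OF Z(1)], of 2]
    by (intro A.vsum_zero) (simp add: Z\<xi>)
  then have "\<ominus>\<^bsub>A\<^esub> (\<psi> x \<otimes>\<^bsub>A\<^esub> \<psi> s) \<oplus>\<^bsub>A\<^esub> \<psi> (x \<otimes>\<^bsub>B\<^esub> s) = \<zero>\<^bsub>A\<^esub>"
    using G\<xi>[of 2] G\<xi>Z[of 2] by (simp add: G del: One_nat_def)
  then have "\<ominus>\<^bsub>A\<^esub> (\<ominus>\<^bsub>A\<^esub> (\<psi> x \<otimes>\<^bsub>A\<^esub> \<psi> s)) = \<psi> (x \<otimes>\<^bsub>B\<^esub> s)"
    by (intro A.sum_eq_zeroD) auto
  then show ?thesis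
    by simp
qed

end

section \<open>Star-homomorphisms, transport to another type, and extension by injectivity\<close>

lemma cstar_homD:
  assumes "h \<in> cstar_hom X Y"
  shows "x \<in> carrier X \<Longrightarrow> h x \<in> carrier Y"
    and "x \<in> carrier X \<Longrightarrow> y \<in> carrier X \<Longrightarrow> h (x \<oplus>\<^bsub>X\<^esub> y) = h x \<oplus>\<^bsub>Y\<^esub> h y"
    and "x \<in> carrier X \<Longrightarrow> y \<in> carrier X \<Longrightarrow> h (x \<otimes>\<^bsub>X\<^esub> y) = h x \<otimes>\<^bsub>Y\<^esub> h y"
    and "h \<one>\<^bsub>X\<^esub> = \<one>\<^bsub>Y\<^esub>"
    and "x \<in> carrier X \<Longrightarrow> h (c \<odot>\<^bsub>X\<^esub> x) = c \<odot>\<^bsub>Y\<^esub> h x"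
    and "x \<in> carrier X \<Longrightarrow> h (x\<^sup>\<star>\<^bsub>X\<^esub>) = (h x)\<^sup>\<star>\<^bsub>Y\<^esub>"
  using assms by (auto simp: cstar_hom_def ring_hom_def)

lemma cstar_homI:
  assumes "\<And>x. x \<in> carrier X \<Longrightarrow> h x \<in> carrier Y"
    and "\<And>x y. x \<in> carrier X \<Longrightarrow> y \<in> carrier X \<Longrightarrow> h (x \<oplus>\<^bsub>X\<^esub> y) = h x \<oplus>\<^bsub>Y\<^esub> h y"
    and "\<And>x y. x \<in> carrier X \<Longrightarrow> y \<in> carrier X \<Longrightarrow> h (x \<otimes>\<^bsub>X\<^esub> y) = h x \<otimes>\<^bsub>Y\<^esub> h y"
    and "h \<one>\<^bsub>X\<^esub> = \<one>\<^bsub>Y\<^esub>"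
    and "\<And>x c. x \<in> carrier X \<Longrightarrow> h (c \<odot>\<^bsub>X\<^esub> x) = c \<odot>\<^bsub>Y\<^esub> h x"
    and "\<And>x. x \<in> carrier X \<Longrightarrow> h (x\<^sup>\<star>\<^bsub>X\<^esub>) = (h x)\<^sup>\<star>\<^bsub>Y\<^esub>"
  shows "h \<in> cstar_hom X Y"
  using assms by (auto simp: cstar_hom_def ring_hom_def)

locale cstar_morphism = X: cstar_algebra X + Y: cstar_algebra Y
  for X :: "('a, 'm) cstar_scheme" and Y :: "('b, 'n) cstar_scheme" +
  fixes h assumes hom: "h \<in> cstar_hom X Y"
begin

lemmas hom_simps [simp] = cstar_homD[OF hom]

lemma hom_zero [simp]: "h \<zero>\<^bsub>X\<^esub> = \<zero>\<^bsub>Y\<^esub>"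
  using hom_simps(5)[of "\<zero>\<^bsub>X\<^esub>" 0] by simp

lemma hom_minus [simp]: "x \<in> carrier X \<Longrightarrow> h (\<ominus>\<^bsub>X\<^esub> x) = \<ominus>\<^bsub>Y\<^esub> h x"
  by (simp add: X.minus_as_smult Y.minus_as_smult)

lemma hom_diff [simp]: "x \<in> carrier X \<Longrightarrow> y \<in> carrier X \<Longrightarrow> h (x \<ominus>\<^bsub>X\<^esub> y) = h x \<ominus>\<^bsub>Y\<^esub> h y"
  by (simp add: X.minus_eq Y.minus_eq)

lemma hom_vsum: "(\<And>k. k < n \<Longrightarrow> f k \<in> carrier X) \<Longrightarrow> h (vsum X f n) = vsum Y (\<lambda>k. h (f k)) n"
  by (induction n) auto

lemma hom_squares: "a \<in> squares X \<Longrightarrow> h a \<in> squares Y"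
proof (erule X.squaresE)
  fix k assume k: "k \<in> selfadjoint_elements X" "a = k \<otimes>\<^bsub>X\<^esub> k"
  have "h k \<in> selfadjoint_elements Y"
    using k(1) hom_simps(6)[of k] by (intro Y.selfadjointI) auto
  with k show ?thesis
    by (auto intro: Y.square_in_squares)
qed

lemma hom_positive_matrix:
  assumes "M \<in> positive_elements (matrix_algebra n X)"
  shows "amplify h M \<in> positive_elements (matrix_algebra n Y)"
proof -
  obtain Z where Z: "entries_in X n Z" "\<And>i j. i < n \<Longrightarrow> j < n \<Longrightarrow> M i j = mat_mult X n (mat_adj X Z) Z i j"
    and M0: "\<And>i j. \<not> (i < n \<and> j < n) \<Longrightarrow> M i j = \<zero>\<^bsub>X\<^esub>"
    using assms unfolding X.positive_matrix_iff by blast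
  have "h (M i j) = mat_mult Y n (mat_adj Y (\<lambda>i j. h (Z i j))) (\<lambda>i j. h (Z i j)) i j" if "i < n" "j < n" for i j
    using that Z(1) unfolding Z(2)[OF that] mat_mult_def mat_adj_def
    by (subst hom_vsum) (auto simp: entries_in_def intro!: vsum_cong)
  moreover have "entries_in Y n (\<lambda>i j. h (Z i j))"
    using Z(1) by (simp add: entries_in_def)
  ultimately show ?thesis
    unfolding Y.positive_matrix_iff using M0 by (auto simp: amplify_def)
qed

lemma ucp_comp_hom:
  assumes "ucp Y (carrier Y) B \<psi>"
  shows "ucp X (carrier X) B (\<lambda>x. \<psi> (h x))"
proof -
  have "amplify (\<lambda>x. \<psi> (h x)) M = amplify \<psi> (amplify h M)" for M
    by (simp add: amplify_def)
  moreover have "\<forall>i<n. \<forall>j<n. amplify h M i j \<in> carrier Y" if "\<forall>i<n. \<forall>j<n. M i j \<in> carrier X" for n M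
    using that by (simp add: amplify_def)
  ultimately show ?thesis
    using assms hom_positive_matrix unfolding ucp_def by (simp add: Pi_iff)
qed

end

lemma (in cstar_algebra) operator_system_iff:
  "operator_system A S \<longleftrightarrow> S \<subseteq> carrier A \<and> \<one> \<in> S \<and> (\<forall>x\<in>S. \<forall>y\<in>S. x \<oplus> y \<in> S) \<and>
    (\<forall>c. \<forall>x\<in>S. c \<odot> x \<in> S) \<and> (\<forall>x\<in>S. x\<^sup>\<star> \<in> S)"
proof
  assume "operator_system A S"
  then have S: "submodule S complex_ring A" and "\<one> \<in> S" "\<forall>x\<in>S. x\<^sup>\<star> \<in> S"
    by (auto simp: operator_system_def)
  with submoduleE[OF S] show "S \<subseteq> carrier A \<and> \<one> \<in> S \<and> (\<forall>x\<in>S. \<forall>y\<in>S. x \<oplus> y \<in> S) \<and>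
    (\<forall>c. \<forall>x\<in>S. c \<odot> x \<in> S) \<and> (\<forall>x\<in>S. x\<^sup>\<star> \<in> S)"
    by auto
next
  assume S: "S \<subseteq> carrier A \<and> \<one> \<in> S \<and> (\<forall>x\<in>S. \<forall>y\<in>S. x \<oplus> y \<in> S) \<and>
    (\<forall>c. \<forall>x\<in>S. c \<odot> x \<in> S) \<and> (\<forall>x\<in>S. x\<^sup>\<star> \<in> S)"
  then have "\<ominus> x \<in> S" if "x \<in> S" for x
    using that minus_as_smult[of x] by (metis subsetD)
  moreover have "\<zero> \<in> S"
    using S smult_0[of \<one>] by (metis one_closed)
  ultimately have "submodule S complex_ring A"
    using S by (intro submoduleI) auto
  with S show "operator_system A S"
    by (auto simp: operator_system_def)
qed

text \<open>A copy of A along an injection f. It is needed because \<open>injective_cstar\<close>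
  speaks of algebras over one type only.\<close>

definition transport :: "('a \<Rightarrow> 'b) \<Rightarrow> ('a, 'm) cstar_scheme \<Rightarrow> 'b cstar" where
  "transport f A = (let g = inv_into (carrier A) f in
    \<lparr> carrier = f ` carrier A,
      monoid.mult = (\<lambda>x y. f (g x \<otimes>\<^bsub>A\<^esub> g y)),
      one = f \<one>\<^bsub>A\<^esub>,
      ring.zero = f \<zero>\<^bsub>A\<^esub>,
      add = (\<lambda>x y. f (g x \<oplus>\<^bsub>A\<^esub> g y)),
      module.smult = (\<lambda>c x. f (c \<odot>\<^bsub>A\<^esub> g x)),
      star = (\<lambda>x. f ((g x)\<^sup>\<star>\<^bsub>A\<^esub>)),
      nrm = (\<lambda>x. nrm A (g x)) \<rparr>)"

lemma (in cstar_algebra) transport_cstar_algebra: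
  assumes f: "inj_on f (carrier A)"
  shows "cstar_embedding A A (transport f A) (inv_into (carrier A) f) (inv_into (carrier A) f)"
    and "f \<in> cstar_hom A (transport f A)"
    and "inv_into (carrier A) f \<in> cstar_hom (transport f A) A"
proof -
  let ?g = "inv_into (carrier A) f"
  have g [simp]: "?g (f x) = x" if "x \<in> carrier A" for x
    using f that by simp
  have gc [simp]: "?g y \<in> carrier A" if "y \<in> f ` carrier A" for y
    using that by (rule inv_into_into)
  show "f \<in> cstar_hom A (transport f A)" "?g \<in> cstar_hom (transport f A) A"
    by (rule cstar_homI; auto simp: transport_def Let_def)+
  show "cstar_embedding A A (transport f A) ?g ?g"
  proof (unfold_locales; (auto simp: transport_def Let_def; fail)?)
    fix h a b
    assume "\<And>n. h n \<in> carrier (transport f A)" "converges A (\<lambda>n. ?g (h n)) a" "converges A (\<lambda>n. ?g (h n)) b"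
    then have "a \<in> carrier A" "b = a"
      using converges_unique converges_closed by blast+
    then show "\<exists>x\<in>carrier (transport f A). ?g x = a \<and> ?g x = b"
      by (intro bexI[of _ "f a"]) (auto simp: transport_def Let_def)
  qed
qed

definition cstar_prod :: "('a, 'm) cstar_scheme \<Rightarrow> ('b, 'n) cstar_scheme \<Rightarrow> ('a \<times> 'b) cstar" where
  "cstar_prod A B =
    \<lparr> carrier = carrier A \<times> carrier B,
      monoid.mult = (\<lambda>x y. (fst x \<otimes>\<^bsub>A\<^esub> fst y, snd x \<otimes>\<^bsub>B\<^esub> snd y)),
      one = (\<one>\<^bsub>A\<^esub>, \<one>\<^bsub>B\<^esub>),
      ring.zero = (\<zero>\<^bsub>A\<^esub>, \<zero>\<^bsub>B\<^esub>),
      add = (\<lambda>x y. (fst x \<oplus>\<^bsub>A\<^esub> fst y, snd x \<oplus>\<^bsub>B\<^esub> snd y)),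
      module.smult = (\<lambda>c x. (c \<odot>\<^bsub>A\<^esub> fst x, c \<odot>\<^bsub>B\<^esub> snd x)),
      star = (\<lambda>x. ((fst x)\<^sup>\<star>\<^bsub>A\<^esub>, (snd x)\<^sup>\<star>\<^bsub>B\<^esub>)),
      nrm = (\<lambda>x. max (nrm A (fst x)) (nrm B (snd x))) \<rparr>"

lemma cstar_prod_embedding:
  assumes "cstar_algebra A" "cstar_algebra B"
  shows "cstar_embedding A B (cstar_prod A B) fst snd"
proof -
  interpret A: cstar_algebra A by fact
  interpret B: cstar_algebra B by fact
  show ?thesis
  proof (unfold_locales; (auto simp: cstar_prod_def; fail)?)
    fix f a b
    assume "converges A (\<lambda>n. fst (f n)) a" "converges B (\<lambda>n. snd (f n)) b"
    then have "(a, b) \<in> carrier (cstar_prod A B)"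
      by (simp add: cstar_prod_def A.converges_closed B.converges_closed)
    then show "\<exists>x\<in>carrier (cstar_prod A B). fst x = a \<and> snd x = b"
      by force
  qed
qed

text \<open>B, S and \<phi> are carried to the type of the hypothesis along f, extended there, and
  the extension is composed with f. Entrywise star-homomorphisms preserve positive matrices, so
  complete positivity survives in both directions.\<close>

lemma injective_cstar_extend:
  fixes A :: "('a, 'm) cstar_scheme" and B :: "('b, 'n) cstar_scheme" and f :: "'b \<Rightarrow> 'u"
  assumes inj: "injective_cstar TYPE('u) A" and B: "cstar_algebra B" and f: "inj_on f (carrier B)"
    and S: "operator_system B S" and \<phi>: "ucp B S A \<phi>"
  shows "\<exists>\<psi>. ucp B (carrier B) A \<psi> \<and> (\<forall>x\<in>S. \<psi> x = \<phi> x)"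
proof -
  interpret B: cstar_algebra B by fact
  let ?T = "transport f B" and ?g = "inv_into (carrier B) f"
  note tr = B.transport_cstar_algebra[OF f]
  interpret T: cstar_algebra ?T
    by (rule cstar_embedding.cstar_algebra_X[OF tr(1)])
  interpret f: cstar_morphism B ?T f
    by unfold_locales (rule tr(2))
  interpret g: cstar_morphism ?T B ?g
    by unfold_locales (rule tr(3))
  have Sc: "S \<subseteq> carrier B"
    using S by (simp add: B.operator_system_iff)
  have gf [simp]: "?g (f x) = x" if "x \<in> carrier B" for x
    using f that by simp
  have gS: "?g y \<in> S" "y \<in> carrier ?T" if "y \<in> f ` S" for y
    using that Sc by auto
  have "operator_system ?T (f ` S)"
    unfolding T.operator_system_iff
  proof (intro conjI ballI allI)
    show "\<one>\<^bsub>?T\<^esub> \<in> f ` S"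
      using S by (intro image_eqI[of _ _ "\<one>\<^bsub>B\<^esub>"]) (auto simp: B.operator_system_iff)
    fix x assume "x \<in> f ` S"
    then obtain a where a: "x = f a" "a \<in> S" "a \<in> carrier B"
      using Sc by blast
    show "x\<^sup>\<star>\<^bsub>?T\<^esub> \<in> f ` S"
      using S a by (intro image_eqI[of _ _ "a\<^sup>\<star>\<^bsub>B\<^esub>"]) (auto simp: B.operator_system_iff)
    show "c \<odot>\<^bsub>?T\<^esub> x \<in> f ` S" for c
      using S a by (intro image_eqI[of _ _ "c \<odot>\<^bsub>B\<^esub> a"]) (auto simp: B.operator_system_iff)
    fix y assume "y \<in> f ` S"
    then obtain b where b: "y = f b" "b \<in> S" "b \<in> carrier B"
      using Sc by blast
    show "x \<oplus>\<^bsub>?T\<^esub> y \<in> f ` S"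
      using S a b by (intro image_eqI[of _ _ "a \<oplus>\<^bsub>B\<^esub> b"]) (auto simp: B.operator_system_iff)
  qed (use Sc in auto)
  moreover have "ucp ?T (f ` S) A (\<lambda>y. \<phi> (?g y))"
    unfolding ucp_def
  proof (intro conjI ballI allI impI)
    fix n M assume M: "M \<in> positive_elements (matrix_algebra n ?T)" "\<forall>i<n. \<forall>j<n. M i j \<in> f ` S"
    have "\<forall>i<n. \<forall>j<n. amplify ?g M i j \<in> S"
      using M(2) gS(1) by (simp add: amplify_def)
    then have "amplify \<phi> (amplify ?g M) \<in> positive_elements (matrix_algebra n A)"
      using \<phi> g.hom_positive_matrix[OF M(1)] unfolding ucp_def by blast
    then show "amplify (\<lambda>y. \<phi> (?g y)) M \<in> positive_elements (matrix_algebra n A)"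
      by (simp add: amplify_def)
  next
    show "(\<lambda>y. \<phi> (?g y)) \<in> f ` S \<rightarrow> carrier A"
      using \<phi> gS(1) unfolding ucp_def by (simp add: Pi_iff)
    show "\<phi> (?g \<one>\<^bsub>?T\<^esub>) = \<one>\<^bsub>A\<^esub>"
      using \<phi> unfolding ucp_def by simp
  next
    fix x y assume "x \<in> f ` S" "y \<in> f ` S"
    then show "\<phi> (?g (x \<oplus>\<^bsub>?T\<^esub> y)) = \<phi> (?g x) \<oplus>\<^bsub>A\<^esub> \<phi> (?g y)"
      using \<phi> gS unfolding ucp_def by simp
  next
    fix c x assume "x \<in> f ` S"
    then show "\<phi> (?g (c \<odot>\<^bsub>?T\<^esub> x)) = c \<odot>\<^bsub>A\<^esub> \<phi> (?g x)"
      using \<phi> gS unfolding ucp_def by simp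
  qed
  ultimately obtain \<psi> where \<psi>: "ucp ?T (carrier ?T) A \<psi>" "\<And>y. y \<in> f ` S \<Longrightarrow> \<psi> y = \<phi> (?g y)"
    using inj[unfolded injective_cstar_def, rule_format, OF conjI[OF T.cstar_algebra_axioms conjI]] by meson
  have "ucp B (carrier B) A (\<lambda>x. \<psi> (f x))"
    by (rule f.ucp_comp_hom[OF \<psi>(1)])
  moreover have "\<psi> (f x) = \<phi> x" if "x \<in> S" for x
    using \<psi>(2)[of "f x"] that Sc by auto
  ultimately show ?thesis
    by blast
qed

section \<open>Injective and rigid extensions of abelian subalgebras\<close>

lemma (in cstar_algebra) gram_hermitian:
  "entries_in A n Z \<Longrightarrow> i < n \<Longrightarrow> j < n \<Longrightarrow>
    (mat_mult A n (mat_adj A Z) Z j i)\<^sup>\<star> = mat_mult A n (mat_adj A Z) Z i j"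
  unfolding mat_mult_def mat_adj_def
  by (subst vsum_star) (auto simp: star_mult entries_in_def intro!: vsum_cong)

lemma (in cstar_algebra) norm_le_imp_diff_in_squares:
  assumes x: "x \<in> selfadjoint_elements A" "nrm A x \<le> c" and c: "0 < c"
  shows "complex_of_real c \<odot> \<one> \<ominus> x \<in> squares A"
proof -
  let ?x = "complex_of_real (1/c) \<odot> x"
  have [simp]: "x \<in> carrier A"
    using x by simp
  have "complex_of_real c \<odot> (\<one> \<ominus> ?x) \<in> squares A"
    using c x(2) selfadjoint_smult[OF x(1), of "1/c"]
    by (intro squares_smult one_minus_in_squares) (auto simp: nrm_smult norm_divide)
  then show ?thesis
    using c by (simp add: smult_diff_right)
qed

text \<open>With x = p - m and p m = 0, multiplying the test by m yields -m^2
  \<open>h\<^sup>\<star> h\<close>, the negative of the modulus square of m h. Being positive as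
  well, it vanishes, so m annihilates H and is 0.\<close>

lemma (in comm_cstar_algebra) in_squares_by_test:
  assumes x: "x \<in> selfadjoint_elements A" and H: "H \<subseteq> carrier A"
    and test: "\<And>h. h \<in> H \<Longrightarrow> x \<otimes> (h\<^sup>\<star> \<otimes> h) \<in> squares A"
    and ess: "\<And>a. a \<in> carrier A \<Longrightarrow> (\<And>h. h \<in> H \<Longrightarrow> a \<otimes> h = \<zero>) \<Longrightarrow> a = \<zero>"
  shows "x \<in> squares A"
proof -
  obtain p m where pm: "p \<in> squares A" "m \<in> squares A" "x = p \<ominus> m" "p \<otimes> m = \<zero>"
    using x by (rule pos_neg_parts)
  have c [simp]: "p \<in> carrier A" "m \<in> carrier A" "m\<^sup>\<star> = m"
    using pm by simp_all
  have "m = \<zero>"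
  proof (rule ess)
    fix h assume h: "h \<in> H"
    then have hc [simp]: "h \<in> carrier A"
      using H by blast
    let ?s = "(m \<otimes> h)\<^sup>\<star> \<otimes> (m \<otimes> h)"
    have s: "?s = m \<otimes> m \<otimes> (h\<^sup>\<star> \<otimes> h)"
      by (simp add: star_mult m_ac)
    have "x \<otimes> (h\<^sup>\<star> \<otimes> h) \<otimes> m = p \<otimes> m \<otimes> (h\<^sup>\<star> \<otimes> h) \<ominus> m \<otimes> m \<otimes> (h\<^sup>\<star> \<otimes> h)"
    proof -
      have "p \<in> carrier A" "m \<in> carrier A" "h\<^sup>\<star> \<otimes> h \<in> carrier A" by simp_all
      then show ?thesis unfolding pm(3) by algebra
    qed
    then have "x \<otimes> (h\<^sup>\<star> \<otimes> h) \<otimes> m = \<ominus> ?s"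
      using pm(4) by (simp add: s minus_eq)
    then have "\<ominus> ?s \<in> squares A"
      using squares_mult[OF test[OF h] pm(2)] by simp
    then have "?s = \<zero>"
      by (intro squares_antisym star_mult_in_squares) auto
    then show "m \<otimes> h = \<zero>"
      by (rule star_mult_eq_zero[rotated]) simp
  qed simp
  then show ?thesis
    using pm by (simp add: minus_eq)
qed

lemma (in comm_cstar_algebra) star_mult_zero:
  assumes "a \<in> carrier A" "b \<in> carrier A" "a \<otimes> b = \<zero>"
  shows "a\<^sup>\<star> \<otimes> b = \<zero>"
proof (rule star_mult_eq_zero)
  have "(a\<^sup>\<star> \<otimes> b)\<^sup>\<star> \<otimes> (a\<^sup>\<star> \<otimes> b) = b\<^sup>\<star> \<otimes> a\<^sup>\<star> \<otimes> (a \<otimes> b)"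
    using assms(1,2) by (simp add: star_mult m_ac)
  then show "(a\<^sup>\<star> \<otimes> b)\<^sup>\<star> \<otimes> (a\<^sup>\<star> \<otimes> b) = \<zero>"
    using assms by simp
qed (use assms in simp)

text \<open>A Gram root over A need not have entries in \<open>D\<close>. The quadratic form on
  columns over \<open>D\<close> is positive in A, hence in \<open>D\<close> by
  \<open>sub_squares_iff\<close>, and \<open>gram_decomposition\<close> produces a root over
  \<open>D\<close>.\<close>

lemma (in abelian_subalgebra) sub_positive_matrix:
  assumes M: "M \<in> positive_elements (matrix_algebra n A)" and MD: "\<forall>i<n. \<forall>j<n. M i j \<in> D"
  shows "M \<in> positive_elements (matrix_algebra n sub)"
proof -
  obtain Y where Y: "entries_in A n Y" "\<And>i j. i < n \<Longrightarrow> j < n \<Longrightarrow> M i j = mat_mult A n (mat_adj A Y) Y i j"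
    and M0: "\<And>i j. \<not> (i < n \<and> j < n) \<Longrightarrow> M i j = \<zero>"
    using M unfolding positive_matrix_iff by blast
  have E: "entries_in sub n M"
    using MD by (simp add: entries_in_def)
  have "form_nonneg sub n M"
    unfolding form_nonneg_def
  proof (intro allI impI)
    fix \<xi> assume \<xi>: "col sub n \<xi>"
    then have \<xi>A: "col A n \<xi>"
      by (simp add: col_def)
    have eq: "ip sub n \<xi> (mat_vec sub n M \<xi>) = ip A n \<xi> (mat_vec A n M \<xi>)"
      by (simp add: ip_def mat_vec_def)
    moreover have "ip sub n \<xi> (mat_vec sub n M \<xi>) \<in> carrier sub"
      using E \<xi> by (intro sub.ip_closed sub.mat_vec_col)
    moreover have "ip A n \<xi> (mat_vec A n M \<xi>) \<in> squares A"
      using Y \<xi>A by (intro ip_gram_in_squares)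
    ultimately show "ip sub n \<xi> (mat_vec sub n M \<xi>) \<in> squares sub"
      by (simp add: sub_squares_iff)
  qed
  moreover have "(M j i)\<^sup>\<star>\<^bsub>sub\<^esub> = M i j" if "i < n" "j < n" for i j
    using gram_hermitian[OF Y(1) that] Y(2) that by simp
  ultimately have "\<exists>Z. entries_in sub n Z \<and> (\<forall>i<n. \<forall>j<n. M i j = mat_mult sub n (mat_adj sub Z) Z i j)"
    using E by (intro sub.gram_decomposition)
  then show ?thesis
    unfolding sub.positive_matrix_iff using M0 by simp
qed

locale abelian_extension = abelian_subalgebra C D + A: comm_cstar_algebra A
  for C :: "('c, 'n) cstar_scheme" (structure) and D and A :: "('i, 'm) cstar_scheme" +
  fixes \<iota> :: "'c \<Rightarrow> 'i"
  assumes iota_hom: "\<iota> \<in> cstar_hom (C\<lparr>carrier := D\<rparr>) A" and iota_inj: "inj_on \<iota> D"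
begin

sublocale iota: cstar_morphism sub A \<iota>
  by unfold_locales (rule iota_hom)

lemma iota_simps [simp]:
  "x \<in> D \<Longrightarrow> \<iota> x \<in> carrier A"
  "x \<in> D \<Longrightarrow> y \<in> D \<Longrightarrow> \<iota> (x \<oplus> y) = \<iota> x \<oplus>\<^bsub>A\<^esub> \<iota> y"
  "x \<in> D \<Longrightarrow> y \<in> D \<Longrightarrow> \<iota> (x \<otimes> y) = \<iota> x \<otimes>\<^bsub>A\<^esub> \<iota> y"
  "\<iota> \<one> = \<one>\<^bsub>A\<^esub>" "\<iota> \<zero> = \<zero>\<^bsub>A\<^esub>"
  "x \<in> D \<Longrightarrow> \<iota> (c \<odot> x) = c \<odot>\<^bsub>A\<^esub> \<iota> x"
  "x \<in> D \<Longrightarrow> \<iota> (x\<^sup>\<star>) = (\<iota> x)\<^sup>\<star>\<^bsub>A\<^esub>"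
  "x \<in> D \<Longrightarrow> y \<in> D \<Longrightarrow> \<iota> (x \<ominus> y) = \<iota> x \<ominus>\<^bsub>A\<^esub> \<iota> y"
  "x \<in> D \<Longrightarrow> \<iota> (\<ominus> x) = \<ominus>\<^bsub>A\<^esub> \<iota> x"
  using iota.hom_simps(1,6)[of x] iota.hom_simps(2,3)[of x y] iota.hom_simps(4) iota.hom_zero
    iota.hom_simps(5)[of x c] iota.hom_diff[of x y] iota.hom_minus[of x]
  by (simp_all add: sub_diff sub_minus)

lemma iota_eq_iff: "x \<in> D \<Longrightarrow> y \<in> D \<Longrightarrow> \<iota> x = \<iota> y \<longleftrightarrow> x = y"
  using iota_inj by (auto dest: inj_onD)

lemma iota_eq_zero: "x \<in> D \<Longrightarrow> \<iota> x = \<zero>\<^bsub>A\<^esub> \<Longrightarrow> x = \<zero>"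
  using iota_eq_iff[of x \<zero>] by simp

lemma iota_squares: "h \<in> squares sub \<Longrightarrow> \<iota> h \<in> squares A"
  by (rule iota.hom_squares)

text \<open>If m is the negative part of x, then x m = -m^2 has a positive image under \<iota>, and
  so has m^2. Hence \<iota> (m^2) = 0, and injectivity gives m = 0.\<close>

lemma iota_reflects_squares:
  assumes x: "x \<in> selfadjoint_elements sub" "\<iota> x \<in> squares A"
  shows "x \<in> squares sub"
proof -
  obtain p m where pm: "p \<in> squares sub" "m \<in> squares sub" "x = p \<ominus>\<^bsub>sub\<^esub> m" "p \<otimes>\<^bsub>sub\<^esub> m = \<zero>\<^bsub>sub\<^esub>"
    using x(1) by (rule sub.pos_neg_parts)
  then have D: "p \<in> D" "m \<in> D" and eq: "x = p \<ominus> m" "p \<otimes> m = \<zero>"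
    by (auto simp: sub_squares_iff sub_diff)
  have m: "m\<^sup>\<star> = m"
    using pm(2) by (simp add: sub_squares_iff)
  have "x \<otimes> m = p \<otimes> m \<ominus> m \<otimes> m"
    unfolding eq(1) using D_carrier[OF D(1)] D_carrier[OF D(2)] by algebra
  then have "x \<otimes> m = \<ominus> (m \<otimes> m)"
    using D by (simp add: eq(2) minus_eq)
  moreover have "\<iota> x \<otimes>\<^bsub>A\<^esub> \<iota> m \<in> squares A"
    using x pm iota_squares by (intro A.squares_mult)
  ultimately have "\<ominus>\<^bsub>A\<^esub> \<iota> (m \<otimes> m) \<in> squares A"
    using D by (metis D_diff D_mult eq(1) iota_simps(3,9))
  moreover have "\<iota> (m \<otimes> m) \<in> squares A"
    using D pm iota_squares by (auto intro: A.squares_mult)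
  ultimately have "m \<otimes> m = \<zero>"
    using D A.squares_antisym[of "\<iota> (m \<otimes> m)"] by (intro iota_eq_zero) auto
  then have "m = \<zero>"
    using sub.star_mult_eq_zero[of m] D m by simp
  then show ?thesis
    using pm D eq by (simp add: minus_eq)
qed

lemma iota_ucp: "ucp C D A \<iota>"
  unfolding ucp_def
proof (intro conjI ballI allI impI)
  fix n M assume "M \<in> positive_elements (matrix_algebra n C)" "\<forall>i<n. \<forall>j<n. M i j \<in> D"
  then show "amplify \<iota> M \<in> positive_elements (matrix_algebra n A)"
    by (intro iota.hom_positive_matrix sub_positive_matrix)
qed auto

end

section \<open>Splitting \<open>A\<close> along a pair of subsets of \<open>D\<close> that
  annihilate each other\<close>

locale complementary_subsets = abelian_extension C D A \<iota>
  for C :: "('c, 'n) cstar_scheme" (structure) and D and A :: "('i, 'm) cstar_scheme" and \<iota> +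
  fixes J K :: "'c set"
  assumes J_subset: "J \<subseteq> D" and K_subset: "K \<subseteq> D"
    and JK: "\<And>j k. j \<in> J \<Longrightarrow> k \<in> K \<Longrightarrow> j \<otimes> k = \<zero>"
    and no_annihilator: "\<And>g. g \<in> D \<Longrightarrow> (\<And>j. j \<in> J \<Longrightarrow> g \<otimes> j = \<zero>) \<Longrightarrow>
      (\<And>k. k \<in> K \<Longrightarrow> g \<otimes> k = \<zero>) \<Longrightarrow> g = \<zero>"
begin

lemma J_D [simp]: "j \<in> J \<Longrightarrow> j \<in> D" and K_D [simp]: "k \<in> K \<Longrightarrow> k \<in> D"
  using J_subset K_subset by auto

lemma D_cancel:
  assumes "d \<in> D" "d' \<in> D" "\<And>j. j \<in> J \<Longrightarrow> d \<otimes> j = d' \<otimes> j" "\<And>k. k \<in> K \<Longrightarrow> d \<otimes> k = d' \<otimes> k"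
  shows "d = d'"
proof -
  have *: "(d \<ominus> d') \<otimes> h = \<zero>" if "h \<in> D" "d \<otimes> h = d' \<otimes> h" for h
  proof -
    have "(d \<ominus> d') \<otimes> h = d \<otimes> h \<ominus> d' \<otimes> h"
      using D_carrier[OF assms(1)] D_carrier[OF assms(2)] D_carrier[OF that(1)] by algebra
    then show ?thesis
      using that assms(1,2) by simp
  qed
  have "d \<ominus> d' = \<zero>"
    by (rule no_annihilator; (rule *)?; (rule assms)?) (simp_all add: assms(1,2))
  then show ?thesis
    using assms(1,2) by (simp add: diff_eq_zero_iff)
qed

text \<open>\<open>represents x d\<close> says that \<open>x\<close> agrees with \<open>(\<iota> d, \<iota> d)\<close> modulo the annihilators of \<open>J\<close>
  (first coordinate) and of \<open>K\<close> (second coordinate).\<close>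

definition represents :: "'i \<times> 'i \<Rightarrow> 'c \<Rightarrow> bool" where
  "represents x d \<longleftrightarrow> fst x \<in> carrier A \<and> snd x \<in> carrier A \<and> d \<in> D \<and>
    (\<forall>j\<in>J. fst x \<otimes>\<^bsub>A\<^esub> \<iota> j = \<iota> (d \<otimes> j)) \<and> (\<forall>k\<in>K. snd x \<otimes>\<^bsub>A\<^esub> \<iota> k = \<iota> (d \<otimes> k))"

abbreviation AA where "AA \<equiv> cstar_prod A A"

lemma AA_embedding: "cstar_embedding A A AA fst snd"
  by (rule cstar_prod_embedding) unfold_locales

interpretation AA: cstar_algebra AA
  by (rule cstar_embedding.cstar_algebra_X[OF AA_embedding])

lemma AA_simps [simp]:
  "x \<in> carrier AA \<longleftrightarrow> fst x \<in> carrier A \<and> snd x \<in> carrier A"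
  "x \<oplus>\<^bsub>AA\<^esub> y = (fst x \<oplus>\<^bsub>A\<^esub> fst y, snd x \<oplus>\<^bsub>A\<^esub> snd y)"
  "x \<otimes>\<^bsub>AA\<^esub> y = (fst x \<otimes>\<^bsub>A\<^esub> fst y, snd x \<otimes>\<^bsub>A\<^esub> snd y)"
  "c \<odot>\<^bsub>AA\<^esub> x = (c \<odot>\<^bsub>A\<^esub> fst x, c \<odot>\<^bsub>A\<^esub> snd x)"
  "x\<^sup>\<star>\<^bsub>AA\<^esub> = ((fst x)\<^sup>\<star>\<^bsub>A\<^esub>, (snd x)\<^sup>\<star>\<^bsub>A\<^esub>)"
  "\<one>\<^bsub>AA\<^esub> = (\<one>\<^bsub>A\<^esub>, \<one>\<^bsub>A\<^esub>)" "\<zero>\<^bsub>AA\<^esub> = (\<zero>\<^bsub>A\<^esub>, \<zero>\<^bsub>A\<^esub>)"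
  by (auto simp: cstar_prod_def mem_Times_iff)

lemma represents_unique: "represents x d \<Longrightarrow> represents x d' \<Longrightarrow> d = d'"
  by (rule D_cancel) (auto simp: represents_def iota_eq_iff simp del: iota_simps(3))

lemma represents_add:
  "represents x d \<Longrightarrow> represents y e \<Longrightarrow> represents (x \<oplus>\<^bsub>AA\<^esub> y) (d \<oplus> e)"
  by (auto simp: represents_def A.l_distr)

lemma represents_smult: "represents x d \<Longrightarrow> represents (c \<odot>\<^bsub>AA\<^esub> x) (c \<odot> d)"
  by (auto simp: represents_def A.smult_mult_left)

lemma represents_star: 
  assumes x: "represents x d"
  shows "represents (x\<^sup>\<star>\<^bsub>AA\<^esub>) (d\<^sup>\<star>)"
proof -
  \<comment> \<open>The difference of a and \<iota> d annihilates \<iota> h; in an abelian algebra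
    its adjoint does so too.\<close>
  have key: "a\<^sup>\<star>\<^bsub>A\<^esub> \<otimes>\<^bsub>A\<^esub> \<iota> h = (\<iota> d)\<^sup>\<star>\<^bsub>A\<^esub> \<otimes>\<^bsub>A\<^esub> \<iota> h"
    if a: "a \<in> carrier A" and d: "d \<in> D" and h: "h \<in> D" and eq: "a \<otimes>\<^bsub>A\<^esub> \<iota> h = \<iota> d \<otimes>\<^bsub>A\<^esub> \<iota> h" for a h
  proof -
    have dist: "(u \<ominus>\<^bsub>A\<^esub> v) \<otimes>\<^bsub>A\<^esub> \<iota> h = u \<otimes>\<^bsub>A\<^esub> \<iota> h \<ominus>\<^bsub>A\<^esub> v \<otimes>\<^bsub>A\<^esub> \<iota> h"
      if "u \<in> carrier A" "v \<in> carrier A" for u v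
      using that h by (simp add: A.minus_eq A.l_distr A.l_minus)
    have "(a \<ominus>\<^bsub>A\<^esub> \<iota> d) \<otimes>\<^bsub>A\<^esub> \<iota> h = \<zero>\<^bsub>A\<^esub>"
      using a d h eq by (simp add: dist)
    then have "(a \<ominus>\<^bsub>A\<^esub> \<iota> d)\<^sup>\<star>\<^bsub>A\<^esub> \<otimes>\<^bsub>A\<^esub> \<iota> h = \<zero>\<^bsub>A\<^esub>"
      using a d h by (intro A.star_mult_zero) auto
    then have "a\<^sup>\<star>\<^bsub>A\<^esub> \<otimes>\<^bsub>A\<^esub> \<iota> h \<ominus>\<^bsub>A\<^esub> (\<iota> d)\<^sup>\<star>\<^bsub>A\<^esub> \<otimes>\<^bsub>A\<^esub> \<iota> h = \<zero>\<^bsub>A\<^esub>"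
      using a d h by (simp add: A.star_diff dist)
    then show ?thesis
      using a d h by (simp add: A.diff_eq_zero_iff)
  qed
  have d: "d \<in> D" "fst x \<in> carrier A" "snd x \<in> carrier A"
    using x by (simp_all add: represents_def)
  show ?thesis
    unfolding represents_def
  proof (intro conjI ballI)
    show "fst (x\<^sup>\<star>\<^bsub>AA\<^esub>) \<otimes>\<^bsub>A\<^esub> \<iota> j = \<iota> (d\<^sup>\<star> \<otimes> j)" if "j \<in> J" for j
      using key[of "fst x" j] x d that by (simp add: represents_def)
    show "snd (x\<^sup>\<star>\<^bsub>AA\<^esub>) \<otimes>\<^bsub>A\<^esub> \<iota> k = \<iota> (d\<^sup>\<star> \<otimes> k)" if "k \<in> K" for k
      using key[of "snd x" k] x d that by (simp add: represents_def)
  qed (use d in simp_all)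
qed

lemma represents_iota: "d \<in> D \<Longrightarrow> represents (\<iota> d, \<iota> d) d"
  by (simp add: represents_def)

text \<open>An extension of \<open>retract\<close> sends this diagonal pair to 0; rigidity sends it
  to a. This is how the absence of annihilators passes from \<open>D\<close> to
  \<open>A\<close>.\<close>

lemma represents_annihilator:
  "a \<in> carrier A \<Longrightarrow> (\<And>j. j \<in> J \<Longrightarrow> a \<otimes>\<^bsub>A\<^esub> \<iota> j = \<zero>\<^bsub>A\<^esub>) \<Longrightarrow> (\<And>k. k \<in> K \<Longrightarrow> a \<otimes>\<^bsub>A\<^esub> \<iota> k = \<zero>\<^bsub>A\<^esub>) \<Longrightarrow>
    represents (a, a) \<zero>"
  by (simp add: represents_def)

lemma iota_JK: "j \<in> J \<Longrightarrow> k \<in> K \<Longrightarrow> \<iota> j \<otimes>\<^bsub>A\<^esub> \<iota> k = \<zero>\<^bsub>A\<^esub>"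
  using JK[of j k] iota_simps(3)[of j k] by simp

text \<open>Together with \<open>represents_K\<close> this determines the values at (\<iota> h, 0),
  that is, the products of P with \<iota> h for h in J and in K.\<close>

lemma represents_J: "j \<in> J \<Longrightarrow> represents (\<iota> j, \<zero>\<^bsub>A\<^esub>) j"
  by (simp add: represents_def iota_JK)

lemma represents_K: "k \<in> K \<Longrightarrow> represents (\<iota> k, \<zero>\<^bsub>A\<^esub>) \<zero>"
  by (simp add: represents_def iota_JK A.m_comm[of "\<iota> k"])

definition retract :: "'i \<times> 'i \<Rightarrow> 'i" where
  "retract x = \<iota> (THE d. represents x d)"

lemma retract_eq: "represents x d \<Longrightarrow> retract x = \<iota> d"
  unfolding retract_def by (metis represents_unique the_equality)

text \<open>M is tied to a matrix N over \<open>D\<close> only after multiplication by h, and a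
  factor h in every entry of the column supplies that multiplication. Up to the positive factor
  \<open>h\<^sup>\<star> h\<close> the form of M is the form of N, which lets positivity pass from
  \<open>A\<close> to \<open>D\<close>.\<close>

lemma form_of_represented:
  assumes N: "entries_in sub n N" and M: "entries_in A n M" and \<xi>: "col sub n \<xi>" and h: "h \<in> D"
    and MN: "\<And>i k. i < n \<Longrightarrow> k < n \<Longrightarrow> M i k \<otimes>\<^bsub>A\<^esub> \<iota> h = \<iota> (N i k \<otimes> h)"
  defines "\<eta> \<equiv> \<lambda>i. \<iota> (\<xi> i \<otimes> h)"
  shows "ip A n \<eta> (mat_vec A n M \<eta>) = \<iota> (ip sub n \<xi> (mat_vec sub n N \<xi>) \<otimes> (h\<^sup>\<star> \<otimes> h))"
proof -
  have Nc [simp]: "N i k \<in> D" and Mc [simp]: "M i k \<in> carrier A" if "i < n" "k < n" for i k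
    using sub.entries_inD[OF N that] A.entries_inD[OF M that] by simp_all
  have xc [simp]: "\<xi> k \<in> D" if "k < n" for k
    using sub.colD[OF \<xi> that] by simp
  have mv: "mat_vec A n M \<eta> i = \<iota> (mat_vec sub n N \<xi> i) \<otimes>\<^bsub>A\<^esub> \<iota> h" if i: "i < n" for i
  proof -
    have "M i k \<otimes>\<^bsub>A\<^esub> \<eta> k = \<iota> (N i k \<otimes> \<xi> k) \<otimes>\<^bsub>A\<^esub> \<iota> h" if k: "k < n" for k
    proof -
      have "M i k \<otimes>\<^bsub>A\<^esub> \<eta> k = (M i k \<otimes>\<^bsub>A\<^esub> \<iota> h) \<otimes>\<^bsub>A\<^esub> \<iota> (\<xi> k)"
        using i k h by (simp add: \<eta>_def A.m_ac)
      also have "\<dots> = \<iota> (N i k \<otimes> h) \<otimes>\<^bsub>A\<^esub> \<iota> (\<xi> k)"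
        by (simp only: MN[OF i k])
      finally show ?thesis
        using i k h by (simp add: A.m_ac)
    qed
    then have "mat_vec A n M \<eta> i = vsum A (\<lambda>k. \<iota> (N i k \<otimes> \<xi> k) \<otimes>\<^bsub>A\<^esub> \<iota> h) n"
      unfolding mat_vec_def by (intro vsum_cong)
    also have "\<dots> = vsum A (\<lambda>k. \<iota> (N i k \<otimes> \<xi> k)) n \<otimes>\<^bsub>A\<^esub> \<iota> h"
      using i h by (intro A.vsum_mult_right[symmetric]) auto
    also have "vsum A (\<lambda>k. \<iota> (N i k \<otimes> \<xi> k)) n = \<iota> (mat_vec sub n N \<xi> i)"
      unfolding mat_vec_def using i by (subst iota.hom_vsum) auto
    finally show ?thesis .
  qed
  have mvD: "mat_vec sub n N \<xi> i \<in> D" if "i < n" for i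
    using sub.colD[OF sub.mat_vec_col[OF N \<xi>] that] by simp
  have hh: "h\<^sup>\<star> \<otimes> h \<in> D"
    using h by simp
  have "(\<eta> i)\<^sup>\<star>\<^bsub>A\<^esub> \<otimes>\<^bsub>A\<^esub> mat_vec A n M \<eta> i = \<iota> ((\<xi> i)\<^sup>\<star> \<otimes> mat_vec sub n N \<xi> i) \<otimes>\<^bsub>A\<^esub> \<iota> (h\<^sup>\<star> \<otimes> h)" if "i < n" for i
    using that h mvD[OF that] by (simp add: mv) (simp add: \<eta>_def A.star_mult A.m_ac)
  then have "ip A n \<eta> (mat_vec A n M \<eta>) = vsum A (\<lambda>i. \<iota> ((\<xi> i)\<^sup>\<star> \<otimes> mat_vec sub n N \<xi> i) \<otimes>\<^bsub>A\<^esub> \<iota> (h\<^sup>\<star> \<otimes> h)) n"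
    unfolding ip_def by (intro vsum_cong)
  also have "\<dots> = vsum A (\<lambda>i. \<iota> ((\<xi> i)\<^sup>\<star> \<otimes> mat_vec sub n N \<xi> i)) n \<otimes>\<^bsub>A\<^esub> \<iota> (h\<^sup>\<star> \<otimes> h)"
    using hh mvD by (intro A.vsum_mult_right[symmetric]) auto
  also have "vsum A (\<lambda>i. \<iota> ((\<xi> i)\<^sup>\<star> \<otimes> mat_vec sub n N \<xi> i)) n = \<iota> (ip sub n \<xi> (mat_vec sub n N \<xi>))"
    unfolding ip_def using mvD by (subst iota.hom_vsum) auto
  also have "\<dots> \<otimes>\<^bsub>A\<^esub> \<iota> (h\<^sup>\<star> \<otimes> h) = \<iota> (ip sub n \<xi> (mat_vec sub n N \<xi>) \<otimes> (h\<^sup>\<star> \<otimes> h))"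
    using hh sub.ip_closed[OF \<xi> sub.mat_vec_col[OF N \<xi>]] iota_simps(3) by simp
  finally show ?thesis .
qed

text \<open>The representing matrix N over \<open>D\<close> has a nonnegative form by
  \<open>in_squares_by_test\<close> with test set J and K together: for h in J the matrix of first
  coordinates of M is used, for h in K that of second coordinates, both positive over
  \<open>A\<close>. Then N is a Gram matrix over \<open>D\<close>, and \<iota> preserves such
  matrices.\<close>

lemma retract_positive:
  assumes M: "M \<in> positive_elements (matrix_algebra n AA)" and S: "\<forall>i<n. \<forall>j<n. \<exists>d. represents (M i j) d"
  shows "amplify retract M \<in> positive_elements (matrix_algebra n A)"
proof -
  obtain Y where Y: "entries_in AA n Y" "\<And>i j. i < n \<Longrightarrow> j < n \<Longrightarrow> M i j = mat_mult AA n (mat_adj AA Y) Y i j"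
    and M0: "\<And>i j. \<not> (i < n \<and> j < n) \<Longrightarrow> M i j = \<zero>\<^bsub>AA\<^esub>"
    using M unfolding AA.positive_matrix_iff by blast
  define N where "N i j = (if i < n \<and> j < n then SOME d. represents (M i j) d else \<zero>)" for i j
  have N: "represents (M i j) (N i j)" if "i < n" "j < n" for i j
    using S that by (auto simp: N_def intro: someI_ex)
  have E: "entries_in sub n N"
    using N by (auto simp: entries_in_def represents_def)
  have herm: "(N j i)\<^sup>\<star> = N i j" if "i < n" "j < n" for i j
    using represents_star[OF N[OF that(2,1)]] N[OF that] AA.gram_hermitian[OF Y(1) that] Y(2) that
    by (intro represents_unique[of "M i j"]) auto
  interpret p: cstar_morphism AA A fst
    by (unfold_locales, rule cstar_homI) auto
  interpret q: cstar_morphism AA A snd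
    by (unfold_locales, rule cstar_homI) auto
  have form: "ip A n \<eta> (mat_vec A n (amplify f M) \<eta>) \<in> squares A"
    if f: "amplify f M \<in> positive_elements (matrix_algebra n A)" and \<eta>: "col A n \<eta>" for f \<eta>
    using f \<eta> unfolding A.positive_matrix_iff by (blast intro: A.ip_gram_in_squares)
  have "form_nonneg sub n N"
    unfolding form_nonneg_def
  proof (intro allI impI)
    fix \<xi> assume \<xi>: "col sub n \<xi>"
    let ?x = "ip sub n \<xi> (mat_vec sub n N \<xi>)"
    have xD: "?x \<in> D"
      using sub.ip_closed[OF \<xi> sub.mat_vec_col[OF E \<xi>]] by simp
    have "mat_vec sub n (mat_adj sub N) \<xi> i = mat_vec sub n N \<xi> i" if "i < n" for i
      using herm that by (intro sub.mat_vec_cong) (simp add: mat_adj_def)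
    then have "?x = ip sub n \<xi> (mat_vec sub n (mat_adj sub N) \<xi>)"
      by (intro ip_cong) auto
    also have "\<dots> = ip sub n (mat_vec sub n N \<xi>) \<xi>"
      using E \<xi> by (intro sub.ip_mat_vec_left[symmetric])
    finally have x: "?x \<in> selfadjoint_elements sub"
      using sub.ip_star[OF \<xi> sub.mat_vec_col[OF E \<xi>]] xD by (intro sub.selfadjointI) auto
    have col: "col A n (\<lambda>i. \<iota> (\<xi> i \<otimes> h))" if "h \<in> D" for h
      using \<xi> that by (simp add: col_def)
    have J: "\<iota> (?x \<otimes> (h\<^sup>\<star> \<otimes> h)) \<in> squares A" if h: "h \<in> J" for h
    proof (subst form_of_represented[symmetric, OF E _ \<xi>])
      show "entries_in A n (amplify fst M)"
        using N unfolding entries_in_def amplify_def represents_def by blast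
      show "amplify fst M i k \<otimes>\<^bsub>A\<^esub> \<iota> h = \<iota> (N i k \<otimes> h)" if "i < n" "k < n" for i k
        using N[OF that] h unfolding amplify_def represents_def by blast
      show "ip A n (\<lambda>i. \<iota> (\<xi> i \<otimes> h)) (mat_vec A n (amplify fst M) (\<lambda>i. \<iota> (\<xi> i \<otimes> h))) \<in> squares A"
        using h by (intro form p.hom_positive_matrix M col) simp
    qed (use h in simp)
    have K: "\<iota> (?x \<otimes> (h\<^sup>\<star> \<otimes> h)) \<in> squares A" if h: "h \<in> K" for h
    proof (subst form_of_represented[symmetric, OF E _ \<xi>])
      show "entries_in A n (amplify snd M)"
        using N unfolding entries_in_def amplify_def represents_def by blast
      show "amplify snd M i k \<otimes>\<^bsub>A\<^esub> \<iota> h = \<iota> (N i k \<otimes> h)" if "i < n" "k < n" for i k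
        using N[OF that] h unfolding amplify_def represents_def by blast
      show "ip A n (\<lambda>i. \<iota> (\<xi> i \<otimes> h)) (mat_vec A n (amplify snd M) (\<lambda>i. \<iota> (\<xi> i \<otimes> h))) \<in> squares A"
        using h by (intro form q.hom_positive_matrix M col) simp
    qed (use h in simp)
    show "?x \<in> squares sub"
    proof (rule sub.in_squares_by_test[OF x])
      show "J \<union> K \<subseteq> carrier sub"
        using J_subset K_subset by simp
      show "?x \<otimes>\<^bsub>sub\<^esub> (h\<^sup>\<star>\<^bsub>sub\<^esub> \<otimes>\<^bsub>sub\<^esub> h) \<in> squares sub" if h: "h \<in> J \<union> K" for h
      proof (rule iota_reflects_squares)
        have hD: "h \<in> D"
          using h by auto
        have "(?x \<otimes> (h\<^sup>\<star> \<otimes> h))\<^sup>\<star> = ?x \<otimes> (h\<^sup>\<star> \<otimes> h)"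
          using x xD hD D_comm[of ?x "h\<^sup>\<star> \<otimes> h"] by (simp add: star_mult sub_selfadjoint_iff)
        then show "?x \<otimes>\<^bsub>sub\<^esub> (h\<^sup>\<star>\<^bsub>sub\<^esub> \<otimes>\<^bsub>sub\<^esub> h) \<in> selfadjoint_elements sub"
          using xD hD by (intro sub.selfadjointI) auto
        show "\<iota> (?x \<otimes>\<^bsub>sub\<^esub> (h\<^sup>\<star>\<^bsub>sub\<^esub> \<otimes>\<^bsub>sub\<^esub> h)) \<in> squares A"
          using J K h by auto
      qed
      show "a = \<zero>\<^bsub>sub\<^esub>" if "a \<in> carrier sub" "\<And>h. h \<in> J \<union> K \<Longrightarrow> a \<otimes>\<^bsub>sub\<^esub> h = \<zero>\<^bsub>sub\<^esub>" for a
        using that no_annihilator[of a] by simp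
    qed
  qed
  then have "\<exists>Z. entries_in sub n Z \<and> (\<forall>i<n. \<forall>j<n. N i j = mat_mult sub n (mat_adj sub Z) Z i j)"
    using E herm by (intro sub.gram_decomposition) auto
  then have "N \<in> positive_elements (matrix_algebra n sub)"
    unfolding sub.positive_matrix_iff by (auto simp: N_def)
  then have "amplify \<iota> N \<in> positive_elements (matrix_algebra n A)"
    by (rule iota.hom_positive_matrix)
  moreover have "amplify \<iota> N = amplify retract M"
  proof (intro ext)
    fix i j
    show "amplify \<iota> N i j = amplify retract M i j"
    proof (cases "i < n \<and> j < n")
      case True
      then show ?thesis
        using retract_eq[OF N] by (simp add: amplify_def)
    next
      case False
      then have "M i j = (\<zero>\<^bsub>A\<^esub>, \<zero>\<^bsub>A\<^esub>)" "N i j = \<zero>"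
        using M0 by (auto simp: N_def)
      then show ?thesis
        using retract_eq[OF represents_annihilator[of "\<zero>\<^bsub>A\<^esub>"]] by (simp add: amplify_def)
    qed
  qed
  ultimately show ?thesis
    by simp
qed

lemma retract_ucp:
  "operator_system AA {x. \<exists>d. represents x d}" "ucp AA {x. \<exists>d. represents x d} A retract"
proof -
  have one: "represents \<one>\<^bsub>AA\<^esub> \<one>"
    using represents_iota[of \<one>] by simp
  show "operator_system AA {x. \<exists>d. represents x d}"
    unfolding AA.operator_system_iff
  proof (intro conjI ballI allI)
    show "{x. \<exists>d. represents x d} \<subseteq> carrier AA"
      by (auto simp: represents_def)
    show "\<one>\<^bsub>AA\<^esub> \<in> {x. \<exists>d. represents x d}"
      using one by blast
  qed (use represents_add represents_smult represents_star in blast)+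
  show "ucp AA {x. \<exists>d. represents x d} A retract"
    unfolding ucp_def
  proof (intro conjI ballI allI impI)
    show "retract \<in> {x. \<exists>d. represents x d} \<rightarrow> carrier A"
    proof
      fix x assume "x \<in> {x. \<exists>d. represents x d}"
      then obtain d where d: "represents x d" by blast
      then show "retract x \<in> carrier A"
        using retract_eq[OF d] by (simp add: represents_def)
    qed
    show "retract \<one>\<^bsub>AA\<^esub> = \<one>\<^bsub>A\<^esub>"
      using retract_eq[OF one] by simp
  next
    fix x y assume "x \<in> {x. \<exists>d. represents x d}" "y \<in> {x. \<exists>d. represents x d}"
    then obtain d e where de: "represents x d" "represents y e" by blast
    then have "d \<in> D" "e \<in> D"
      by (auto simp: represents_def)
    then show "retract (x \<oplus>\<^bsub>AA\<^esub> y) = retract x \<oplus>\<^bsub>A\<^esub> retract y"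
      using retract_eq[OF represents_add[OF de]] retract_eq[OF de(1)] retract_eq[OF de(2)] by simp
  next
    fix c x assume "x \<in> {x. \<exists>d. represents x d}"
    then obtain d where d: "represents x d" by blast
    then have "d \<in> D"
      by (auto simp: represents_def)
    then show "retract (c \<odot>\<^bsub>AA\<^esub> x) = c \<odot>\<^bsub>A\<^esub> retract x"
      using retract_eq[OF represents_smult[OF d]] retract_eq[OF d] by simp
  next
    fix n M assume "M \<in> positive_elements (matrix_algebra n AA)" "\<forall>i<n. \<forall>j<n. M i j \<in> {x. \<exists>d. represents x d}"
    then show "amplify retract M \<in> positive_elements (matrix_algebra n A)"
      by (intro retract_positive) auto
  qed
qed

lemma rigid_injective_split:
  fixes f :: "'i \<times> 'i \<Rightarrow> 'u"
  assumes inj: "injective_cstar TYPE('u) A" and rigid: "rigid_extension sub A \<iota>" and f: "inj f"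
  shows "(\<forall>a\<in>carrier A. (\<forall>j\<in>J. a \<otimes>\<^bsub>A\<^esub> \<iota> j = \<zero>\<^bsub>A\<^esub>) \<and> (\<forall>k\<in>K. a \<otimes>\<^bsub>A\<^esub> \<iota> k = \<zero>\<^bsub>A\<^esub>) \<longrightarrow> a = \<zero>\<^bsub>A\<^esub>) \<and>
    (\<exists>P\<in>squares A. (\<forall>j\<in>J. P \<otimes>\<^bsub>A\<^esub> \<iota> j = \<iota> j) \<and> (\<forall>k\<in>K. P \<otimes>\<^bsub>A\<^esub> \<iota> k = \<zero>\<^bsub>A\<^esub>))"
proof -
  have "inj_on f (carrier AA)"
    using f by (rule inj_on_subset) simp
  from injective_cstar_extend[OF inj AA.cstar_algebra_axioms this retract_ucp]
  obtain \<psi> where \<psi>1: "ucp AA (carrier AA) A \<psi>"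
    and ext: "\<forall>x\<in>{x. \<exists>d. represents x d}. \<psi> x = retract x"
    by blast
  have \<psi>2: "\<psi> x = \<iota> d" if "represents x d" for x d
  proof -
    have "\<psi> x = retract x"
      using ext that by blast
    then show ?thesis
      by (simp only: retract_eq[OF that])
  qed
  note \<psi> = \<psi>1 \<psi>2
  interpret \<psi>: ucp_map AA A \<psi>
    by unfold_locales (rule \<psi>1)
  interpret diag: cstar_morphism A AA "\<lambda>a. (a, a)"
    by (unfold_locales, rule cstar_homI) auto
  have "ucp A (carrier A) A (\<lambda>a. \<psi> (a, a)) \<and> (\<forall>d\<in>carrier sub. \<psi> (\<iota> d, \<iota> d) = \<iota> d)"
    using diag.ucp_comp_hom[OF \<psi>1] \<psi>2[OF represents_iota] by simp
  with rigid[unfolded rigid_extension_def, THEN spec, of "\<lambda>a. \<psi> (a, a)"]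
  have diag: "\<psi> (a, a) = a" if "a \<in> carrier A" for a
    using that by blast
  define P where "P = \<psi> (\<one>\<^bsub>A\<^esub>, \<zero>\<^bsub>A\<^esub>)"
  have P: "P \<in> squares A"
    using \<psi>.map_square[of "(\<one>\<^bsub>A\<^esub>, \<zero>\<^bsub>A\<^esub>)"] by (simp add: P_def)
  \<comment> \<open>Since \<psi> is the identity on the diagonal, the pair (\<iota> h, \<iota> h)
    lies in its multiplicative domain and can be pulled out of \<psi> (\<iota> h, 0).\<close>
  have mult: "P \<otimes>\<^bsub>A\<^esub> \<iota> h = \<psi> (\<iota> h, \<zero>\<^bsub>A\<^esub>)" if "h \<in> D" for h
  proof -
    let ?s = "(\<iota> h, \<iota> h)" and ?e = "(\<one>\<^bsub>A\<^esub>, \<zero>\<^bsub>A\<^esub>)"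
    have c: "\<iota> h \<in> carrier A" "(\<iota> h)\<^sup>\<star>\<^bsub>A\<^esub> \<otimes>\<^bsub>A\<^esub> \<iota> h \<in> carrier A"
      using that by simp_all
    have sc: "?s \<in> carrier AA" and ec: "?e \<in> carrier AA"
      using c(1) by simp_all
    have eq: "\<psi> (?s\<^sup>\<star>\<^bsub>AA\<^esub> \<otimes>\<^bsub>AA\<^esub> ?s) = (\<psi> ?s)\<^sup>\<star>\<^bsub>A\<^esub> \<otimes>\<^bsub>A\<^esub> \<psi> ?s"
      by (simp only: AA_simps fst_conv snd_conv diag[OF c(1)] diag[OF c(2)])
    have "\<psi> (?e \<otimes>\<^bsub>AA\<^esub> ?s) = \<psi> ?e \<otimes>\<^bsub>A\<^esub> \<psi> ?s"
      by (rule \<psi>.map_multiplicative_domain[OF sc eq ec])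
    then show ?thesis
      using c by (simp only: P_def diag[OF c(1)] AA_simps fst_conv snd_conv A.l_one A.l_null)
  qed
  have "P \<otimes>\<^bsub>A\<^esub> \<iota> j = \<iota> j" if "j \<in> J" for j
    using mult[of j] \<psi>(2)[OF represents_J[OF that]] that by simp
  moreover have "P \<otimes>\<^bsub>A\<^esub> \<iota> k = \<zero>\<^bsub>A\<^esub>" if "k \<in> K" for k
    using mult[of k] \<psi>(2)[OF represents_K[OF that]] that by simp
  moreover have "a = \<zero>\<^bsub>A\<^esub>" if "a \<in> carrier A"
    "\<forall>j\<in>J. a \<otimes>\<^bsub>A\<^esub> \<iota> j = \<zero>\<^bsub>A\<^esub>" "\<forall>k\<in>K. a \<otimes>\<^bsub>A\<^esub> \<iota> k = \<zero>\<^bsub>A\<^esub>" for a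
    using that diag[of a] \<psi>(2)[OF represents_annihilator[of a]] by simp
  ultimately show ?thesis
    using P by blast
qed

text \<open>P is an upper bound because P - \<iota> h = P (1 - \<iota> h). For leastness, q - P is
  tested against J and K. On K only q remains. On J, the elements 1 - (1 - g)^n with g a multiple of
  \<open>h\<^sup>\<star> h\<close> stay in the ball and act on g as an approximate unit, so that q
  \<iota> g \<ge> \<iota> g = P \<iota> g.\<close>

lemma is_sup_positive_ball:
  assumes ideal: "\<And>d j. d \<in> D \<Longrightarrow> j \<in> J \<Longrightarrow> d \<otimes> j \<in> J" "\<zero> \<in> J"
    and ess: "\<And>a. a \<in> carrier A \<Longrightarrow> (\<And>j. j \<in> J \<Longrightarrow> a \<otimes>\<^bsub>A\<^esub> \<iota> j = \<zero>\<^bsub>A\<^esub>) \<Longrightarrow>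
      (\<And>k. k \<in> K \<Longrightarrow> a \<otimes>\<^bsub>A\<^esub> \<iota> k = \<zero>\<^bsub>A\<^esub>) \<Longrightarrow> a = \<zero>\<^bsub>A\<^esub>"
    and P: "P \<in> squares A" "\<And>j. j \<in> J \<Longrightarrow> P \<otimes>\<^bsub>A\<^esub> \<iota> j = \<iota> j" "\<And>k. k \<in> K \<Longrightarrow> P \<otimes>\<^bsub>A\<^esub> \<iota> k = \<zero>\<^bsub>A\<^esub>"
  shows "is_sup A (\<iota> ` {h \<in> J. h \<in> positive_elements sub \<and> nrm C h \<le> 1}) P"
  unfolding is_sup_def cstar_le_def A.positive_elements_eq_squares sub.positive_elements_eq_squares
proof (intro conjI ballI impI)
  have Pc [simp]: "P \<in> carrier A"
    using P by simp
  show "P \<in> selfadjoint_elements A"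
    using P by simp
  fix y assume "y \<in> \<iota> ` {h \<in> J. h \<in> squares sub \<and> nrm C h \<le> 1}"
  then obtain h where h: "y = \<iota> h" "h \<in> J" "h \<in> squares sub" "nrm C h \<le> 1"
    by blast
  have "\<one> \<ominus>\<^bsub>sub\<^esub> h \<in> squares sub"
    using sub.one_minus_in_squares[of h] sub.squares_selfadjoint[OF h(3)] h(4) by simp
  then have "\<iota> (\<one> \<ominus> h) \<in> squares A"
    using h by (simp add: sub_diff iota_squares del: iota_simps)
  then have "P \<otimes>\<^bsub>A\<^esub> (\<one>\<^bsub>A\<^esub> \<ominus>\<^bsub>A\<^esub> \<iota> h) \<in> squares A"
    using P h by (intro A.squares_mult) auto
  moreover have "P \<otimes>\<^bsub>A\<^esub> (\<one>\<^bsub>A\<^esub> \<ominus>\<^bsub>A\<^esub> \<iota> h) = P \<ominus>\<^bsub>A\<^esub> P \<otimes>\<^bsub>A\<^esub> \<iota> h"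
    using h by (simp add: A.minus_eq A.r_distr A.r_minus)
  ultimately show "P \<ominus>\<^bsub>A\<^esub> y \<in> squares A"
    using P h by simp
next
  have Pc [simp]: "P \<in> carrier A"
    using P by simp
  fix q assume q: "q \<in> selfadjoint_elements A"
    and ub: "\<forall>x\<in>\<iota> ` {h \<in> J. h \<in> squares sub \<and> nrm C h \<le> 1}. q \<ominus>\<^bsub>A\<^esub> x \<in> squares A"
  have qc [simp]: "q \<in> carrier A"
    using q by simp
  have ub': "q \<ominus>\<^bsub>A\<^esub> \<iota> h \<in> squares A" if "h \<in> J" "h \<in> squares sub" "nrm C h \<le> 1" for h
    using ub that by blast
  \<comment> \<open>The zero element of J belongs to the ball, so every upper bound is
    positive.\<close>
  have qS: "q \<in> squares A"
    using ub'[of \<zero>] ideal(2) sub.squares_zero by (simp add: A.minus_eq)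
  have dist: "(x \<ominus>\<^bsub>A\<^esub> y) \<otimes>\<^bsub>A\<^esub> z = x \<otimes>\<^bsub>A\<^esub> z \<ominus>\<^bsub>A\<^esub> y \<otimes>\<^bsub>A\<^esub> z"
    if "x \<in> carrier A" "y \<in> carrier A" "z \<in> carrier A" for x y z
    using that by (simp add: A.minus_eq A.l_distr A.l_minus)
  show "q \<ominus>\<^bsub>A\<^esub> P \<in> squares A"
  proof (rule A.in_squares_by_test)
    show "q \<ominus>\<^bsub>A\<^esub> P \<in> selfadjoint_elements A"
      using q P by (intro A.selfadjoint_diff) auto
    show "\<iota> ` (J \<union> K) \<subseteq> carrier A"
      by auto
    show "a = \<zero>\<^bsub>A\<^esub>" if "a \<in> carrier A" "\<And>h. h \<in> \<iota> ` (J \<union> K) \<Longrightarrow> a \<otimes>\<^bsub>A\<^esub> h = \<zero>\<^bsub>A\<^esub>" for a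
      by (rule ess[OF that(1)]; rule that(2)) auto
    fix h' assume "h' \<in> \<iota> ` (J \<union> K)"
    then obtain h where h: "h' = \<iota> h" "h \<in> J \<union> K" "h \<in> D"
      by auto
    let ?g = "(\<iota> h)\<^sup>\<star>\<^bsub>A\<^esub> \<otimes>\<^bsub>A\<^esub> \<iota> h"
    have gS: "?g \<in> squares A"
      using h by (intro A.star_mult_in_squares) simp
    have eq: "(q \<ominus>\<^bsub>A\<^esub> P) \<otimes>\<^bsub>A\<^esub> ?g = q \<otimes>\<^bsub>A\<^esub> ?g \<ominus>\<^bsub>A\<^esub> (\<iota> h)\<^sup>\<star>\<^bsub>A\<^esub> \<otimes>\<^bsub>A\<^esub> (P \<otimes>\<^bsub>A\<^esub> \<iota> h)"
    proof -
      have "\<iota> h \<in> carrier A" "(\<iota> h)\<^sup>\<star>\<^bsub>A\<^esub> \<in> carrier A"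
        using h by simp_all
      then show ?thesis
        using qc Pc by algebra
    qed
    show "(q \<ominus>\<^bsub>A\<^esub> P) \<otimes>\<^bsub>A\<^esub> (h'\<^sup>\<star>\<^bsub>A\<^esub> \<otimes>\<^bsub>A\<^esub> h') \<in> squares A"
    proof (cases "h \<in> K")
      case True
      then have "(q \<ominus>\<^bsub>A\<^esub> P) \<otimes>\<^bsub>A\<^esub> ?g = q \<otimes>\<^bsub>A\<^esub> ?g"
        unfolding eq using h P by (simp add: A.minus_eq)
      then show ?thesis
        using h qS gS by (simp add: A.squares_mult)
    next
      case False
      then have hJ: "h \<in> J"
        using h by blast
      \<comment> \<open>The factor brings g into the range 0 \<le> g \<le> 1 in which the powers of
        1 - g are controlled; the summand 1 covers h = 0.\<close>
      define c where "c = 1 / ((nrm C h)\<^sup>2 + 1)"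
      have c: "0 < c" "c * (nrm C h)\<^sup>2 \<le> 1"
        by (auto simp: c_def add_nonneg_pos)
      define g where "g = complex_of_real c \<odot> (h\<^sup>\<star> \<otimes> h)"
      have gD [simp]: "g \<in> D"
        using h by (simp add: g_def)
      have g1: "g \<in> squares sub"
        using sub.squares_smult[OF sub.star_mult_in_squares[of h], of c] c h by (simp add: g_def)
      have "nrm C g \<le> 1"
        using c h by (simp add: g_def nrm_smult cstar_identity)
      then have g2: "\<one>\<^bsub>sub\<^esub> \<ominus>\<^bsub>sub\<^esub> g \<in> squares sub"
        using sub.one_minus_in_squares[of g] sub.squares_selfadjoint[OF g1] by simp
      have \<iota>g: "\<iota> g = complex_of_real c \<odot>\<^bsub>A\<^esub> ?g"
        using h by (simp add: g_def)
      let ?y = "q \<otimes>\<^bsub>A\<^esub> \<iota> g \<ominus>\<^bsub>A\<^esub> \<iota> g"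
      \<comment> \<open>For r = (1 - g)^n the element 1 - r = g k lies in the ball, so (q - \<iota>
        (1 - r)) \<iota> g is positive, and so is 1/(n + 1) - g r. In their sum the terms with r
        cancel.\<close>
      have step: "?y \<oplus>\<^bsub>A\<^esub> complex_of_real (1 / real (Suc n)) \<odot>\<^bsub>A\<^esub> \<one>\<^bsub>A\<^esub> \<in> squares A" for n
      proof -
        define r where "r = (\<one>\<^bsub>sub\<^esub> \<ominus>\<^bsub>sub\<^esub> g) [^]\<^bsub>sub\<^esub> n"
        have rS: "r \<in> squares sub"
          unfolding r_def by (rule sub.squares_pow[OF g2])
        then have rD [simp]: "r \<in> D"
          by (simp add: sub_squares_iff)
        obtain k where k: "k \<in> squares sub" "\<one>\<^bsub>sub\<^esub> \<ominus>\<^bsub>sub\<^esub> r = g \<otimes>\<^bsub>sub\<^esub> k"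
          unfolding r_def using sub.one_minus_pow[OF g1 g2, of n] by blast
        have kD [simp]: "k \<in> D"
          using k(1) by (simp add: sub_squares_iff)
        have eq1: "\<one> \<ominus> r = g \<otimes> k"
          using k(2) by (simp add: sub_diff)
        have hn: "g \<otimes> k \<in> squares sub"
          using sub.squares_mult[OF g1 k(1)] by simp
        have "g \<otimes> k = (complex_of_real c \<odot> (k \<otimes> h\<^sup>\<star>)) \<otimes> h"
          using h D_comm[of "h\<^sup>\<star> \<otimes> h" k] by (simp add: g_def smult_mult_left m_assoc)
        then have hnJ: "g \<otimes> k \<in> J"
          using ideal(1)[OF _ hJ] h by simp
        have "\<one> \<ominus> g \<otimes> k = r"
        proof -
          have "\<one> \<ominus> (\<one> \<ominus> r) = r"
            using D_carrier[OF rD] by algebra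
          then show ?thesis
            by (simp add: eq1)
        qed
        then have "\<one>\<^bsub>sub\<^esub> \<ominus>\<^bsub>sub\<^esub> g \<otimes> k \<in> squares sub"
          using rS by (simp add: sub_diff)
        then have "nrm C (g \<otimes> k) \<le> 1"
          using sub.norm_le_one[of "g \<otimes> k"] sub.squares_selfadjoint[OF hn]
            sub.squares_add[OF sub.squares_one hn] by simp
        then have "(q \<ominus>\<^bsub>A\<^esub> \<iota> (g \<otimes> k)) \<otimes>\<^bsub>A\<^esub> \<iota> g \<in> squares A"
          using ub' hn hnJ g1 iota_squares by (intro A.squares_mult)
        moreover have "nrm C (g \<otimes> r) \<le> 1 / real (Suc n)"
          unfolding r_def using sub.norm_mult_one_minus_pow[OF g1 g2, of n] by simp
        then have "complex_of_real (1 / real (Suc n)) \<odot>\<^bsub>sub\<^esub> \<one>\<^bsub>sub\<^esub> \<ominus>\<^bsub>sub\<^esub> g \<otimes> r \<in> squares sub"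
          using sub.squares_selfadjoint[OF sub.squares_mult[OF g1 rS]]
          by (intro sub.norm_le_imp_diff_in_squares) auto
        then have "\<iota> (complex_of_real (1 / real (Suc n)) \<odot> \<one> \<ominus> g \<otimes> r) \<in> squares A"
          by (simp add: sub_diff iota_squares del: iota_simps of_nat_Suc of_real_divide)
        ultimately have sum: "(q \<ominus>\<^bsub>A\<^esub> \<iota> (g \<otimes> k)) \<otimes>\<^bsub>A\<^esub> \<iota> g \<oplus>\<^bsub>A\<^esub>
            \<iota> (complex_of_real (1 / real (Suc n)) \<odot> \<one> \<ominus> g \<otimes> r) \<in> squares A"
          by (rule A.squares_add)
        let ?e = "complex_of_real (1 / real (Suc n)) \<odot>\<^bsub>A\<^esub> \<one>\<^bsub>A\<^esub>"
        have "\<iota> (complex_of_real (1 / real (Suc n)) \<odot> \<one> \<ominus> g \<otimes> r) = ?e \<ominus>\<^bsub>A\<^esub> \<iota> g \<otimes>\<^bsub>A\<^esub> \<iota> r"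
          by (simp del: of_nat_Suc of_real_divide)
        moreover have "\<iota> (g \<otimes> k) = \<one>\<^bsub>A\<^esub> \<ominus>\<^bsub>A\<^esub> \<iota> r"
          unfolding eq1[symmetric] by simp
        moreover have "(q \<ominus>\<^bsub>A\<^esub> (\<one>\<^bsub>A\<^esub> \<ominus>\<^bsub>A\<^esub> \<iota> r)) \<otimes>\<^bsub>A\<^esub> \<iota> g \<oplus>\<^bsub>A\<^esub> (?e \<ominus>\<^bsub>A\<^esub> \<iota> g \<otimes>\<^bsub>A\<^esub> \<iota> r) = ?y \<oplus>\<^bsub>A\<^esub> ?e"
        proof -
          have "\<iota> r \<in> carrier A" "\<iota> g \<in> carrier A" "?e \<in> carrier A"
            by simp_all
          then show ?thesis
            using qc by algebra
        qed
        ultimately show ?thesis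
          using sum by simp
      qed
      have "converges A (\<lambda>n. ?y \<oplus>\<^bsub>A\<^esub> complex_of_real (1 / real (Suc n)) \<odot>\<^bsub>A\<^esub> \<one>\<^bsub>A\<^esub>) ?y"
      proof (rule A.converges_bound)
        fix n
        let ?e = "complex_of_real (1 / real (Suc n)) \<odot>\<^bsub>A\<^esub> \<one>\<^bsub>A\<^esub>"
        have "y \<oplus>\<^bsub>A\<^esub> e \<ominus>\<^bsub>A\<^esub> y = e" if "y \<in> carrier A" "e \<in> carrier A" for y e
          using that by algebra
        then have "?y \<oplus>\<^bsub>A\<^esub> ?e \<ominus>\<^bsub>A\<^esub> ?y = ?e"
          by simp
        moreover have "nrm A ?e \<le> 1 / real (Suc n)"
          using A.nrm_one_le by (simp add: A.nrm_smult norm_divide field_simps del: of_nat_Suc)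
        ultimately show "nrm A (?y \<oplus>\<^bsub>A\<^esub> ?e \<ominus>\<^bsub>A\<^esub> ?y) \<le> 1 / real (Suc n)"
          by simp
      qed (use LIMSEQ_Suc[OF lim_1_over_n] in auto)
      then have "?y \<in> squares A"
        using step by (rule A.squares_limit)
      moreover have "?y = complex_of_real c \<odot>\<^bsub>A\<^esub> ((q \<ominus>\<^bsub>A\<^esub> P) \<otimes>\<^bsub>A\<^esub> ?g)"
        unfolding eq \<iota>g using P(2)[OF hJ] h by (simp add: A.smult_mult_right A.smult_diff_right)
      ultimately have "complex_of_real c \<odot>\<^bsub>A\<^esub> ((q \<ominus>\<^bsub>A\<^esub> P) \<otimes>\<^bsub>A\<^esub> ?g) \<in> squares A"
        by (simp only:)
      moreover have "(q \<ominus>\<^bsub>A\<^esub> P) \<otimes>\<^bsub>A\<^esub> ?g \<in> carrier A"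
        using h(3) by simp
      ultimately have "(q \<ominus>\<^bsub>A\<^esub> P) \<otimes>\<^bsub>A\<^esub> ?g \<in> squares A"
        using A.squares_smult_iff c(1) by blast
      then show ?thesis
        by (simp only: h(1))
    qed
  qed
qed

end

section \<open>Normalizers of a MASA\<close>

context abelian_subalgebra
begin

lemmas D_ac = sub.m_ac[simplified]

text \<open>An identity on a closed ideal then has to be checked on generators only. It is applied
  to multiplication by a fixed element and to h \<mapsto> E (v h).\<close>

lemma kernel_closed_ideal:
  assumes X: "cstar_algebra X"
    and F: "\<And>h. h \<in> D \<Longrightarrow> F h \<in> carrier X"
    and add: "\<And>h k. h \<in> D \<Longrightarrow> k \<in> D \<Longrightarrow> F (h \<oplus> k) = F h \<oplus>\<^bsub>X\<^esub> F k"
    and smult: "\<And>c h. h \<in> D \<Longrightarrow> F (c \<odot> h) = c \<odot>\<^bsub>X\<^esub> F h"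
    and absorb: "\<And>h d. h \<in> D \<Longrightarrow> d \<in> D \<Longrightarrow> F h = \<zero>\<^bsub>X\<^esub> \<Longrightarrow> F (h \<otimes> d) = \<zero>\<^bsub>X\<^esub>"
    and bound: "\<And>h. h \<in> D \<Longrightarrow> nrm X (F h) \<le> c * nrm A h"
  shows "ideal {h \<in> D. F h = \<zero>\<^bsub>X\<^esub>} sub \<and> closedin (norm_topology sub) {h \<in> D. F h = \<zero>\<^bsub>X\<^esub>}"
    (is "ideal ?I sub \<and> _")
proof
  interpret X: cstar_algebra X by fact
  have F0: "F \<zero> = \<zero>\<^bsub>X\<^esub>"
    using smult[of \<zero> 0] F[of \<zero>] by simp
  have minus: "F (\<ominus> h) = \<ominus>\<^bsub>X\<^esub> F h" if "h \<in> D" for h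
    using smult[of h "- 1"] F[OF that] that by (simp add: minus_as_smult X.minus_as_smult)
  have diff: "F (h \<ominus> k) = F h \<ominus>\<^bsub>X\<^esub> F k" if "h \<in> D" "k \<in> D" for h k
    using that add[of h "\<ominus> k"] minus by (simp add: minus_eq X.minus_eq)
  show "ideal ?I sub"
  proof (rule idealI)
    have "submodule ?I complex_ring sub"
      using F0 minus smult add by (intro sub.submoduleI) (auto simp: sub_minus)
    then show "subgroup ?I (add_monoid sub)"
      by (rule submodule.axioms)
  qed (use absorb D_comm in \<open>auto intro: sub.ring_axioms\<close>)
  show "closedin (norm_topology sub) ?I"
    unfolding sub.closedin_norm_topology_iff
  proof (intro conjI allI impI)
    fix f l assume *: "range f \<subseteq> ?I \<and> converges sub f l"
    then have f: "f n \<in> D" "F (f n) = \<zero>\<^bsub>X\<^esub>" for n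
      by auto
    have l: "l \<in> D" and lim: "converges A f l"
      using * by (auto simp: sub_converges_iff)
    have "converges X (\<lambda>n. F (f n)) (F l)"
    proof (rule X.converges_bound)
      show "nrm X (F (f n) \<ominus>\<^bsub>X\<^esub> F l) \<le> c * nrm A (f n \<ominus> l)" for n
        using bound[of "f n \<ominus> l"] f l by (simp add: diff)
      show "(\<lambda>n. c * nrm A (f n \<ominus> l)) \<longlonglongrightarrow> 0"
        using lim tendsto_mult_left[of _ 0 _ c] by (fastforce simp: converges_def)
    qed (use F f l in auto)
    moreover have "converges X (\<lambda>n. F (f n)) \<zero>\<^bsub>X\<^esub>"
      unfolding f(2) by (rule X.converges_const) simp
    ultimately show "l \<in> ?I"
      using X.converges_unique l by blast
  qed auto
qed

lemma closed_ideal_gen_minimal: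
  "ideal I sub \<and> closedin (norm_topology sub) I \<Longrightarrow> S \<subseteq> I \<Longrightarrow> closed_ideal_gen sub S \<subseteq> I"
  by (auto simp: closed_ideal_gen_def)

lemma closed_ideal_gen_superset: "S \<subseteq> closed_ideal_gen sub S"
  by (auto simp: closed_ideal_gen_def)

lemma D_closed_ideal: "ideal D sub \<and> closedin (norm_topology sub) D"
proof
  show "ideal D sub"
    using sub.oneideal by simp
  show "closedin (norm_topology sub) D"
    using closedin_topspace[of "norm_topology sub"] by simp
qed

lemma closed_ideal_gen_mult: "x \<in> closed_ideal_gen sub S \<Longrightarrow> d \<in> D \<Longrightarrow> d \<otimes> x \<in> closed_ideal_gen sub S"
  using ideal.I_l_closed[where R = sub] by (fastforce simp: closed_ideal_gen_def)

lemma closed_ideal_gen_zero: "\<zero> \<in> closed_ideal_gen sub S"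
proof -
  have "\<zero> \<in> I" if "ideal I sub" for I
    using additive_subgroup.zero_closed[OF ideal.axioms(1)[OF that]] by simp
  then show ?thesis
    by (auto simp: closed_ideal_gen_def)
qed

lemma mult_kernel_closed_ideal:
  assumes x: "x \<in> carrier A"
  shows "ideal {h \<in> D. x \<otimes> h = \<zero>} sub \<and> closedin (norm_topology sub) {h \<in> D. x \<otimes> h = \<zero>}"
proof (rule kernel_closed_ideal[where c = "nrm A x"])
  show "x \<otimes> (h \<otimes> d) = \<zero>" if "h \<in> D" "d \<in> D" "x \<otimes> h = \<zero>" for h d
    using that x by (simp flip: m_assoc)
qed (use x in \<open>auto simp: r_distr smult_mult_right nrm_mult intro: cstar_algebra_axioms\<close>)

end

locale masa_normalizer = abelian_subalgebra C D for C :: "('c, 'n) cstar_scheme" (structure) and D +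
  fixes v
  assumes masa: "\<And>E. abelian_cstar_subalgebra C E \<Longrightarrow> D \<subseteq> E \<Longrightarrow> E = D"
    and v: "v \<in> normalizers C D"
begin

text \<open>The bicommutant of \<open>D\<close> with x added is an abelian C*-subalgebra containing
  \<open>D\<close>, hence equal to \<open>D\<close>. Self-adjointness keeps the generating set
  closed under the star; \<open>masa_commutant\<close> removes it by the Cartesian
  decomposition.\<close>

lemma masa_selfadjoint:
  assumes x: "x \<in> selfadjoint_elements C" and comm: "\<And>h. h \<in> D \<Longrightarrow> x \<otimes> h = h \<otimes> x"
  shows "x \<in> D"
proof -
  let ?T = "insert x D"
  have T: "?T \<subseteq> carrier C" "\<And>y. y \<in> ?T \<Longrightarrow> y\<^sup>\<star> \<in> ?T"
    using x by auto
  have "y \<otimes> z = z \<otimes> y" if "y \<in> ?T" "z \<in> ?T" for y z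
    using that comm D_comm by (metis insert_iff)
  from bicommutant[OF T this] masa show ?thesis
    by blast
qed

lemma masa_commutant:
  assumes x: "x \<in> carrier C" and comm: "\<And>h. h \<in> D \<Longrightarrow> x \<otimes> h = h \<otimes> x"
  shows "x \<in> D"
proof -
  have star: "x\<^sup>\<star> \<otimes> h = h \<otimes> x\<^sup>\<star>" if h: "h \<in> D" for h
  proof -
    have "(h\<^sup>\<star> \<otimes> x)\<^sup>\<star> = (x \<otimes> h\<^sup>\<star>)\<^sup>\<star>"
      using comm[of "h\<^sup>\<star>"] h by simp
    then show ?thesis
      using x h by (simp add: star_mult)
  qed
  have "(x \<oplus> x\<^sup>\<star>) \<otimes> h = h \<otimes> (x \<oplus> x\<^sup>\<star>)" if "h \<in> D" for h
    using x that comm[OF that] star[OF that] by (simp add: l_distr r_distr)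
  then have 1: "x \<oplus> x\<^sup>\<star> \<in> D"
    by (intro masa_selfadjoint cartesian_decomposition x)
  have "(\<i> \<odot> (x \<ominus> x\<^sup>\<star>)) \<otimes> h = h \<otimes> (\<i> \<odot> (x \<ominus> x\<^sup>\<star>))" if "h \<in> D" for h
    using x that comm[OF that] star[OF that]
    by (simp add: smult_mult_left smult_mult_right minus_eq l_distr r_distr l_minus r_minus)
  then have 2: "\<i> \<odot> (x \<ominus> x\<^sup>\<star>) \<in> D"
    by (intro masa_selfadjoint cartesian_decomposition x)
  have "(1/2) \<odot> (x \<oplus> x\<^sup>\<star> \<oplus> (- \<i>) \<odot> (\<i> \<odot> (x \<ominus> x\<^sup>\<star>))) \<in> D"
    by (rule D_smult[OF D_add[OF 1 D_smult[OF 2]]])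
  then show ?thesis
    unfolding cartesian_decomposition(3)[OF x] .
qed

lemma v_carrier [simp]: "v \<in> carrier C"
  and v_D [simp]: "d \<in> D \<Longrightarrow> v\<^sup>\<star> \<otimes> d \<otimes> v \<in> D" "d \<in> D \<Longrightarrow> v \<otimes> d \<otimes> v\<^sup>\<star> \<in> D"
  using v by (auto simp: normalizers_def)

lemma v_D1 [simp]: "v\<^sup>\<star> \<otimes> v \<in> D" "v \<otimes> v\<^sup>\<star> \<in> D"
  using v_D[of \<one>] by simp_all

abbreviation s where "s \<equiv> v\<^sup>\<star> \<otimes> v"
abbreviation G where "G \<equiv> closed_ideal_gen sub {s}"
abbreviation J where "J \<equiv> J_ideal C D v"
abbreviation K where "K \<equiv> K_ideal C D v"

lemma J_iff: "j \<in> J \<longleftrightarrow> j \<in> D \<and> v \<otimes> j = j \<otimes> v \<and> v \<otimes> j \<in> D \<and> j \<in> G"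
  by (auto simp: J_ideal_def)

text \<open>The kernel of multiplication by d is a closed ideal, so killing the generator
  \<open>s\<close> kills all of \<open>G\<close>.\<close>

lemma perp_iff: "d \<in> ideal_perp sub G \<longleftrightarrow> d \<in> D \<and> d \<otimes> s = \<zero>"
proof
  assume "d \<in> ideal_perp sub G"
  then show "d \<in> D \<and> d \<otimes> s = \<zero>"
    using closed_ideal_gen_superset[of "{s}"] by (auto simp: ideal_perp_def)
next
  assume d: "d \<in> D \<and> d \<otimes> s = \<zero>"
  then have "G \<subseteq> {h \<in> D. d \<otimes> h = \<zero>}"
    by (intro closed_ideal_gen_minimal mult_kernel_closed_ideal) auto
  with d show "d \<in> ideal_perp sub G"
    by (auto simp: ideal_perp_def)
qed

lemma gen_D: "h \<in> D \<Longrightarrow> v\<^sup>\<star> \<otimes> h \<otimes> v \<ominus> h \<otimes> v\<^sup>\<star> \<otimes> v \<in> D"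
  using D_diff[OF v_D(1) D_mult[OF _ v_D1(1)]] by (simp add: m_assoc)

lemma K_minimal:
  assumes I: "ideal I sub \<and> closedin (norm_topology sub) I"
    and perp: "\<And>d. d \<in> D \<Longrightarrow> d \<otimes> s = \<zero> \<Longrightarrow> d \<in> I"
    and gens: "\<And>h. h \<in> D \<Longrightarrow> v\<^sup>\<star> \<otimes> h \<otimes> v \<ominus> h \<otimes> v\<^sup>\<star> \<otimes> v \<in> I"
  shows "K \<subseteq> I"
  unfolding K_ideal_def ideal_join_def
  by (intro closed_ideal_gen_minimal[OF I] Un_least) (use perp gens in \<open>auto simp: perp_iff\<close>)

lemma K_perp: "d \<in> D \<Longrightarrow> d \<otimes> s = \<zero> \<Longrightarrow> d \<in> K"
  using closed_ideal_gen_superset perp_iff unfolding K_ideal_def ideal_join_def by blast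

lemma K_gen:
  assumes "h \<in> D" shows "v\<^sup>\<star> \<otimes> h \<otimes> v \<ominus> h \<otimes> v\<^sup>\<star> \<otimes> v \<in> K"
  unfolding K_ideal_def ideal_join_def
  by (intro subsetD[OF closed_ideal_gen_superset] UnI2 subsetD[OF closed_ideal_gen_superset]) (use assms in blast)

lemma K_D: "K \<subseteq> D"
  by (rule K_minimal[OF D_closed_ideal]) (auto intro: gen_D)

lemma J_mult:
  assumes d: "d \<in> D" and j: "j \<in> J"
  shows "d \<otimes> j \<in> J"
proof -
  have *: "j \<in> D" "v \<otimes> j = j \<otimes> v" "v \<otimes> j \<in> D" "j \<in> G"
    using j unfolding J_iff by blast+
  have "v \<otimes> (d \<otimes> j) = v \<otimes> j \<otimes> d"
    using d *(1) D_comm[OF d *(1)] by (simp add: m_assoc)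
  moreover have "d \<otimes> j \<otimes> v = v \<otimes> j \<otimes> d"
    using d *(1) D_comm[OF d *(3)] by (simp add: m_assoc *(2)[symmetric])
  moreover have "v \<otimes> j \<otimes> d \<in> D"
    using d *(3) by (rule_tac D_mult)
  ultimately show ?thesis
    using d * closed_ideal_gen_mult by (simp add: J_iff)
qed

lemma J_zero: "\<zero> \<in> J"
  using closed_ideal_gen_zero by (simp add: J_iff)

text \<open>The kernel of multiplication by j contains the generators of K. Elements orthogonal to
  \<open>G\<close> kill j, which lies in \<open>G\<close>. For the others, v j lies in
  \<open>D\<close> and commutes with h, so
  \<open>v\<^sup>\<star> h (v j) = v\<^sup>\<star> (v j) h\<close>, which is h s j.\<close>

lemma JK:
  assumes j: "j \<in> J" and k: "k \<in> K"
  shows "j \<otimes> k = \<zero>"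
proof -
  have *: "j \<in> D" "v \<otimes> j \<in> D" "j \<in> G"
    using j unfolding J_iff by blast+
  have "K \<subseteq> {h \<in> D. j \<otimes> h = \<zero>}"
  proof (rule K_minimal)
    show "ideal {h \<in> D. j \<otimes> h = \<zero>} sub \<and> closedin (norm_topology sub) {h \<in> D. j \<otimes> h = \<zero>}"
      using * by (intro mult_kernel_closed_ideal) simp
    show "d \<in> {h \<in> D. j \<otimes> h = \<zero>}" if d: "d \<in> D" "d \<otimes> s = \<zero>" for d
    proof -
      have "d \<otimes> j = \<zero>"
        using perp_iff[of d] d *(3) by (simp add: ideal_perp_def)
      then show ?thesis
        using d * D_comm[of d j] by simp
    qed
    show "v\<^sup>\<star> \<otimes> h \<otimes> v \<ominus> h \<otimes> v\<^sup>\<star> \<otimes> v \<in> {h \<in> D. j \<otimes> h = \<zero>}" if h: "h \<in> D" for h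
    proof -
      have "v\<^sup>\<star> \<otimes> h \<otimes> v \<otimes> j = v\<^sup>\<star> \<otimes> (h \<otimes> (v \<otimes> j))"
        using h * by (simp add: m_assoc)
      also have "h \<otimes> (v \<otimes> j) = v \<otimes> j \<otimes> h"
        using h * by (intro D_comm)
      also have "v\<^sup>\<star> \<otimes> (v \<otimes> j \<otimes> h) = s \<otimes> (j \<otimes> h)"
        using h * by (simp add: m_assoc)
      also have "\<dots> = h \<otimes> s \<otimes> j"
        using h * D_comm[of "j \<otimes> h" s] D_comm[of j h] D_comm[of j s] D_comm[of h s]
        by (metis D_carrier D_mult m_assoc v_D1(1))
      finally have eq: "v\<^sup>\<star> \<otimes> h \<otimes> v \<otimes> j = h \<otimes> s \<otimes> j" .
      have "j \<otimes> (v\<^sup>\<star> \<otimes> h \<otimes> v \<ominus> h \<otimes> v\<^sup>\<star> \<otimes> v) = (v\<^sup>\<star> \<otimes> h \<otimes> v \<ominus> h \<otimes> v\<^sup>\<star> \<otimes> v) \<otimes> j"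
        using * gen_D[OF h] by (intro D_comm)
      also have "\<dots> = v\<^sup>\<star> \<otimes> h \<otimes> v \<otimes> j \<ominus> h \<otimes> s \<otimes> j"
        using h * by (simp add: minus_eq l_distr l_minus m_assoc)
      also have "\<dots> = \<zero>"
        unfolding eq using h * by simp
      finally show ?thesis
        using gen_D[OF h] by simp
    qed
  qed
  then show ?thesis
    using k by blast
qed

text \<open>Both ideals are used in turn. With y = \<open>g\<^sup>\<star> g\<close>, the element t =
  y s lies in J, so g t = 0 and therefore y^2 s = 0. Thus y^2 is orthogonal to s, hence in K, and g
  annihilates it too. So y^3 = 0, which gives y = 0 and g = 0.\<close>

lemma no_annihilator:
  assumes g: "g \<in> D" and gJ: "\<And>j. j \<in> J \<Longrightarrow> g \<otimes> j = \<zero>" and gK: "\<And>k. k \<in> K \<Longrightarrow> g \<otimes> k = \<zero>"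
  shows "g = \<zero>"
proof -
  note [simp] = g
  have key: "v\<^sup>\<star> \<otimes> h \<otimes> v \<otimes> g = h \<otimes> s \<otimes> g" if h: "h \<in> D" for h
  proof -
    have "(v\<^sup>\<star> \<otimes> h \<otimes> v \<ominus> h \<otimes> v\<^sup>\<star> \<otimes> v) \<otimes> g = \<zero>"
      using gK[OF K_gen[OF h]] D_comm[OF g gen_D[OF h]] by simp
    moreover have "(v\<^sup>\<star> \<otimes> h \<otimes> v \<ominus> h \<otimes> v\<^sup>\<star> \<otimes> v) \<otimes> g = v\<^sup>\<star> \<otimes> h \<otimes> v \<otimes> g \<ominus> h \<otimes> s \<otimes> g"
      using h by (simp add: minus_eq l_distr l_minus m_assoc)
    ultimately show ?thesis
      using h by (simp add: diff_eq_zero_iff)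
  qed
  define w where "w = v \<otimes> g"
  have wc [simp]: "w \<in> carrier C"
    by (simp add: w_def)
  have ws: "w\<^sup>\<star> = g\<^sup>\<star> \<otimes> v\<^sup>\<star>"
    by (simp add: w_def star_mult)
  have form: "w\<^sup>\<star> \<otimes> h \<otimes> w = g\<^sup>\<star> \<otimes> (h \<otimes> s \<otimes> g)" if h: "h \<in> D" for h
  proof -
    have "w\<^sup>\<star> \<otimes> h \<otimes> w = g\<^sup>\<star> \<otimes> (v\<^sup>\<star> \<otimes> h \<otimes> v \<otimes> g)"
      unfolding ws unfolding w_def using h by (simp add: m_assoc)
    then show ?thesis
      by (simp only: key[OF h])
  qed
  have ww: "w\<^sup>\<star> \<otimes> w = g\<^sup>\<star> \<otimes> (s \<otimes> g)"
    using form[of \<one>] by simp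
  \<comment> \<open>The commutator u has \<open>u\<^sup>\<star> u = 0\<close>: expanded, this
    product contains w only in expressions \<open>w\<^sup>\<star> d w\<close> with d in
    \<open>D\<close>, and \<open>ww\<close> and \<open>form\<close> rewrite these inside the abelian
    algebra \<open>D\<close>.\<close>
  have "w \<otimes> h = h \<otimes> w" if h: "h \<in> D" for h
  proof -
    let ?u = "w \<otimes> h \<ominus> h \<otimes> w"
    note [simp] = h
    have us: "?u\<^sup>\<star> = h\<^sup>\<star> \<otimes> w\<^sup>\<star> \<ominus> w\<^sup>\<star> \<otimes> h\<^sup>\<star>"
      by (simp add: star_simps)
    have "?u\<^sup>\<star> \<otimes> ?u = (h\<^sup>\<star> \<otimes> (w\<^sup>\<star> \<otimes> w) \<otimes> h \<ominus> h\<^sup>\<star> \<otimes> (w\<^sup>\<star> \<otimes> h \<otimes> w)) \<ominus>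
        (w\<^sup>\<star> \<otimes> h\<^sup>\<star> \<otimes> w \<otimes> h \<ominus> w\<^sup>\<star> \<otimes> (h\<^sup>\<star> \<otimes> h) \<otimes> w)"
    proof -
      have "h \<in> carrier C" "h\<^sup>\<star> \<in> carrier C" "w \<in> carrier C" "w\<^sup>\<star> \<in> carrier C"
        by simp_all
      then show ?thesis
        unfolding us by algebra
    qed
    also have "\<dots> = (h\<^sup>\<star> \<otimes> (g\<^sup>\<star> \<otimes> (s \<otimes> g)) \<otimes> h \<ominus> h\<^sup>\<star> \<otimes> (g\<^sup>\<star> \<otimes> (h \<otimes> s \<otimes> g))) \<ominus>
        (g\<^sup>\<star> \<otimes> (h\<^sup>\<star> \<otimes> s \<otimes> g) \<otimes> h \<ominus> g\<^sup>\<star> \<otimes> (h\<^sup>\<star> \<otimes> h \<otimes> s \<otimes> g))"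
      by (simp only: ww form[OF h] form[OF D_star[OF h]] form[OF D_mult[OF D_star[OF h] h]])
    also have "\<dots> = \<zero>"
    proof -
      define p where "p = s"
      have p [simp]: "p \<in> D"
        by (simp add: p_def)
      have 1: "h\<^sup>\<star> \<otimes> (g\<^sup>\<star> \<otimes> (p \<otimes> g)) \<otimes> h = h\<^sup>\<star> \<otimes> (g\<^sup>\<star> \<otimes> (h \<otimes> p \<otimes> g))"
        by (simp add: D_ac)
      have 2: "g\<^sup>\<star> \<otimes> (h\<^sup>\<star> \<otimes> p \<otimes> g) \<otimes> h = g\<^sup>\<star> \<otimes> (h\<^sup>\<star> \<otimes> h \<otimes> p \<otimes> g)"
        by (simp add: D_ac)
      show ?thesis
        unfolding p_def[symmetric] 1 2 by simp
    qed
    finally have "?u = \<zero>"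
      by (rule star_mult_eq_zero[rotated]) simp
    then show ?thesis
      by (simp add: diff_eq_zero_iff)
  qed
  then have wD [simp]: "w \<in> D"
    by (intro masa_commutant) auto
  \<comment> \<open>As w is normal, t can be written as \<open>w w\<^sup>\<star>\<close> and as
    \<open>g g\<^sup>\<star> s\<close>. The first form computes t v and the second v t; both are
    \<open>w g\<^sup>\<star> s\<close>, an element of \<open>D\<close>.\<close>
  define t where "t = g\<^sup>\<star> \<otimes> g \<otimes> s"
  have tD [simp]: "t \<in> D"
    using D_mult[OF D_mult[OF D_star[OF g] g] v_D1(1)] by (simp add: t_def)
  have tw: "t = w \<otimes> w\<^sup>\<star>"
  proof -
    have "w \<otimes> w\<^sup>\<star> = w\<^sup>\<star> \<otimes> w"
      by (intro D_comm) auto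
    also have "\<dots> = t"
      unfolding ww t_def using D_comm[OF g v_D1(1)] by (simp add: m_assoc)
    finally show ?thesis ..
  qed
  have gs: "g\<^sup>\<star> \<otimes> s \<in> D"
    using D_mult[OF D_star[OF g] v_D1(1)] .
  have tv: "t \<otimes> v = w \<otimes> (g\<^sup>\<star> \<otimes> s)"
    unfolding tw ws by (simp add: m_assoc)
  have vt: "v \<otimes> t = w \<otimes> (g\<^sup>\<star> \<otimes> s)"
  proof -
    have "t = g \<otimes> (g\<^sup>\<star> \<otimes> s)"
      unfolding t_def using D_comm[OF D_star[OF g] g] by (simp add: m_assoc)
    then show ?thesis
      unfolding w_def by (simp add: m_assoc)
  qed
  have "t \<in> G"
    unfolding t_def using closed_ideal_gen_superset[of "{s}"]
    by (rule_tac closed_ideal_gen_mult) auto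
  then have "t \<in> J"
    using tv vt D_mult[OF wD gs] by (simp add: J_iff)
  then have gt: "g \<otimes> t = \<zero>"
    by (rule gJ)
  define y where "y = g\<^sup>\<star> \<otimes> g"
  have y [simp]: "y \<in> D" "y\<^sup>\<star> = y"
    by (simp_all add: y_def star_mult)
  have "y \<otimes> y \<otimes> s = g\<^sup>\<star> \<otimes> (g \<otimes> t)"
    unfolding y_def t_def by (simp add: m_assoc)
  then have "y \<otimes> y \<in> K"
    by (intro K_perp) (simp_all add: gt)
  then have "g \<otimes> (y \<otimes> y) = \<zero>"
    by (rule gK)
  then have "g\<^sup>\<star> \<otimes> (g \<otimes> (y \<otimes> y)) = \<zero>"
    by simp
  then have "y \<otimes> (y \<otimes> y) = \<zero>"
    unfolding y_def by (simp add: m_assoc)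
  then have "(y \<otimes> y)\<^sup>\<star> \<otimes> (y \<otimes> y) = \<zero>"
    by (simp add: star_mult m_assoc)
  then have "y\<^sup>\<star> \<otimes> y = \<zero>"
    using star_mult_eq_zero[of "y \<otimes> y"] by simp
  then have "y = \<zero>"
    by (rule star_mult_eq_zero[rotated]) simp
  then show "g = \<zero>"
    unfolding y_def by (rule star_mult_eq_zero[rotated]) simp
qed

end

section \<open>Pseudo-expectations: bimodule property and vanishing on K\<close>

locale expectation = abelian_extension C D A \<iota>
  for C :: "('c, 'n) cstar_scheme" (structure) and D and A :: "('i, 'm) cstar_scheme" and \<iota> +
  fixes E assumes E: "pseudo_expectation C D A \<iota> E"
begin

sublocale E: ucp_map C A E
  using E by unfold_locales (simp add: pseudo_expectation_def)

lemma E_D: "d \<in> D \<Longrightarrow> E d = \<iota> d"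
  using E by (simp add: pseudo_expectation_def)

lemma E_right: 
  assumes x: "x \<in> carrier C" and d: "d \<in> D"
  shows "E (x \<otimes> d) = E x \<otimes>\<^bsub>A\<^esub> \<iota> d"
proof -
  have "E (d\<^sup>\<star> \<otimes> d) = (E d)\<^sup>\<star>\<^bsub>A\<^esub> \<otimes>\<^bsub>A\<^esub> E d"
    using d by (simp add: E_D)
  from E.map_multiplicative_domain[OF D_carrier[OF d] this x] show ?thesis
    by (simp only: E_D[OF d])
qed

lemma E_left: 
  assumes x: "x \<in> carrier C" and d: "d \<in> D"
  shows "E (d \<otimes> x) = \<iota> d \<otimes>\<^bsub>A\<^esub> E x"
proof -
  have "d \<otimes> x = (x\<^sup>\<star> \<otimes> d\<^sup>\<star>)\<^sup>\<star>"
    using x d by (simp add: star_mult)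
  then have "E (d \<otimes> x) = (E (x\<^sup>\<star> \<otimes> d\<^sup>\<star>))\<^sup>\<star>\<^bsub>A\<^esub>"
    using x d by (simp only: E.map_star star_closed m_closed D_carrier)
  also have "E (x\<^sup>\<star> \<otimes> d\<^sup>\<star>) = (E x)\<^sup>\<star>\<^bsub>A\<^esub> \<otimes>\<^bsub>A\<^esub> (\<iota> d)\<^sup>\<star>\<^bsub>A\<^esub>"
    using x d by (simp add: E_right E.map_star)
  finally show ?thesis
    using x d by (simp add: A.star_mult)
qed

text \<open>The set of h with E (v h) = 0 is a closed ideal, so generators suffice. If d s = 0, then
  v d itself is 0 by the C*-identity. For a generator coming from h, put p =
  \<open>v v\<^sup>\<star>\<close>: v times it equals h p v - v h s, whose image under E is the
  difference of \<iota> h E (p v) and E (v s) \<iota> h. As p v = v s and \<open>A\<close> is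
  abelian, this vanishes.\<close>

lemma E_K:
  assumes "masa_normalizer C D v" and h: "h \<in> K_ideal C D v"
  shows "E (v \<otimes> h) = \<zero>\<^bsub>A\<^esub>"
proof -
  interpret N: masa_normalizer C D v by fact
  have "N.K \<subseteq> {h \<in> D. E (v \<otimes> h) = \<zero>\<^bsub>A\<^esub>}"
  proof (rule N.K_minimal)
    show "ideal {h \<in> D. E (v \<otimes> h) = \<zero>\<^bsub>A\<^esub>} sub \<and> closedin (norm_topology sub) {h \<in> D. E (v \<otimes> h) = \<zero>\<^bsub>A\<^esub>}"
    proof (rule kernel_closed_ideal[where c = "4 * nrm C v"])
      show "cstar_algebra A" by unfold_locales
      show "E (v \<otimes> (h \<otimes> d)) = \<zero>\<^bsub>A\<^esub>" if "h \<in> D" "d \<in> D" "E (v \<otimes> h) = \<zero>\<^bsub>A\<^esub>" for h d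
        using that E_right[of "v \<otimes> h" d] by (simp add: m_assoc)
      show "nrm A (E (v \<otimes> h)) \<le> 4 * nrm C v * nrm C h" if "h \<in> D" for h
        using that E.map_norm_le[of "v \<otimes> h"] nrm_mult[of v h] by simp
    qed (simp_all add: r_distr smult_mult_right E.map_add E.map_smult)
    show "d \<in> {h \<in> D. E (v \<otimes> h) = \<zero>\<^bsub>A\<^esub>}" if d: "d \<in> D" "d \<otimes> N.s = \<zero>" for d
    proof -
      have "(v \<otimes> d)\<^sup>\<star> \<otimes> (v \<otimes> d) = d\<^sup>\<star> \<otimes> (N.s \<otimes> d)"
        using d(1) by (simp add: star_mult m_assoc)
      also have "N.s \<otimes> d = \<zero>"
        using d D_comm[OF d(1) N.v_D1(1)] by simp
      finally have "(v \<otimes> d)\<^sup>\<star> \<otimes> (v \<otimes> d) = \<zero>"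
        using d(1) by simp
      then have "v \<otimes> d = \<zero>"
        by (rule star_mult_eq_zero[rotated]) (use d in simp)
      then show ?thesis
        using d(1) by simp
    qed
    show "v\<^sup>\<star> \<otimes> h \<otimes> v \<ominus> h \<otimes> v\<^sup>\<star> \<otimes> v \<in> {h \<in> D. E (v \<otimes> h) = \<zero>\<^bsub>A\<^esub>}" if h: "h \<in> D" for h
    proof -
      define p where "p = v \<otimes> v\<^sup>\<star>"
      have p [simp]: "p \<in> D"
        by (simp add: p_def)
      have "v \<otimes> (v\<^sup>\<star> \<otimes> h \<otimes> v \<ominus> h \<otimes> v\<^sup>\<star> \<otimes> v) = (h \<otimes> p) \<otimes> v \<ominus> v \<otimes> (h \<otimes> N.s)"
      proof -
        have "v \<otimes> (v\<^sup>\<star> \<otimes> h \<otimes> v) = p \<otimes> h \<otimes> v"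
          using h by (simp add: p_def m_assoc)
        moreover have "p \<otimes> h = h \<otimes> p"
          using h by (intro D_comm) auto
        ultimately show ?thesis
          using h by (simp add: minus_eq r_distr r_minus m_assoc)
      qed
      then have "E (v \<otimes> (v\<^sup>\<star> \<otimes> h \<otimes> v \<ominus> h \<otimes> v\<^sup>\<star> \<otimes> v)) = E ((h \<otimes> p) \<otimes> v) \<ominus>\<^bsub>A\<^esub> E (v \<otimes> (h \<otimes> N.s))"
        using h by (simp add: E.map_diff)
      moreover have "E ((h \<otimes> p) \<otimes> v) = \<iota> h \<otimes>\<^bsub>A\<^esub> E (p \<otimes> v)"
        using h by (simp add: E_left A.m_assoc)
      moreover have "p \<otimes> v = v \<otimes> N.s"
        by (simp add: p_def m_assoc)
      moreover have "E (v \<otimes> (h \<otimes> N.s)) = \<iota> h \<otimes>\<^bsub>A\<^esub> E (v \<otimes> N.s)"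
        using h E_right[of v "h \<otimes> N.s"] E_right[of v N.s] N.v_D1(1) iota_simps(3)[OF h N.v_D1(1)]
        by (simp add: A.m_lcomm)
      ultimately show ?thesis
        using N.gen_D[OF h] h by simp
    qed
  qed
  then show ?thesis
    using h by blast
qed

end

section \<open>Existence, uniqueness and the modulus formula\<close>

lemma pseudo_expectation_cong:
  assumes C: "cstar_algebra C" and D: "D \<subseteq> carrier C" and E: "pseudo_expectation C D A \<iota> E"
    and eq: "\<And>x. x \<in> carrier C \<Longrightarrow> E' x = E x"
  shows "pseudo_expectation C D A \<iota> E'"
proof -
  interpret cstar_algebra C by fact
  have amp: "amplify E' M = amplify E M"
    if "M \<in> positive_elements (matrix_algebra n C)" "\<forall>i<n. \<forall>j<n. M i j \<in> carrier C" for n M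
  proof (intro ext)
    fix i j
    \<comment> \<open>\<open>amplify\<close> also acts outside the n by n block. There the entries
      are 0, an element of the carrier, where the two maps agree.\<close>
    have "\<not> (i < n \<and> j < n) \<Longrightarrow> M i j = \<zero>\<^bsub>C\<^esub>"
      using that(1) unfolding positive_matrix_iff by blast
    then have "M i j \<in> carrier C"
      using that(2) by (cases "i < n \<and> j < n") auto
    then show "amplify E' M i j = amplify E M i j"
      by (simp add: amplify_def eq)
  qed
  have "ucp C (carrier C) A E'"
    using E unfolding pseudo_expectation_def ucp_def by (simp add: eq amp Pi_iff)
  then show ?thesis
    using E D eq by (auto simp: pseudo_expectation_def)
qed

text \<open>Makes pairs over the type of \<open>A\<close> available to
  \<open>injective_cstar_extend\<close>. A pair is encoded by \<phi> \<mapsto> \<phi> a + (\<phi>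
  b)^2: replacing \<phi> by -\<phi> changes the sign of the first term only, so indicator functions
  and their negatives recover a and b in this order.\<close>

lemma sum_pair_injection:
  "\<exists>f :: 'i \<times> 'i \<Rightarrow> 'c + (('i \<Rightarrow> complex) \<Rightarrow> complex). inj f"
proof -
  define F :: "'i \<times> 'i \<Rightarrow> ('i \<Rightarrow> complex) \<Rightarrow> complex" where "F = (\<lambda>(a, b) \<phi>. \<phi> a + (\<phi> b)\<^sup>2)"
  have "a = a' \<and> b = b'" if eq: "F (a, b) = F (a', b')" for a b a' b' :: 'i
  proof -
    define \<delta> where "\<delta> c x = (\<lambda>z :: 'i. if z = x then c else (0 :: complex))" for c x
    have F: "F (a, b) (\<delta> c x) = F (a', b') (\<delta> c x)" for c x
      using eq by simp
    show ?thesis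
      using F[of 1 a] F[of "- 1" a] F[of 1 b] F[of "- 1" b]
      by (auto simp: F_def \<delta>_def split: if_splits)
  qed
  then have "inj F"
    by (intro injI) (metis surj_pair)
  then have "inj (Inr \<circ> F :: 'i \<times> 'i \<Rightarrow> 'c + (('i \<Rightarrow> complex) \<Rightarrow> complex))"
    by (intro inj_compose) auto
  then show ?thesis
    by (intro exI)
qed

theorem theorem3p10:
  fixes C :: "'c cstar" and D :: "'c set" and A :: "'i cstar" and \<iota> :: "'c \<Rightarrow> 'i"
  assumes "regular_MASA_inclusion C D"
    and "injective_envelope TYPE('c + (('i \<Rightarrow> complex) \<Rightarrow> complex)) (C\<lparr>carrier := D\<rparr>) A \<iota>"
  shows "(\<exists>!E. E \<in> extensional (carrier C) \<and> pseudo_expectation C D A \<iota> E) \<and>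
    (\<forall>E. pseudo_expectation C D A \<iota> E \<longrightarrow> (\<forall>v \<in> normalizers C D.
       (\<forall>h \<in> J_ideal C D v. E (v \<otimes>\<^bsub>C\<^esub> h) = \<iota> (v \<otimes>\<^bsub>C\<^esub> h)) \<and>
       (\<forall>h \<in> K_ideal C D v. E (v \<otimes>\<^bsub>C\<^esub> h) = \<zero>\<^bsub>A\<^esub>) \<and>
       (\<exists>P. is_sup A (\<iota> ` J_positive_ball C D v) P \<and>
            (E v)\<^sup>\<star>\<^bsub>A\<^esub> \<otimes>\<^bsub>A\<^esub> E v = \<iota> (v\<^sup>\<star>\<^bsub>C\<^esub> \<otimes>\<^bsub>C\<^esub> v) \<otimes>\<^bsub>A\<^esub> P)))"
proof -
  have incl: "inclusion C D"
    and dense: "norm_topology C closure_of linear_span C (normalizers C D) = carrier C"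
    and masa: "\<And>E. abelian_cstar_subalgebra C E \<Longrightarrow> D \<subseteq> E \<Longrightarrow> E = D"
    using assms(1) by (auto simp: regular_MASA_inclusion_def regular_inclusion_def MASA_inclusion_def)
  have inj: "injective_cstar TYPE('c + (('i \<Rightarrow> complex) \<Rightarrow> complex)) A"
    and rigid: "rigid_extension (C\<lparr>carrier := D\<rparr>) A \<iota>"
    and hom: "\<iota> \<in> cstar_hom (C\<lparr>carrier := D\<rparr>) A" and inj_iota: "inj_on \<iota> D"
    and A: "cstar_algebra A" "cring A"
    using assms(2) by (simp_all add: injective_envelope_def)
  obtain f :: "'i \<times> 'i \<Rightarrow> 'c + (('i \<Rightarrow> complex) \<Rightarrow> complex)" where f: "inj f"
    using sum_pair_injection by blast
  interpret abelian_extension C D A \<iota>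
    using incl A hom inj_iota
    by (simp add: abelian_extension_def abelian_subalgebra_def abelian_subalgebra_axioms_def
        abelian_extension_axioms_def comm_cstar_algebra_def inclusion_def)
  have N: "masa_normalizer C D v" if "v \<in> normalizers C D" for v
    using masa that by unfold_locales auto
  \<comment> \<open>The splitting is made anew for each normalizer. Its annihilator part proves
    equalities in \<open>A\<close>, both for uniqueness and for the modulus; the element P enters
    the modulus.\<close>
  have split: "(\<forall>a\<in>carrier A. (\<forall>j\<in>J_ideal C D v. a \<otimes>\<^bsub>A\<^esub> \<iota> j = \<zero>\<^bsub>A\<^esub>) \<and>
        (\<forall>k\<in>K_ideal C D v. a \<otimes>\<^bsub>A\<^esub> \<iota> k = \<zero>\<^bsub>A\<^esub>) \<longrightarrow> a = \<zero>\<^bsub>A\<^esub>) \<and>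
      (\<exists>P\<in>carrier A. (\<forall>j\<in>J_ideal C D v. P \<otimes>\<^bsub>A\<^esub> \<iota> j = \<iota> j) \<and> (\<forall>k\<in>K_ideal C D v. P \<otimes>\<^bsub>A\<^esub> \<iota> k = \<zero>\<^bsub>A\<^esub>) \<and>
        is_sup A (\<iota> ` J_positive_ball C D v) P)"
    if v: "v \<in> normalizers C D" for v
  proof -
    interpret N: masa_normalizer C D v
      by (rule N[OF v])
    interpret S: complementary_subsets C D A \<iota> N.J N.K
    proof
      show "N.J \<subseteq> D"
        using N.J_iff by blast
    qed (use N.K_D N.JK N.no_annihilator in blast)+
    note sp = S.rigid_injective_split[OF inj rigid f]
    then obtain P where P: "P \<in> squares A" "\<And>j. j \<in> N.J \<Longrightarrow> P \<otimes>\<^bsub>A\<^esub> \<iota> j = \<iota> j"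
      "\<And>k. k \<in> N.K \<Longrightarrow> P \<otimes>\<^bsub>A\<^esub> \<iota> k = \<zero>\<^bsub>A\<^esub>"
      by blast
    have "is_sup A (\<iota> ` {h \<in> N.J. h \<in> positive_elements sub \<and> nrm C h \<le> 1}) P"
      by (rule S.is_sup_positive_ball[OF N.J_mult N.J_zero _ P]) (use sp in blast)+
    then show ?thesis
      using sp P A.squares_carrier[OF P(1)] unfolding J_positive_ball_def by blast
  qed
  have eJ: "E (v \<otimes>\<^bsub>C\<^esub> h) = \<iota> (v \<otimes>\<^bsub>C\<^esub> h)"
    if "pseudo_expectation C D A \<iota> E" "h \<in> J_ideal C D v" for E v h
    using that unfolding pseudo_expectation_def J_ideal_def by blast
  have eK: "E (v \<otimes>\<^bsub>C\<^esub> h) = \<zero>\<^bsub>A\<^esub>"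
    if "pseudo_expectation C D A \<iota> E" "v \<in> normalizers C D" "h \<in> K_ideal C D v" for E v h
  proof -
    interpret E: expectation C D A \<iota> E
      using that(1) by unfold_locales
    show ?thesis
      by (rule E.E_K[OF N[OF that(2)] that(3)])
  qed
  have agree: "E v = E' v" if E: "pseudo_expectation C D A \<iota> E" and E': "pseudo_expectation C D A \<iota> E'"
    and v: "v \<in> normalizers C D" for E E' v
  proof -
    interpret N: masa_normalizer C D v
      by (rule N[OF v])
    interpret E: expectation C D A \<iota> E
      using E by unfold_locales
    interpret E': expectation C D A \<iota> E'
      using E' by unfold_locales
    \<comment> \<open>By the bimodule property, testing E v - E' v against \<iota> h compares the
      two maps at v h. On J both values are \<iota> (v h), on K both are 0.\<close>
    have diff: "(E v \<ominus>\<^bsub>A\<^esub> E' v) \<otimes>\<^bsub>A\<^esub> \<iota> h = E (v \<otimes>\<^bsub>C\<^esub> h) \<ominus>\<^bsub>A\<^esub> E' (v \<otimes>\<^bsub>C\<^esub> h)" if "h \<in> D" for h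
      using that by (simp add: E.E_right E'.E_right A.minus_eq A.l_distr A.l_minus)
    have "(E v \<ominus>\<^bsub>A\<^esub> E' v) \<otimes>\<^bsub>A\<^esub> \<iota> j = \<zero>\<^bsub>A\<^esub>" if j: "j \<in> N.J" for j
    proof -
      have "j \<in> D" "v \<otimes>\<^bsub>C\<^esub> j \<in> D"
        using j by (auto simp: N.J_iff)
      then show ?thesis
        using eJ[OF E j] eJ[OF E' j] by (simp add: diff)
    qed
    moreover have "(E v \<ominus>\<^bsub>A\<^esub> E' v) \<otimes>\<^bsub>A\<^esub> \<iota> k = \<zero>\<^bsub>A\<^esub>" if k: "k \<in> N.K" for k
      using eK[OF E v k] eK[OF E' v k] N.K_D k by (simp add: diff subsetD)
    ultimately have "E v \<ominus>\<^bsub>A\<^esub> E' v = \<zero>\<^bsub>A\<^esub>"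
      using split[OF v] by simp
    then show ?thesis
      by (simp add: A.diff_eq_zero_iff)
  qed
  have unique: "E x = E' x" if E: "pseudo_expectation C D A \<iota> E" and E': "pseudo_expectation C D A \<iota> E'"
    and x: "x \<in> carrier C" for E E' x
  proof -
    interpret E: expectation C D A \<iota> E
      using E by unfold_locales
    interpret E': expectation C D A \<iota> E'
      using E' by unfold_locales
    \<comment> \<open>The agreement set is a closed subspace containing the normalizers; regularity
      makes it everything.\<close>
    let ?Z = "{x \<in> carrier C. E x = E' x}"
    have "submodule ?Z complex_ring C"
      by (intro submoduleI) (auto simp: E.E.map_add E'.E.map_add E.E.map_minus E'.E.map_minus E.E.map_smult E'.E.map_smult)
    moreover have "normalizers C D \<subseteq> ?Z"
      using agree[OF E E'] by (auto simp: normalizers_def)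
    ultimately have "linear_span C (normalizers C D) \<subseteq> ?Z"
      unfolding linear_span_def by blast
    moreover have "closedin (norm_topology C) ?Z"
      unfolding closedin_norm_topology_iff
    proof (intro conjI allI impI)
      fix f l assume *: "range f \<subseteq> ?Z \<and> converges C f l"
      then have "E (f n) = E' (f n)" for n
        by auto
      then have "E l = E' l"
        using E.E.map_converges[of f l] E'.E.map_converges[of f l] * A.converges_unique by simp
      then show "l \<in> ?Z"
        using * converges_closed by blast
    qed auto
    ultimately have "norm_topology C closure_of linear_span C (normalizers C D) \<subseteq> ?Z"
      by (rule closure_of_minimal)
    then show ?thesis
      using dense x by blast
  qed
  have modulus: "\<exists>P. is_sup A (\<iota> ` J_positive_ball C D v) P \<and>
      (E v)\<^sup>\<star>\<^bsub>A\<^esub> \<otimes>\<^bsub>A\<^esub> E v = \<iota> (v\<^sup>\<star>\<^bsub>C\<^esub> \<otimes>\<^bsub>C\<^esub> v) \<otimes>\<^bsub>A\<^esub> P"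
    if E: "pseudo_expectation C D A \<iota> E" and v: "v \<in> normalizers C D" for E v
  proof -
    interpret N: masa_normalizer C D v
      by (rule N[OF v])
    interpret E: expectation C D A \<iota> E
      using E by unfold_locales
    obtain P where P: "P \<in> carrier A" "\<And>j. j \<in> N.J \<Longrightarrow> P \<otimes>\<^bsub>A\<^esub> \<iota> j = \<iota> j"
      "\<And>k. k \<in> N.K \<Longrightarrow> P \<otimes>\<^bsub>A\<^esub> \<iota> k = \<zero>\<^bsub>A\<^esub>" "is_sup A (\<iota> ` J_positive_ball C D v) P"
      using split[OF v] by blast
    let ?a = "(E v)\<^sup>\<star>\<^bsub>A\<^esub> \<otimes>\<^bsub>A\<^esub> E v" and ?s = "\<iota> N.s"
    have c: "?a \<in> carrier A" "?s \<in> carrier A" "?s \<otimes>\<^bsub>A\<^esub> P \<in> carrier A"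
      using P(1) iota_simps(1)[OF N.v_D1(1)] by auto
    \<comment> \<open>The difference of the two sides is tested on J and K. For j,
      \<open>(E v)\<^sup>\<star> E (v j)\<close> becomes E of \<open>v\<^sup>\<star> v j\<close>,
      because v j lies in \<open>D\<close>, and P \<iota> j = \<iota> j. For k both terms
      vanish.\<close>
    have diff: "(?a \<ominus>\<^bsub>A\<^esub> ?s \<otimes>\<^bsub>A\<^esub> P) \<otimes>\<^bsub>A\<^esub> \<iota> h = (E v)\<^sup>\<star>\<^bsub>A\<^esub> \<otimes>\<^bsub>A\<^esub> E (v \<otimes>\<^bsub>C\<^esub> h) \<ominus>\<^bsub>A\<^esub> ?s \<otimes>\<^bsub>A\<^esub> (P \<otimes>\<^bsub>A\<^esub> \<iota> h)"
      if "h \<in> D" for h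
      using that c P(1) by (simp add: E.E_right A.minus_eq A.l_distr A.l_minus A.m_assoc del: iota_simps(3))
    have "(?a \<ominus>\<^bsub>A\<^esub> ?s \<otimes>\<^bsub>A\<^esub> P) \<otimes>\<^bsub>A\<^esub> \<iota> j = \<zero>\<^bsub>A\<^esub>" if j: "j \<in> N.J" for j
    proof -
      have jD: "j \<in> D" "v \<otimes>\<^bsub>C\<^esub> j \<in> D"
        using j by (auto simp: N.J_iff)
      have "(E v)\<^sup>\<star>\<^bsub>A\<^esub> \<otimes>\<^bsub>A\<^esub> E (v \<otimes>\<^bsub>C\<^esub> j) = E (v\<^sup>\<star>\<^bsub>C\<^esub>) \<otimes>\<^bsub>A\<^esub> \<iota> (v \<otimes>\<^bsub>C\<^esub> j)"
        using jD by (simp only: E.E.map_star N.v_carrier E.E_D)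
      also have "\<dots> = E (v\<^sup>\<star>\<^bsub>C\<^esub> \<otimes>\<^bsub>C\<^esub> (v \<otimes>\<^bsub>C\<^esub> j))"
        using jD by (intro E.E_right[symmetric]) auto
      also have "v\<^sup>\<star>\<^bsub>C\<^esub> \<otimes>\<^bsub>C\<^esub> (v \<otimes>\<^bsub>C\<^esub> j) = N.s \<otimes>\<^bsub>C\<^esub> j"
        using jD by (simp add: m_assoc)
      also have "E (N.s \<otimes>\<^bsub>C\<^esub> j) = ?s \<otimes>\<^bsub>A\<^esub> \<iota> j"
        using jD N.v_D1(1) by (simp only: E.E_D D_mult iota_simps(3))
      finally show ?thesis
        using diff[OF jD(1)] P(2)[OF j] c jD by (simp only: A.diff_self A.m_closed iota_simps(1))
    qed
    moreover have "(?a \<ominus>\<^bsub>A\<^esub> ?s \<otimes>\<^bsub>A\<^esub> P) \<otimes>\<^bsub>A\<^esub> \<iota> k = \<zero>\<^bsub>A\<^esub>" if k: "k \<in> N.K" for k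
      using diff[of k] eK[OF E v k] P(3)[OF k] N.K_D k c
      by (simp add: subsetD A.minus_eq del: iota_simps(3))
    moreover have "?a \<ominus>\<^bsub>A\<^esub> ?s \<otimes>\<^bsub>A\<^esub> P \<in> carrier A"
      using c by simp
    ultimately have "?a \<ominus>\<^bsub>A\<^esub> ?s \<otimes>\<^bsub>A\<^esub> P = \<zero>\<^bsub>A\<^esub>"
      using split[OF v] by blast
    then have "?a = ?s \<otimes>\<^bsub>A\<^esub> P"
      using c A.diff_eq_zero_iff by blast
    with P(4) show ?thesis
      by blast
  qed
  have "\<exists>E. E \<in> extensional (carrier C) \<and> pseudo_expectation C D A \<iota> E"
  proof -
    \<comment> \<open>The left summand of the type holds C itself, so \<iota> on the operator system
      \<open>D\<close> extends to C.\<close>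
    have "inj_on (Inl :: 'c \<Rightarrow> 'c + (('i \<Rightarrow> complex) \<Rightarrow> complex)) (carrier C)"
      by simp
    moreover have "operator_system C D"
      using subcringE(1)[OF subcring] by (simp add: operator_system_iff)
    ultimately obtain E where E: "ucp C (carrier C) A E" "\<forall>d\<in>D. E d = \<iota> d"
      using injective_cstar_extend[OF inj cstar_algebra_axioms _ _ iota_ucp] by blast
    then have "pseudo_expectation C D A \<iota> E"
      unfolding pseudo_expectation_def by blast
    \<comment> \<open>HOL functions are total; restricting to the carrier fixes the values outside
      it, which uniqueness among extensional maps refers to.\<close>
    then have "pseudo_expectation C D A \<iota> (restrict E (carrier C))"
      by (rule pseudo_expectation_cong[OF cstar_algebra_axioms subcringE(1)[OF subcring]]) simp
    then show ?thesis
      by (intro exI[of _ "restrict E (carrier C)"]) simp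
  qed
  moreover have "E = E'" if "E \<in> extensional (carrier C)" "pseudo_expectation C D A \<iota> E"
    "E' \<in> extensional (carrier C)" "pseudo_expectation C D A \<iota> E'" for E E'
    by (rule extensionalityI[OF that(1,3)]) (rule unique[OF that(2,4)])
  ultimately show ?thesis
    using eJ eK modulus by blast
qed

end
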